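(* There exist an absolute constant $c>0$ and a randomized polynomial-time algorithm with the following guarantee. For every integer $d\ge 1$, every weighted undirected graph $G=(V,E,w)$ with nonnegative edge weights, and every feasible $d$-dimensional solution $\{v_i\in\mathbb{R}^d\}_{i\in V}$ of the Max-Cut SDP strengthened with triangle inequalities (defined in the context), the algorithm, given $G$ and $\{v_i\}_{i\in V}$, outputs a cut $x\in\{\pm1\}^V$ whose expected value satisfies \[ \mathbb{E}\Big[\sum_{(i,j)\in E:\ x_i\neq x_j} w_{ij}\Big]\ \ge\ \bigl(\alpha_{\mathrm{GW}}+2^{-c\,d}\bigr)\cdot \mathrm{SDP}, \] where $\mathrm{SDP}=\frac12\sum_{(i,j)\in E} w_{ij}(1-\langle v_i,v_j\rangle)$ is the objective value of the input solution.
   Context: The Max-Cut SDP strengthened with triangle inequalities for a weighted graph $G=(V,E,w)$ asks for vectors $\{v_i\}_{i\in V}$ maximizing $\frac12\sum_{(i,j)\in E} w_{ij}(1-\langle v_i,v_j\rangle)$ subject to $\|v_i\|_2=1$ for all $i\in V$ and $\|a_iv_i-a_jv_j\|_2^2+\|a_iv_i-a_kv_k\|_2^2\ge \|a_jv_j-a_kv_k\|_2^2$ for all $i,j,k\in V$ and all $a_i,a_j,a_k\in\{\pm1\}$. A feasible solution is $d$-dimensional if all $v_i$ lie in $\mathbb{R}^d$. The Goemans–Williamson constant is $\alpha_{\mathrm{GW}}:=\min_{\rho\in[-1,1]}\frac{\arccos(\rho)/\pi}{(1-\rho)/2}\approx 0.87856$. *)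

theory Defs
  imports "HOL-Probability.Probability" "HOL-Computational_Algebra.Polynomial"
begin

section \<open>The Goemans--Williamson constant\<close>

definition gw_ratio :: "real \<Rightarrow> real" where
  "gw_ratio \<rho> = (arccos \<rho> / pi) / ((1 - \<rho>) / 2)"

text \<open>The point \<open>\<rho> = 1\<close> has to be left out: there the quotient is \<open>0 / 0\<close> (it tends to \<open>\<infinity>\<close>), which
  HOL would evaluate to \<open>0\<close>. The infimum is attained, see \<open>alpha_GW_attained\<close> below.\<close>

definition alpha_GW :: real where
  "alpha_GW = (INF \<rho>\<in>{-1..<1}. gw_ratio \<rho>)"

lemma gw_ratio_minus_one: "gw_ratio (-1) = 1"
  by (simp add: gw_ratio_def)

lemma gw_ratio_gt_one:
  assumes "9/10 \<le> \<rho>" "\<rho> < 1"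
  shows "gw_ratio \<rho> > 1"
proof -
  have "sin (arccos \<rho>) \<le> arccos \<rho>"
    using assms by (intro sin_x_le_x arccos_lbound) auto
  then have le: "sqrt (1 - \<rho>\<^sup>2) \<le> arccos \<rho>"
    using assms by (simp add: sin_arccos)
  have "(2 * (1 - \<rho>))\<^sup>2 < 1 - \<rho>\<^sup>2"
  proof -
    have "1 - \<rho>\<^sup>2 - (2 * (1 - \<rho>))\<^sup>2 = (1 - \<rho>) * (5 * \<rho> - 3)"
      by (simp add: power2_eq_square algebra_simps)
    moreover have "(1 - \<rho>) * (5 * \<rho> - 3) > 0"
      using assms by (intro mult_pos_pos) auto
    ultimately show ?thesis by linarith
  qed
  then have "2 * (1 - \<rho>) < sqrt (1 - \<rho>\<^sup>2)"
    by (rule real_less_rsqrt)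
  with le have "2 * (1 - \<rho>) < arccos \<rho>" by linarith
  moreover have "pi * (1 - \<rho>) \<le> 4 * (1 - \<rho>)"
    using assms pi_less_4 by (intro mult_right_mono) auto
  ultimately have "pi * (1 - \<rho>) < 2 * arccos \<rho>" by linarith
  then show ?thesis
    using assms by (simp add: gw_ratio_def field_simps)
qed

lemma alpha_GW_attained:
  "\<exists>\<rho>\<in>{-1..<1}. gw_ratio \<rho> = alpha_GW \<and> (\<forall>\<sigma>\<in>{-1..<1}. gw_ratio \<rho> \<le> gw_ratio \<sigma>)"
proof -
  have "continuous_on {-1..9/10} gw_ratio"
    unfolding gw_ratio_def by (intro continuous_intros) auto
  then obtain \<rho> where \<rho>: "\<rho> \<in> {-1..9/10}" "\<forall>\<sigma>\<in>{-1..9/10}. gw_ratio \<rho> \<le> gw_ratio \<sigma>"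
    using continuous_attains_inf[of "{-1..9/10::real}" gw_ratio] by auto
  have min: "gw_ratio \<rho> \<le> gw_ratio \<sigma>" if "\<sigma> \<in> {-1..<1}" for \<sigma>
  proof (cases "\<sigma> \<le> 9/10")
    case True
    with that \<rho>(2) show ?thesis by auto
  next
    case False
    then have "gw_ratio \<sigma> > 1" using that by (intro gw_ratio_gt_one) auto
    moreover have "gw_ratio \<rho> \<le> gw_ratio (-1)" using \<rho>(2) by simp
    ultimately show ?thesis by (simp add: gw_ratio_minus_one)
  qed
  have "alpha_GW = gw_ratio \<rho>"
    unfolding alpha_GW_def using \<rho>(1) min by (intro cInf_eq_minimum) auto
  with \<rho>(1) min show ?thesis by (intro bexI[of _ \<rho>]) auto
qed


section \<open>Weighted graphs, the strengthened SDP, and cuts\<close>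

text \<open>The vertices are \<open>0, \<dots>, n - 1\<close>. An undirected edge is stored once, as the pair \<open>(i, j)\<close> with
  \<open>i < j\<close>.\<close>

definition weighted_graph :: "nat \<Rightarrow> (nat \<times> nat) set \<Rightarrow> (nat \<Rightarrow> nat \<Rightarrow> real) \<Rightarrow> bool" where
  "weighted_graph n E w \<longleftrightarrow>
     E \<subseteq> {(i, j). i < j \<and> j < n} \<and> (\<forall>(i, j)\<in>E. 0 \<le> w i j)"

text \<open>As \<open>d\<close> is quantified inside the theorem, a vector of \<open>\<real>\<^sup>d\<close> is a function on \<open>nat\<close> of which only
  the values at arguments below \<open>d\<close> are ever used.\<close>

definition inner_prod :: "nat \<Rightarrow> (nat \<Rightarrow> real) \<Rightarrow> (nat \<Rightarrow> real) \<Rightarrow> real" where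
  "inner_prod d x y = (\<Sum>l<d. x l * y l)"

abbreviation norm2 :: "nat \<Rightarrow> (nat \<Rightarrow> real) \<Rightarrow> real" where
  "norm2 d x \<equiv> L2_set x {..<d}"

definition sdp_feasible :: "nat \<Rightarrow> nat \<Rightarrow> (nat \<Rightarrow> nat \<Rightarrow> real) \<Rightarrow> bool" where
  "sdp_feasible d n v \<longleftrightarrow>
     (\<forall>i<n. norm2 d (v i) = 1) \<and>
     (\<forall>i<n. \<forall>j<n. \<forall>k<n. \<forall>a\<in>{1, -1}. \<forall>b\<in>{1, -1}. \<forall>c\<in>{1, -1}.
        (norm2 d (\<lambda>l. a * v i l - b * v j l))\<^sup>2 + (norm2 d (\<lambda>l. a * v i l - c * v k l))\<^sup>2
          \<ge> (norm2 d (\<lambda>l. b * v j l - c * v k l))\<^sup>2)"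

definition sdp_value ::
  "nat \<Rightarrow> (nat \<times> nat) set \<Rightarrow> (nat \<Rightarrow> nat \<Rightarrow> real) \<Rightarrow> (nat \<Rightarrow> nat \<Rightarrow> real) \<Rightarrow> real" where
  "sdp_value d E w v = 1/2 * (\<Sum>(i, j)\<in>E. w i j * (1 - inner_prod d (v i) (v j)))"

definition cut_weight :: "(nat \<times> nat) set \<Rightarrow> (nat \<Rightarrow> nat \<Rightarrow> real) \<Rightarrow> (nat \<Rightarrow> real) \<Rightarrow> real" where
  "cut_weight E w x = (\<Sum>(i, j)\<in>{(i, j)\<in>E. x i \<noteq> x j}. w i j)"


section \<open>Randomized algorithms over the reals\<close>

text \<open>
  Weights and vectors are exact real numbers, so algorithms are programs for a real RAM (a uniform
  Blum--Shub--Smale machine with indirect addressing). It has an integer memory and a real memory,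
  both addressed by triples of integers (array, row, column). Integers serve as indices and counters:
  they can be added, subtracted (truncated at \<open>0\<close>) and compared, but not multiplied, so that a
  unit-cost step cannot do more than polynomial work on bit strings. Reals have the field operations
  and comparison, but no rounding to an integer. Program constants are rational, so a program is a
  finite object that cannot hide non-computable information in a real constant. The source of
  randomness is an instruction that draws a fresh standard Gaussian.
\<close>

type_synonym addr = "nat \<times> nat \<times> nat"

datatype iexp =
    IConst nat
  | ILoad iexp iexp iexp
  | IAdd iexp iexp
  | ISub iexp iexp

datatype rexp =
    RConst rat
  | RLoad iexp iexp iexp
  | RAdd rexp rexp
  | RSub rexp rexp
  | RMul rexp rexp
  | RDiv rexp rexp

datatype bexp =
    ILess iexp iexp
  | RLess rexp rexp
  | BNot bexp
  | BAnd bexp bexp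

datatype cmd =
    Skip
  | IStore iexp iexp iexp iexp
  | RStore iexp iexp iexp rexp
  | Gauss iexp iexp iexp
  | Seq cmd cmd
  | Cond bexp cmd cmd
  | While bexp cmd

text \<open>The randomness is a tape \<open>\<omega>\<close> of real numbers; the field \<open>drawn\<close> counts the entries already
  consumed, so that each draw reads a new one.\<close>

record state =
  imem :: "addr \<Rightarrow> nat"
  rmem :: "addr \<Rightarrow> real"
  drawn :: nat

primrec ival :: "iexp \<Rightarrow> state \<Rightarrow> nat" where
  "ival (IConst m) s = m"
| "ival (ILoad a i j) s = imem s (ival a s, ival i s, ival j s)"
| "ival (IAdd e f) s = ival e s + ival f s"
| "ival (ISub e f) s = ival e s - ival f s"

primrec rval :: "rexp \<Rightarrow> state \<Rightarrow> real" where
  "rval (RConst q) s = of_rat q"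
| "rval (RLoad a i j) s = rmem s (ival a s, ival i s, ival j s)"
| "rval (RAdd e f) s = rval e s + rval f s"
| "rval (RSub e f) s = rval e s - rval f s"
| "rval (RMul e f) s = rval e s * rval f s"
| "rval (RDiv e f) s = rval e s / rval f s"

primrec bval :: "bexp \<Rightarrow> state \<Rightarrow> bool" where
  "bval (ILess e f) s \<longleftrightarrow> ival e s < ival f s"
| "bval (RLess e f) s \<longleftrightarrow> rval e s < rval f s"
| "bval (BNot b) s \<longleftrightarrow> \<not> bval b s"
| "bval (BAnd b b') s \<longleftrightarrow> bval b s \<and> bval b' s"

text \<open>\<open>exec \<omega> C s t s'\<close>: on random tape \<open>\<omega>\<close>, the program \<open>C\<close> started in \<open>s\<close> halts in \<open>s'\<close> after \<open>t\<close>
  steps. Every store, draw and test costs one step; expressions have a size fixed by the program,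
  so this is the number of elementary operations up to a constant factor.\<close>

inductive exec :: "(nat \<Rightarrow> real) \<Rightarrow> cmd \<Rightarrow> state \<Rightarrow> nat \<Rightarrow> state \<Rightarrow> bool" for \<omega> where
  Skip: "exec \<omega> Skip s 1 s"
| IStore: "exec \<omega> (IStore a i j e) s 1
    (s\<lparr>imem := (imem s)((ival a s, ival i s, ival j s) := ival e s)\<rparr>)"
| RStore: "exec \<omega> (RStore a i j e) s 1
    (s\<lparr>rmem := (rmem s)((ival a s, ival i s, ival j s) := rval e s)\<rparr>)"
| Gauss: "exec \<omega> (Gauss a i j) s 1
    (s\<lparr>rmem := (rmem s)((ival a s, ival i s, ival j s) := \<omega> (drawn s)), drawn := Suc (drawn s)\<rparr>)"
| Seq: "exec \<omega> C s t s' \<Longrightarrow> exec \<omega> D s' t' s'' \<Longrightarrow> exec \<omega> (Seq C D) s (t + t') s''"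
| CondTrue: "bval b s \<Longrightarrow> exec \<omega> C s t s' \<Longrightarrow> exec \<omega> (Cond b C D) s (Suc t) s'"
| CondFalse: "\<not> bval b s \<Longrightarrow> exec \<omega> D s t s' \<Longrightarrow> exec \<omega> (Cond b C D) s (Suc t) s'"
| WhileFalse: "\<not> bval b s \<Longrightarrow> exec \<omega> (While b C) s 1 s"
| WhileTrue: "bval b s \<Longrightarrow> exec \<omega> C s t s' \<Longrightarrow> exec \<omega> (While b C) s' t' s''
    \<Longrightarrow> exec \<omega> (While b C) s (Suc (t + t')) s''"

inductive_cases SkipE: "exec \<omega> Skip s t s'"
inductive_cases IStoreE: "exec \<omega> (IStore a i j e) s t s'"
inductive_cases RStoreE: "exec \<omega> (RStore a i j e) s t s'"
inductive_cases GaussE: "exec \<omega> (Gauss a i j) s t s'"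
inductive_cases SeqE: "exec \<omega> (Seq C D) s t s'"
inductive_cases CondE: "exec \<omega> (Cond b C D) s t s'"
inductive_cases WhileE: "exec \<omega> (While b C) s t s'"

lemma exec_deterministic:
  "exec \<omega> C s t s' \<Longrightarrow> exec \<omega> C s u s'' \<Longrightarrow> u = t \<and> s'' = s'"
proof (induction arbitrary: u s'' rule: exec.induct)
  case Skip then show ?case by (auto elim: SkipE)
next
  case IStore then show ?case by (auto elim: IStoreE)
next
  case RStore then show ?case by (auto elim: RStoreE)
next
  case Gauss then show ?case by (auto elim: GaussE)
next
  case Seq then show ?case by (blast elim: SeqE)
next
  case CondTrue then show ?case by (blast elim: CondE)
next
  case CondFalse then show ?case by (blast elim: CondE)
next
  case WhileFalse then show ?case by (auto elim: WhileE)
next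
  case (WhileTrue b s C t s' t' s''')
  from WhileTrue.prems WhileTrue.hyps(1) obtain p m q
    where "u = Suc (p + q)" "exec \<omega> C s p m" "exec \<omega> (While b C) m q s''"
    by (auto elim: WhileE)
  with WhileTrue.IH show ?case by blast
qed

definition final_state :: "(nat \<Rightarrow> real) \<Rightarrow> cmd \<Rightarrow> state \<Rightarrow> state" where
  "final_state \<omega> A s = (THE s'. \<exists>t. exec \<omega> A s t s')"

lemma final_state_eq: "exec \<omega> A s t s' \<Longrightarrow> final_state \<omega> A s = s'"
  unfolding final_state_def by (rule the_equality) (auto dest: exec_deterministic)

text \<open>Independent standard Gaussians.\<close>

definition gauss_tape :: "(nat \<Rightarrow> real) measure" where
  "gauss_tape = (\<Pi>\<^sub>M m\<in>UNIV. std_normal_distribution)"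

text \<open>Input convention: integer cells \<open>(0,0,0)\<close> and \<open>(1,0,0)\<close> hold \<open>n\<close> and \<open>d\<close>, real array \<open>0\<close> holds the
  symmetric weighted adjacency matrix, row \<open>i\<close> of real array \<open>1\<close> holds the vector \<open>v i\<close>; everything
  else is \<open>0\<close>. Output convention: the cut is column \<open>0\<close> of real array \<open>2\<close>.\<close>

definition adj_matrix ::
  "(nat \<times> nat) set \<Rightarrow> (nat \<Rightarrow> nat \<Rightarrow> real) \<Rightarrow> nat \<Rightarrow> nat \<Rightarrow> real" where
  "adj_matrix E w i j = (if (i, j) \<in> E then w i j else if (j, i) \<in> E then w j i else 0)"

definition input ::
  "nat \<Rightarrow> nat \<Rightarrow> (nat \<times> nat) set \<Rightarrow> (nat \<Rightarrow> nat \<Rightarrow> real) \<Rightarrow> (nat \<Rightarrow> nat \<Rightarrow> real) \<Rightarrow> state" where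
  "input d n E w v =
     \<lparr>imem = (\<lambda>_. 0)((0, 0, 0) := n, (1, 0, 0) := d),
      rmem = (\<lambda>(a, i, j). if a = 0 \<and> i < n \<and> j < n then adj_matrix E w i j
                          else if a = 1 \<and> i < n \<and> j < d then v i j else 0),
      drawn = 0\<rparr>"

definition output_cut :: "state \<Rightarrow> nat \<Rightarrow> real" where
  "output_cut s i = rmem s (2, i, 0)"

text \<open>The cut computed on tape \<open>\<omega>\<close>; a random variable on \<open>gauss_tape\<close>.\<close>

definition alg_cut ::
  "cmd \<Rightarrow> nat \<Rightarrow> nat \<Rightarrow> (nat \<times> nat) set \<Rightarrow> (nat \<Rightarrow> nat \<Rightarrow> real) \<Rightarrow> (nat \<Rightarrow> nat \<Rightarrow> real)
     \<Rightarrow> (nat \<Rightarrow> real) \<Rightarrow> nat \<Rightarrow> real" where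
  "alg_cut A d n E w v \<omega> = output_cut (final_state \<omega> A (input d n E w v))"

text \<open>The input consists of \<open>n\<^sup>2 + n d\<close> reals, so polynomial in the input size means polynomial in
  \<open>n + d\<close>. The bound is a worst-case one, over all inputs and all outcomes of the random draws.\<close>

definition poly_time :: "cmd \<Rightarrow> bool" where
  "poly_time A \<longleftrightarrow>
     (\<exists>p :: nat poly. \<forall>d n E w v \<omega>. \<exists>t s. exec \<omega> A (input d n E w v) t s \<and> t \<le> poly p (n + d))"

end

(*
  The triangle inequalities say that the points v_i and -v_i span no obtuse angle, so by Danzer and
  Gruenbaum they take at most 2^d values. Hyperplane rounding gains a constant factor over alpha_GW
  on every edge whose inner product rho is not in [-1 + eps, -eps], so assume that such bad edges
  carry an exponentially small share. Choose a vector u whose (good) edges carry a 2^-d share of the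
  weight. On the thin strip |<g,u>| <= delta, exponentially small but not smaller, the sign of u is
  almost independent of the signs of the neighbours v_e of u, which are those of their normalised
  projections p_e to the complement of u. Flipping u whenever that helps therefore gains
  Pr[strip] E|Z| / 2 with Z = sum_e w_e sgn <g,p_e>, and E|Z| sum_e w_e >= E Z^2 is
  2/pi sum_{e,f} w_e w_f arcsin <p_e,p_f>. The triangle inequality at -u gives
  <p_e,p_f> >= -tau with tau < 1. All coefficients of the arcsine series are positive, and powers of
  inner products are positive definite kernels, so the term of degree 2k + 1 = O(d), with
  tau^(2k+1) < 2^(-d-1), bounds E Z^2 from below by 2^-O(d) (sum_e w_e)^2.
  A bad edge between u and a vector very close to u may have a huge weight. So it is not u alone
  that is flipped, but all the vertices within an exponentially small distance of the line of u, at
  a threshold that is not close to any vertex; the algorithm tries all thresholds.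
*)
theory Submission
  imports Defs
begin

section \<open>Nonobtuse point sets\<close>

text \<open>Every Gaussian fact rests on one statement: the joint law of three linear functionals on
  Borel rectangles depends only on their inner products, even if the dimension changes. So a
  direction orthogonal to the others can serve as an extra, independent coordinate, and an angle can
  be measured in the plane. The small constants come from three errors. Replacing neighbours by
  projections spoils a share of order \<open>\<delta>\<close> of the strip, to be kept below the
  relative gain \<open>\<kappa>\<close>; hence \<open>\<delta>\<close> is of order
  \<open>\<kappa>\<close>. Replacing \<open>u\<close> by a vertex of its cluster fails with
  probability up to \<open>s\<close>, which is not confined to the strip and so competes with the
  strip probability times \<open>\<kappa>\<close>; hence \<open>s\<close> is of order
  \<open>\<delta> * \<kappa>\<close>. A gap free of vertices has width \<open>h\<close> of order
  \<open>s\<^sup>2 / 2 ^ d\<close>, and an edge that jumps it weighs at most \<open>pi / h\<close>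
  times its expected cut. This decides which share of bad edges is harmless. All these quantities
  are 2^-O(d), a class closed under products, so no estimate has to be sharp.\<close>

lemma inner_prod_commute: "inner_prod d x y = inner_prod d y x"
  by (simp add: inner_prod_def mult.commute)

lemma inner_prod_diff_right: "inner_prod d x (\<lambda>l. y l - z l) = inner_prod d x y - inner_prod d x z"
  by (simp add: inner_prod_def algebra_simps sum_subtractf)

lemma inner_prod_diff_left: "inner_prod d (\<lambda>l. y l - z l) x = inner_prod d y x - inner_prod d z x"
  by (simp add: inner_prod_def algebra_simps sum_subtractf)

lemma inner_prod_add_right: "inner_prod d x (\<lambda>l. y l + z l) = inner_prod d x y + inner_prod d x z"
  by (simp add: inner_prod_def algebra_simps sum.distrib)

lemma inner_prod_add_left: "inner_prod d (\<lambda>l. y l + z l) x = inner_prod d y x + inner_prod d z x"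
  by (simp add: inner_prod_def algebra_simps sum.distrib)

lemma inner_prod_scale_right: "inner_prod d x (\<lambda>l. c * y l) = c * inner_prod d x y"
  by (simp add: inner_prod_def sum_distrib_left algebra_simps)

lemma inner_prod_scale_left: "inner_prod d (\<lambda>l. c * y l) x = c * inner_prod d y x"
  by (simp add: inner_prod_def sum_distrib_left algebra_simps)

lemmas inner_prod_bilinear =
  inner_prod_diff_left inner_prod_diff_right inner_prod_add_left inner_prod_add_right
  inner_prod_scale_left inner_prod_scale_right

lemma inner_prod_self_nonneg: "0 \<le> inner_prod d x x"
  by (simp add: inner_prod_def sum_nonneg)

lemma inner_prod_self_eq_0: "inner_prod d x x = 0 \<longleftrightarrow> (\<forall>l<d. x l = 0)"
  by (auto simp: inner_prod_def sum_nonneg_eq_0_iff)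

lemma norm2_power2: "(norm2 d x)\<^sup>2 = inner_prod d x x"
  by (simp add: L2_set_def inner_prod_def sum_nonneg power2_eq_square)

text \<open>The head is the most significant digit: at the first place where two lists differ it
  outweighs everything after it, which suits induction on the lists.\<close>

fun dyadic_point :: "(nat \<Rightarrow> real) list \<Rightarrow> nat \<Rightarrow> real" where
  "dyadic_point [] = (\<lambda>l. 0)"
| "dyadic_point (x # xs) = (\<lambda>l. 2 ^ length xs * x l + dyadic_point xs l)"

context
  fixes d :: nat and P :: "(nat \<Rightarrow> real) set"
  assumes nonobtuse: "\<And>x y z. x \<in> P \<Longrightarrow> y \<in> P \<Longrightarrow> z \<in> P \<Longrightarrow>
      0 \<le> inner_prod d (\<lambda>l. y l - x l) (\<lambda>l. z l - x l)"
begin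

text \<open>The nonobtuse angle at \<open>y\<close> keeps \<open>p\<close> on the near side of the
  hyperplane through \<open>y\<close> normal to \<open>y - x\<close>; the angle at \<open>x\<close>
  keeps \<open>q\<close> beyond the parallel hyperplane through \<open>x\<close>.\<close>

lemma nonobtuse_slab:
  assumes "x \<in> P" "y \<in> P" "p \<in> P" "q \<in> P"
  shows "inner_prod d (\<lambda>l. y l - x l) (\<lambda>l. p l - q l)
    \<le> inner_prod d (\<lambda>l. y l - x l) (\<lambda>l. y l - x l)"
  using nonobtuse[of y x p] nonobtuse[of x y q] assms by (simp add: inner_prod_bilinear)

text \<open>The weights 2^0, ..., 2^(N-1) add up to one less than the weight of the next digit. This
  missing unit is what separates the sums.\<close>

lemma dyadic_point_slab:
  assumes "x \<in> P" "y \<in> P" "length xs = length ys" "set xs \<subseteq> P" "set ys \<subseteq> P"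
  shows "inner_prod d (\<lambda>l. y l - x l) (\<lambda>l. dyadic_point xs l - dyadic_point ys l)
    \<le> (2 ^ length xs - 1) * inner_prod d (\<lambda>l. y l - x l) (\<lambda>l. y l - x l)"
  using assms(3-)
proof (induction xs ys rule: list_induct2)
  case Nil
  then show ?case by (simp add: inner_prod_def)
next
  case (Cons p xs q ys)
  have "2 ^ length xs * inner_prod d (\<lambda>l. y l - x l) (\<lambda>l. p l - q l)
      \<le> 2 ^ length xs * inner_prod d (\<lambda>l. y l - x l) (\<lambda>l. y l - x l)"
    using Cons.prems assms(1,2) by (intro mult_left_mono nonobtuse_slab) auto
  moreover have "inner_prod d (\<lambda>l. y l - x l) (\<lambda>l. dyadic_point (p # xs) l - dyadic_point (q # ys) l) =
      2 ^ length xs * inner_prod d (\<lambda>l. y l - x l) (\<lambda>l. p l - q l) +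
      inner_prod d (\<lambda>l. y l - x l) (\<lambda>l. dyadic_point xs l - dyadic_point ys l)"
    unfolding dyadic_point.simps inner_prod_bilinear using Cons.hyps by (simp add: algebra_simps)
  moreover have "inner_prod d (\<lambda>l. y l - x l) (\<lambda>l. dyadic_point xs l - dyadic_point ys l)
      \<le> (2 ^ length xs - 1) * inner_prod d (\<lambda>l. y l - x l) (\<lambda>l. y l - x l)"
    using Cons by auto
  ultimately have "inner_prod d (\<lambda>l. y l - x l)
      (\<lambda>l. dyadic_point (p # xs) l - dyadic_point (q # ys) l)
      \<le> 2 ^ length xs * inner_prod d (\<lambda>l. y l - x l) (\<lambda>l. y l - x l) +
        (2 ^ length xs - 1) * inner_prod d (\<lambda>l. y l - x l) (\<lambda>l. y l - x l)"
    by linarith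
  also have "\<dots> = (2 ^ length (p # xs) - 1) * inner_prod d (\<lambda>l. y l - x l) (\<lambda>l. y l - x l)"
    by (simp add: algebra_simps)
  finally show ?case .
qed

text \<open>\<open>x\<close> and \<open>y\<close> are the entries at the first difference. If m
  entries follow, that place contributes 2^m times the squared distance, and the rest can take back
  at most 2^m - 1 times as much.\<close>

lemma dyadic_point_separated:
  assumes "length xs = length ys" "set xs \<subseteq> P" "set ys \<subseteq> P" "xs \<noteq> ys"
  shows "\<exists>x\<in>P. \<exists>y\<in>P. x \<noteq> y \<and> inner_prod d (\<lambda>l. y l - x l) (\<lambda>l. y l - x l)
    \<le> inner_prod d (\<lambda>l. y l - x l) (\<lambda>l. dyadic_point ys l - dyadic_point xs l)"
  using assms
proof (induction xs ys rule: list_induct2)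
  case Nil
  then show ?case by simp
next
  case (Cons x xs y ys)
  show ?case
  proof (cases "x = y")
    case True
    with Cons obtain a b where ab: "a \<in> P" "b \<in> P" "a \<noteq> b"
      "inner_prod d (\<lambda>l. b l - a l) (\<lambda>l. b l - a l)
        \<le> inner_prod d (\<lambda>l. b l - a l) (\<lambda>l. dyadic_point ys l - dyadic_point xs l)"
      by auto
    with True Cons.hyps show ?thesis by (intro bexI[of _ a] bexI[of _ b]) auto
  next
    case False
    have "inner_prod d (\<lambda>l. y l - x l) (\<lambda>l. dyadic_point xs l - dyadic_point ys l)
      \<le> (2 ^ length xs - 1) * inner_prod d (\<lambda>l. y l - x l) (\<lambda>l. y l - x l)"
      using Cons by (intro dyadic_point_slab) auto
    then have "inner_prod d (\<lambda>l. y l - x l) (\<lambda>l. y l - x l)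
        \<le> inner_prod d (\<lambda>l. y l - x l)
            (\<lambda>l. dyadic_point (y # ys) l - dyadic_point (x # xs) l)"
      unfolding dyadic_point.simps inner_prod_bilinear using Cons.hyps by (simp add: algebra_simps)
    with False Cons.prems show ?thesis by (intro bexI[of _ x] bexI[of _ y]) auto
  qed
qed

end

lemma dyadic_point_bound:
  assumes "\<And>x. x \<in> set xs \<Longrightarrow> \<bar>x l\<bar> \<le> B" "0 \<le> B"
  shows "\<bar>dyadic_point xs l\<bar> \<le> (2 ^ length xs - 1) * B"
  using assms(1)
proof (induction xs)
  case Nil
  then show ?case by simp
next
  case (Cons x xs)
  have "\<bar>2 ^ length xs * x l\<bar> \<le> 2 ^ length xs * B"
    using Cons.prems by (simp add: abs_mult)
  with Cons show ?case by (simp add: algebra_simps)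
qed

text \<open>The theorem of Danzer and Gruenbaum. Any two points \<open>x\<close>, \<open>y\<close> bound a slab that contains all the
  others, so distinct sums \<open>\<Sum>k<N. 2 ^ k * x\<^sub>k\<close> over \<open>P\<close> are separated by a constant. As
  they lie in a box of side \<open>O(2 ^ N)\<close>, there are \<open>O(2 ^ (d * N))\<close> of them; let \<open>N \<rightarrow> \<infinity>\<close>.\<close>

lemma nonobtuse_card_le:
  assumes fin: "finite P"
    and dist: "\<And>x y. x \<in> P \<Longrightarrow> y \<in> P \<Longrightarrow> x \<noteq> y \<Longrightarrow> \<exists>l<d. x l \<noteq> y l"
    and nonobtuse: "\<And>x y z. x \<in> P \<Longrightarrow> y \<in> P \<Longrightarrow> z \<in> P \<Longrightarrow>
      0 \<le> inner_prod d (\<lambda>l. y l - x l) (\<lambda>l. z l - x l)"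
  shows "card P \<le> 2 ^ d"
proof (rule ccontr)
  assume large: "\<not> ?thesis"
  define r where "r = real (card P) / 2 ^ d"
  have "real (2 ^ d) < real (card P)" using large by (simp only: of_nat_less_iff not_le)
  then have r: "r > 1" by (simp add: r_def)
  \<comment> \<open>Sums in one cell of side \<open>1 / K\<close> differ by at most
    \<open>1 / K\<close> in each coordinate, so pairing their difference with \<open>y - x\<close>
    gives at most the l1-norm of \<open>y - x\<close> over \<open>K\<close>. Once \<open>K\<close>
    exceeds this ratio, that is less than the separation, the squared norm of
    \<open>y - x\<close>.\<close>
  define N1 where "N1 x y = (\<Sum>l<d. \<bar>y l - x l\<bar>) /
    inner_prod d (\<lambda>l. y l - x l) (\<lambda>l. y l - x l)" for x y :: "nat \<Rightarrow> real"
  obtain K :: nat where K: "\<And>x y. x \<in> P \<Longrightarrow> y \<in> P \<Longrightarrow> N1 x y < real K"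
  proof -
    obtain K :: nat where K: "Max (insert 0 ((\<lambda>(x, y). N1 x y) ` (P \<times> P))) < real K"
      using reals_Archimedean2 by blast
    have "N1 x y \<le> Max (insert 0 ((\<lambda>(x, y). N1 x y) ` (P \<times> P)))" if "x \<in> P" "y \<in> P" for x y
      using that fin by (intro Max_ge) auto
    with K show ?thesis by (intro that[of K]) fastforce
  qed
  obtain B :: nat where B: "\<And>x l. x \<in> P \<Longrightarrow> l < d \<Longrightarrow> \<bar>x l\<bar> \<le> real B"
  proof -
    obtain B :: nat where B: "Max (insert 0 ((\<lambda>(x, l). \<bar>x l\<bar>) ` (P \<times> {..<d}))) < real B"
      using reals_Archimedean2 by blast
    have "\<bar>x l\<bar> \<le> Max (insert 0 ((\<lambda>(x, l). \<bar>x l\<bar>) ` (P \<times> {..<d})))" if "x \<in> P" "l < d" for x l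
      using that fin by (intro Max_ge) auto
    with B show ?thesis by (intro that[of B]) fastforce
  qed
  define cell where
    "cell xs = restrict (\<lambda>l. \<lfloor>real K * dyadic_point xs l\<rfloor>) {..<d}" for xs
  have main: "card P ^ N \<le> ((2 * K * B + 1) * 2 ^ N) ^ d" for N :: nat
  proof -
    define Ls where "Ls = {xs. set xs \<subseteq> P \<and> length xs = N}"
    have "inj_on cell Ls"
    proof (rule inj_onI, rule ccontr)
      fix xs ys assume xy: "xs \<in> Ls" "ys \<in> Ls" "cell xs = cell ys" "xs \<noteq> ys"
      obtain x y where e: "x \<in> P" "y \<in> P" "x \<noteq> y" "inner_prod d (\<lambda>l. y l - x l) (\<lambda>l. y l - x l)
          \<le> inner_prod d (\<lambda>l. y l - x l) (\<lambda>l. dyadic_point ys l - dyadic_point xs l)"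
        using dyadic_point_separated[of P d xs ys] nonobtuse xy(1,2,4) by (auto simp: Ls_def)
      have pos: "inner_prod d (\<lambda>l. y l - x l) (\<lambda>l. y l - x l) > 0"
        using dist[OF e(1-3)] inner_prod_self_nonneg[of d "\<lambda>l. y l - x l"]
          inner_prod_self_eq_0[of d "\<lambda>l. y l - x l"] by fastforce
      have close: "real K * \<bar>dyadic_point ys l - dyadic_point xs l\<bar> \<le> 1" if "l < d" for l
      proof -
        have "\<lfloor>real K * dyadic_point xs l\<rfloor> = \<lfloor>real K * dyadic_point ys l\<rfloor>"
          using fun_cong[OF xy(3), of l] that by (simp add: cell_def)
        then have "\<bar>real K * dyadic_point ys l - real K * dyadic_point xs l\<bar> \<le> 1"
          by linarith
        then show ?thesis by (simp add: abs_mult flip: right_diff_distrib)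
      qed
      have "real K * inner_prod d (\<lambda>l. y l - x l) (\<lambda>l. y l - x l)
          \<le> real K * inner_prod d (\<lambda>l. y l - x l) (\<lambda>l. dyadic_point ys l - dyadic_point xs l)"
        using e(4) by (intro mult_left_mono) auto
      also have "\<dots> = (\<Sum>l<d. (y l - x l) * (real K * (dyadic_point ys l - dyadic_point xs l)))"
        by (simp add: inner_prod_def sum_distrib_left algebra_simps)
      also have "\<dots> \<le> (\<Sum>l<d. \<bar>y l - x l\<bar>)"
      proof (intro sum_mono)
        fix l assume "l \<in> {..<d}"
        have "(y l - x l) * (real K * (dyadic_point ys l - dyadic_point xs l))
            \<le> \<bar>y l - x l\<bar> * (real K * \<bar>dyadic_point ys l - dyadic_point xs l\<bar>)"
          using abs_ge_self[of "(y l - x l) * (real K * (dyadic_point ys l - dyadic_point xs l))"]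
          by (simp only: abs_mult abs_of_nat)
        also have "\<dots> \<le> \<bar>y l - x l\<bar> * 1"
          using close \<open>l \<in> {..<d}\<close> by (intro mult_left_mono) auto
        finally show "(y l - x l) * (real K * (dyadic_point ys l - dyadic_point xs l)) \<le> \<bar>y l - x l\<bar>"
          by simp
      qed
      finally have "real K \<le> N1 x y" using pos by (simp add: N1_def field_simps)
      with K[OF e(1,2)] show False by simp
    qed
    moreover have "cell ` Ls \<subseteq> ({..<d} \<rightarrow>\<^sub>E {- int (2 ^ N * K * B)..int (2 ^ N * K * B)})"
    proof (rule image_subsetI, rule PiE_I)
      fix xs l assume "xs \<in> Ls"
      { assume "l \<in> {..<d}"
        then have l: "l < d" by simp
        have "\<bar>dyadic_point xs l\<bar> \<le> (2 ^ length xs - 1) * real B"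
          using \<open>xs \<in> Ls\<close> l B by (intro dyadic_point_bound) (auto simp: Ls_def)
        also have "\<dots> \<le> 2 ^ N * real B"
          using \<open>xs \<in> Ls\<close> by (intro mult_right_mono) (auto simp: Ls_def)
        finally have "real K * \<bar>dyadic_point xs l\<bar> \<le> real K * (2 ^ N * real B)"
          by (intro mult_left_mono) auto
        then have "\<bar>real K * dyadic_point xs l\<bar> \<le> real (2 ^ N * K * B)"
          by (simp add: abs_mult mult_ac)
        then show "cell xs l \<in> {- int (2 ^ N * K * B)..int (2 ^ N * K * B)}"
          using l by (simp add: cell_def le_floor_iff floor_le_iff del: of_nat_mult of_nat_power) linarith }
      assume "l \<notin> {..<d}"
      then show "cell xs l = undefined" by (simp add: cell_def)
    qed
    ultimately have "card Ls \<le> card ({..<d} \<rightarrow>\<^sub>E {- int (2 ^ N * K * B)..int (2 ^ N * K * B)})"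
      by (intro card_inj_on_le[of cell]) (auto intro: finite_PiE)
    also have "\<dots> = (2 * (2 ^ N * K * B) + 1) ^ d"
    proof -
      have "card {- int Q..int Q} = 2 * Q + 1" for Q
        by simp
      then show ?thesis by (simp only: card_PiE finite_lessThan prod_constant card_lessThan)
    qed
    also have "\<dots> \<le> ((2 * K * B + 1) * 2 ^ N) ^ d"
      by (intro power_mono) (auto simp: algebra_simps)
    finally show ?thesis
      using fin by (simp add: Ls_def card_lists_length_eq)
  qed
  \<comment> \<open>Neither \<open>K\<close> nor \<open>B\<close> depends on \<open>N\<close>, so
    the number of lists, growing by \<open>card P\<close> per step, cannot outgrow the number of
    cells, growing by \<open>2 ^ d\<close>.\<close>
  obtain N where N: "(2 * real K * real B + 1) ^ d < r ^ N"
    using real_arch_pow[OF r] by blast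
  have "real (card P) ^ N \<le> ((2 * real K * real B + 1) * 2 ^ N) ^ d"
    using of_nat_mono[OF main[of N], where 'a = real]
    by (simp only: of_nat_mult of_nat_add of_nat_power of_nat_numeral of_nat_1)
  then have "real (card P) ^ N \<le> (2 * real K * real B + 1) ^ d * (2 ^ d) ^ N"
    by (simp only: power_mult_distrib mult.commute flip: power_mult)
  then have "r ^ N \<le> (2 * real K * real B + 1) ^ d"
    by (simp add: r_def power_divide pos_divide_le_eq)
  with N show False by simp
qed

section \<open>Joint laws of linear functionals of a Gaussian vector\<close>

lemma integrable_bounded_weight:
  fixes f g :: "'a \<Rightarrow> real"
  assumes "prob_space M" "g \<in> borel_measurable M" "f \<in> borel_measurable M"
    "\<And>x. \<bar>g x\<bar> \<le> L" "\<And>x. \<bar>f x\<bar> \<le> K"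
  shows "integrable M (\<lambda>x. g x * f x)"
proof -
  interpret prob_space M by fact
  have "\<bar>g x * f x\<bar> \<le> L * K" for x
    unfolding abs_mult using assms(4)[of x] assms(5)[of x] by (intro mult_mono) auto
  then show ?thesis
    using assms(2,3) by (intro integrable_const_bound[where B = "L * K"]) auto
qed

text \<open>Levy's uniqueness theorem, for the image under \<open>X\<close> of the measure with density \<open>f\<close>.\<close>

lemma weighted_uniqueness:
  fixes X f :: "'a \<Rightarrow> real" and Y g :: "'b \<Rightarrow> real"
  assumes M: "prob_space M" and N: "prob_space N"
    and X[measurable]: "X \<in> borel_measurable M" and Y[measurable]: "Y \<in> borel_measurable N"
    and f[measurable]: "f \<in> borel_measurable M" and g[measurable]: "g \<in> borel_measurable N"
    and fb: "\<And>x. 0 \<le> f x" "\<And>x. f x \<le> K" and gb: "\<And>x. 0 \<le> g x" "\<And>x. g x \<le> K"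
    and eq: "\<And>r \<theta>. (\<integral>x. cos (r * X x + \<theta>) * f x \<partial>M) = (\<integral>x. cos (r * Y x + \<theta>) * g x \<partial>N)"
    and A[measurable]: "A \<in> sets borel"
  shows "(\<integral>x. indicator A (X x) * f x \<partial>M) = (\<integral>x. indicator A (Y x) * g x \<partial>N)"
proof -
  \<comment> \<open>Dividing the density by its mass \<open>m\<close> gives a probability measure,
    and its characteristic function consists of the cosine and sine integrals. The generic form
    serves both sides.\<close>
  have image: "\<exists>D. real_distribution D \<and> measure D A = (\<integral>x. indicator A (X x) * f x \<partial>M) / m \<and>
      (\<forall>t. char D t = Complex ((\<integral>x. cos (t * X x) * f x \<partial>M) / m) ((\<integral>x. sin (t * X x) * f x \<partial>M) / m))"
    if "prob_space M" and [measurable]: "X \<in> borel_measurable M" "f \<in> borel_measurable M"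
      and fb: "\<And>x. 0 \<le> f x" "\<And>x. f x \<le> K" and m: "m = (\<integral>x. f x \<partial>M)" "m > 0"
    for M :: "'c measure" and X f m
  proof -
    interpret prob_space M by fact
    define D where "D = distr (density M (\<lambda>x. ennreal (f x / m))) borel X"
    have int: "integrable M (\<lambda>x. h x * f x)"
      if "h \<in> borel_measurable M" "\<And>x. \<bar>h x\<bar> \<le> 1" for h :: "'c \<Rightarrow> real"
      using that fb \<open>prob_space M\<close> by (intro integrable_bounded_weight[where K = K and L = 1]) auto
    have nonneg: "AE x in M. 0 \<le> f x / m" using fb m(2) by (intro AE_I2) auto
    have int1: "integrable M f" using int[of "\<lambda>_. 1"] by simp
    have "(\<integral>\<^sup>+x. ennreal (f x / m) \<partial>M) = ennreal (\<integral>x. f x / m \<partial>M)"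
      using int1 nonneg by (intro nn_integral_eq_integral) auto
    also have "\<dots> = 1" using m by simp
    finally have "prob_space (density M (\<lambda>x. ennreal (f x / m)))"
      by (intro prob_spaceI) (simp add: emeasure_density cong: nn_integral_cong)
    then interpret D: prob_space "density M (\<lambda>x. ennreal (f x / m))" .
    have "real_distribution D"
      unfolding D_def by (intro D.real_distribution_distr) auto
    moreover have "measure D A = (\<integral>x. indicator A (X x) * f x \<partial>M) / m"
    proof -
      have "measure D A = (\<integral>x. indicator A x \<partial>D)"
        unfolding D_def by simp
      also have "\<dots> = (\<integral>x. (f x / m) *\<^sub>R (indicator A (X x) :: real) \<partial>M)"
        unfolding D_def using nonneg
        by (subst integral_distr, simp, simp, subst integral_density) auto
      also have "\<dots> = (\<integral>x. indicator A (X x) * f x / m \<partial>M)"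
        by (intro Bochner_Integration.integral_cong) auto
      finally show ?thesis by simp
    qed
    moreover have iexp: "iexp y = of_real (cos y) + \<i> * of_real (sin y)" for y
      by (simp add: complex_eq_iff Re_exp Im_exp)
    have split: "(\<integral>x. complex_of_real (a x) + \<i> * complex_of_real (b x) \<partial>M) =
        complex_of_real (\<integral>x. a x \<partial>M) + \<i> * complex_of_real (\<integral>x. b x \<partial>M)"
      if "integrable M a" "integrable M b" for a b
      using that by (subst Bochner_Integration.integral_add) simp_all
    have "char D t =
      Complex ((\<integral>x. cos (t * X x) * f x \<partial>M) / m) ((\<integral>x. sin (t * X x) * f x \<partial>M) / m)" for t
    proof -
      have "char D t = (\<integral>x. (f x / m) *\<^sub>R iexp (t * X x) \<partial>M)"
        unfolding D_def char_def using nonneg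
        by (subst integral_distr, simp, simp, subst integral_density) auto
      also have "\<dots> = (\<integral>x. complex_of_real (cos (t * X x) * f x / m) + \<i> * complex_of_real (sin (t * X x) * f x / m) \<partial>M)"
        unfolding iexp by (intro Bochner_Integration.integral_cong refl) (simp add: complex_eq_iff)
      also have "\<dots> = complex_of_real (\<integral>x. cos (t * X x) * f x / m \<partial>M) +
          \<i> * complex_of_real (\<integral>x. sin (t * X x) * f x / m \<partial>M)"
        using int[of "\<lambda>x. cos (t * X x)"] int[of "\<lambda>x. sin (t * X x)"]
        by (intro split integrable_divide_zero) auto
      finally show ?thesis by (simp add: complex_eq_iff)
    qed
    ultimately show ?thesis by blast
  qed
  interpret M: prob_space M by fact
  interpret N: prob_space N by fact
  have intf: "integrable M f" "integrable N g"
    using fb gb integrable_bounded_weight[OF M, of "\<lambda>_. 1" f 1 K]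
      integrable_bounded_weight[OF N, of "\<lambda>_. 1" g 1 K] by auto
  define m where "m = (\<integral>x. f x \<partial>M)"
  have m': "m = (\<integral>x. g x \<partial>N)" using eq[of 0 0] by (simp add: m_def)
  show ?thesis
  proof (cases "m > 0")
    case True
    from image[OF M X f fb m_def True] obtain D where D: "real_distribution D"
      "measure D A = (\<integral>x. indicator A (X x) * f x \<partial>M) / m"
      "\<And>t. char D t = Complex ((\<integral>x. cos (t * X x) * f x \<partial>M) / m) ((\<integral>x. sin (t * X x) * f x \<partial>M) / m)"
      by blast
    from image[OF N Y g gb m' True] obtain D' where D': "real_distribution D'"
      "measure D' A = (\<integral>x. indicator A (Y x) * g x \<partial>N) / m"
      "\<And>t. char D' t = Complex ((\<integral>x. cos (t * Y x) * g x \<partial>N) / m) ((\<integral>x. sin (t * Y x) * g x \<partial>N) / m)"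
      by blast
    have "char D = char D'"
    proof
      fix t
      have "(\<integral>x. sin (t * X x) * f x \<partial>M) = (\<integral>x. sin (t * Y x) * g x \<partial>N)"
        \<comment> \<open>The phase turns the cosine into the sine, which is the imaginary part of
          the characteristic function.\<close>
        using eq[of t "-(pi/2)"] by (simp add: cos_sin_eq[symmetric] cos_diff)
      then show "char D t = char D' t" using eq[of t 0] by (simp add: D(3) D'(3))
    qed
    then have "D = D'" using D(1) D'(1) by (intro Levy_uniqueness) auto
    with D(2) D'(2) True show ?thesis by simp
  next
    case False
    then have "m = 0" using fb unfolding m_def by (intro antisym Bochner_Integration.integral_nonneg) auto
    then have "AE x in M. f x = 0" "AE x in N. g x = 0"
      using integral_nonneg_eq_0_iff_AE[OF intf(1)] integral_nonneg_eq_0_iff_AE[OF intf(2)] fb gb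
        m' m_def by auto
    then have "(\<integral>x. indicator A (X x) * f x \<partial>M) = 0" "(\<integral>x. indicator A (Y x) * g x \<partial>N) = 0"
      by (auto intro!: integral_eq_zero_AE)
    then show ?thesis by simp
  qed
qed

text \<open>Since \<open>cos (r * X + \<eta>) * cos (V + \<theta>)\<close> is a combination of cosines of \<open>\<plusminus> r * X + V\<close>, the weight
  \<open>f * (1 + cos (V + \<theta>))\<close> is covered by the previous lemma.\<close>

lemma weighted_uniqueness_step:
  fixes X V f :: "'a \<Rightarrow> real" and Y W g :: "'b \<Rightarrow> real"
  assumes M: "prob_space M" and N: "prob_space N"
    and X[measurable]: "X \<in> borel_measurable M" and Y[measurable]: "Y \<in> borel_measurable N"
    and V[measurable]: "V \<in> borel_measurable M" and W[measurable]: "W \<in> borel_measurable N"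
    and f[measurable]: "f \<in> borel_measurable M" and g[measurable]: "g \<in> borel_measurable N"
    and fb: "\<And>x. 0 \<le> f x" "\<And>x. f x \<le> 1" and gb: "\<And>x. 0 \<le> g x" "\<And>x. g x \<le> 1"
    and eq: "\<And>r \<theta>. (\<integral>x. cos (r * X x + \<theta>) * f x \<partial>M) = (\<integral>x. cos (r * Y x + \<theta>) * g x \<partial>N)"
    and eqV: "\<And>r \<theta>. (\<integral>x. cos (r * X x + V x + \<theta>) * f x \<partial>M) = (\<integral>x. cos (r * Y x + W x + \<theta>) * g x \<partial>N)"
    and A[measurable]: "A \<in> sets borel"
  shows "(\<integral>x. cos (V x + \<theta>) * (indicator A (X x) * f x) \<partial>M) =
    (\<integral>x. cos (W x + \<theta>) * (indicator A (Y x) * g x) \<partial>N)"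
proof -
  have intM: "integrable M (\<lambda>x. h x * f x)"
    if "h \<in> borel_measurable M" "\<And>x. \<bar>h x\<bar> \<le> 1" for h :: "'a \<Rightarrow> real"
    using that fb by (intro integrable_bounded_weight[where K = 1 and L = 1] M) auto
  have intN: "integrable N (\<lambda>x. h x * g x)"
    if "h \<in> borel_measurable N" "\<And>x. \<bar>h x\<bar> \<le> 1" for h :: "'b \<Rightarrow> real"
    using that gb by (intro integrable_bounded_weight[where K = 1 and L = 1] N) auto
  have prod: "cos (a + b) * (h * (1 + cos (c + t))) =
      cos (a + b) * h + 1/2 * (cos (a + c + (b + t)) * h) + 1/2 * (cos (- a + c + (t - b)) * h)"
    for a b c t h :: real
  proof -
    have "cos (a + b) * cos (c + t) = (cos (a + c + (b + t)) + cos (- a + c + (t - b))) / 2"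
      using cos_times_cos[of "c + t" "a + b"] by (simp add: algebra_simps)
    moreover have "cos (a + b) * (h * (1 + cos (c + t))) =
        cos (a + b) * h + (cos (a + b) * cos (c + t)) * h"
      by (simp add: algebra_simps)
    ultimately show ?thesis by (simp add: add_divide_distrib distrib_right)
  qed
  have sum3: "(\<integral>x. a x + 1/2 * b x + 1/2 * c x \<partial>L) = (\<integral>x. a x \<partial>L) + 1/2 * (\<integral>x. b x \<partial>L) + 1/2 * (\<integral>x. c x \<partial>L)"
    if "integrable L a" "integrable L b" "integrable L c" for L :: "'c measure" and a b c :: "'c \<Rightarrow> real"
    using that by simp
  \<comment> \<open>A cosine is no density, but 1 + cos is nonnegative and at most 2. The summand 1
    is removed afterwards by uniqueness for the weight \<open>f\<close> itself.\<close>
  have "(\<integral>x. indicator A (X x) * (f x * (1 + cos (V x + \<theta>))) \<partial>M) =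
      (\<integral>x. indicator A (Y x) * (g x * (1 + cos (W x + \<theta>))) \<partial>N)"
  proof (rule weighted_uniqueness[OF M N X Y, where K = 2])
    have cos1: "0 \<le> 1 + cos t" for t :: real
      using cos_ge_minus_one[of t] by linarith
    have "f x * (1 + cos (V x + \<theta>)) \<le> 1 * 2" for x
      using fb cos1 by (intro mult_mono) auto
    then show "f x * (1 + cos (V x + \<theta>)) \<le> 2" for x by simp
    have "g x * (1 + cos (W x + \<theta>)) \<le> 1 * 2" for x
      using gb cos1 by (intro mult_mono) auto
    then show "g x * (1 + cos (W x + \<theta>)) \<le> 2" for x by simp
    show "0 \<le> f x * (1 + cos (V x + \<theta>))" for x
      by (intro mult_nonneg_nonneg fb cos1)
    show "0 \<le> g x * (1 + cos (W x + \<theta>))" for x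
      by (intro mult_nonneg_nonneg gb cos1)
    fix r b
    have "(\<integral>x. cos (r * X x + b) * (f x * (1 + cos (V x + \<theta>))) \<partial>M) =
        (\<integral>x. cos (r * X x + b) * f x \<partial>M) + 1/2 * (\<integral>x. cos (r * X x + V x + (b + \<theta>)) * f x \<partial>M)
        + 1/2 * (\<integral>x. cos ((- r) * X x + V x + (\<theta> - b)) * f x \<partial>M)"
      unfolding prod mult_minus_left by (intro sum3 intM) auto
    moreover have "(\<integral>x. cos (r * Y x + b) * (g x * (1 + cos (W x + \<theta>))) \<partial>N) =
        (\<integral>x. cos (r * Y x + b) * g x \<partial>N) + 1/2 * (\<integral>x. cos (r * Y x + W x + (b + \<theta>)) * g x \<partial>N)
        + 1/2 * (\<integral>x. cos ((- r) * Y x + W x + (\<theta> - b)) * g x \<partial>N)"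
      unfolding prod mult_minus_left by (intro sum3 intN) auto
    ultimately show "(\<integral>x. cos (r * X x + b) * (f x * (1 + cos (V x + \<theta>))) \<partial>M) =
        (\<integral>x. cos (r * Y x + b) * (g x * (1 + cos (W x + \<theta>))) \<partial>N)"
      unfolding eq eqV by simp
  qed auto
  moreover have "(\<integral>x. indicator A (X x) * f x \<partial>M) = (\<integral>x. indicator A (Y x) * g x \<partial>N)"
    by (rule weighted_uniqueness[OF M N X Y f g fb gb eq A])
  moreover have "(\<integral>x. indicator A (X x) * (f x * (1 + cos (V x + \<theta>))) \<partial>M) =
      (\<integral>x. indicator A (X x) * f x \<partial>M) + (\<integral>x. cos (V x + \<theta>) * (indicator A (X x) * f x) \<partial>M)"
    using intM[of "\<lambda>x. indicator A (X x)"] intM[of "\<lambda>x. cos (V x + \<theta>) * indicator A (X x)"]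
    by (subst Bochner_Integration.integral_add[symmetric])
       (auto simp: algebra_simps abs_mult indicator_def)
  moreover have "(\<integral>x. indicator A (Y x) * (g x * (1 + cos (W x + \<theta>))) \<partial>N) =
      (\<integral>x. indicator A (Y x) * g x \<partial>N) + (\<integral>x. cos (W x + \<theta>) * (indicator A (Y x) * g x) \<partial>N)"
    using intN[of "\<lambda>x. indicator A (Y x)"] intN[of "\<lambda>x. cos (W x + \<theta>) * indicator A (Y x)"]
    by (subst Bochner_Integration.integral_add[symmetric])
       (auto simp: algebra_simps abs_mult indicator_def)
  ultimately show ?thesis by linarith
qed

text \<open>Each of the three rounds trades the frequency of one variable for an indicator, with the
  remaining variables in the role of the phase \<open>V\<close>. Rectangles suffice, since only sign
  patterns and strips are measured later.\<close>

lemma joint_law_unique: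
  fixes X1 X2 X3 :: "'a \<Rightarrow> real" and Y1 Y2 Y3 :: "'b \<Rightarrow> real"
  assumes M: "prob_space M" and N: "prob_space N"
    and X[measurable]: "X1 \<in> borel_measurable M" "X2 \<in> borel_measurable M" "X3 \<in> borel_measurable M"
    and Y[measurable]: "Y1 \<in> borel_measurable N" "Y2 \<in> borel_measurable N" "Y3 \<in> borel_measurable N"
    and eq: "\<And>r s t \<theta>. (\<integral>x. cos (r * X1 x + (s * X2 x + t * X3 x) + \<theta>) \<partial>M) =
        (\<integral>x. cos (r * Y1 x + (s * Y2 x + t * Y3 x) + \<theta>) \<partial>N)"
    and A[measurable]: "A \<in> sets borel" "B \<in> sets borel" "C \<in> sets borel"
  shows "(\<integral>x. indicator A (X1 x) * indicator B (X2 x) * indicator C (X3 x) \<partial>M) =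
    (\<integral>x. indicator A (Y1 x) * indicator B (Y2 x) * indicator C (Y3 x) \<partial>N :: real)"
proof -
  have 1: "(\<integral>x. cos (s * X2 x + t * X3 x + \<theta>) * (indicator A (X1 x) * 1) \<partial>M) =
      (\<integral>x. cos (s * Y2 x + t * Y3 x + \<theta>) * (indicator A (Y1 x) * 1) \<partial>N)" for s t \<theta>
    by (rule weighted_uniqueness_step[OF M N]) (use eq eq[of _ 0 0] in \<open>auto simp: add.assoc\<close>)
  have 2: "(\<integral>x. cos (t * X3 x + \<theta>) * (indicator B (X2 x) * (indicator A (X1 x) * 1)) \<partial>M) =
      (\<integral>x. cos (t * Y3 x + \<theta>) * (indicator B (Y2 x) * (indicator A (Y1 x) * 1)) \<partial>N)" for t \<theta>
    by (rule weighted_uniqueness_step[OF M N]) (use 1 1[of _ 0] in \<open>auto simp: indicator_def\<close>)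
  have 3: "(\<integral>x. cos (0 + 0 :: real) * (indicator C (X3 x) * (indicator B (X2 x) * (indicator A (X1 x) * 1))) \<partial>M) =
      (\<integral>x. cos (0 + 0 :: real) * (indicator C (Y3 x) * (indicator B (Y2 x) * (indicator A (Y1 x) * 1))) \<partial>N)"
    by (rule weighted_uniqueness_step[OF M N, where V = "\<lambda>_. 0" and W = "\<lambda>_. 0"])
       (use 2 in \<open>auto simp: indicator_def\<close>)
  then show ?thesis by (simp add: mult_ac)
qed

section \<open>Linear functionals of the Gaussian tape\<close>

lemma prob_space_gauss_tape: "prob_space gauss_tape"
  unfolding gauss_tape_def by (intro prob_space_PiM prob_space_normal_density) simp

interpretation gauss: prob_space gauss_tape
  by (rule prob_space_gauss_tape)

lemma sets_gauss_tape [measurable_cong]: "sets gauss_tape = sets (\<Pi>\<^sub>M m\<in>UNIV. borel)"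
  unfolding gauss_tape_def by (intro sets_PiM_cong) auto

lemma space_gauss_tape [simp]: "space gauss_tape = UNIV"
  by (simp add: gauss_tape_def space_PiM)

lemma inner_prod_measurable [measurable]:
  "inner_prod d a \<in> borel_measurable (\<Pi>\<^sub>M m\<in>UNIV. borel)"
  unfolding inner_prod_def by measurable

lemma inner_prod_measurable_gauss [measurable]: "inner_prod d a \<in> borel_measurable gauss_tape"
  unfolding inner_prod_def by measurable

lemma prob_gauss_tape_UNIV [simp]: "measure gauss_tape UNIV = 1"
  using gauss.prob_space by simp

lemma gauss_integrable_bounded:
  fixes f :: "(nat \<Rightarrow> real) \<Rightarrow> real"
  assumes "f \<in> borel_measurable gauss_tape" "\<And>\<omega>. \<bar>f \<omega>\<bar> \<le> B"
  shows "integrable gauss_tape f"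
  using assms by (intro gauss.integrable_const_bound[where B = B]) auto

lemma distr_gauss_tape_component: "distr gauss_tape borel (\<lambda>\<omega>. \<omega> l) = std_normal_distribution"
proof -
  have "distr gauss_tape borel (\<lambda>\<omega>. \<omega> l) = distr gauss_tape std_normal_distribution (\<lambda>\<omega>. \<omega> l)"
    by (intro distr_cong) auto
  also have "\<dots> = std_normal_distribution"
    unfolding gauss_tape_def by (intro distr_PiM_component prob_space_normal_density) auto
  finally show ?thesis .
qed

lemma indep_vars_gauss_tape: "gauss.indep_vars (\<lambda>_. borel) (\<lambda>l \<omega>. \<omega> l) UNIV"
proof (subst gauss.indep_vars_iff_distr_eq_PiM)
  have restrict_UNIV: "(\<lambda>x :: nat \<Rightarrow> real. \<lambda>i\<in>UNIV. x i) = (\<lambda>x. x)"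
    by (simp add: fun_eq_iff)
  have "distr gauss_tape (\<Pi>\<^sub>M m\<in>UNIV. borel) (\<lambda>x. \<lambda>i\<in>UNIV. x i) = gauss_tape"
    unfolding restrict_UNIV by (intro distr_id2 sets_gauss_tape[symmetric])
  then show "distr gauss_tape (\<Pi>\<^sub>M m\<in>UNIV. borel) (\<lambda>x. \<lambda>i\<in>UNIV. x i) =
      (\<Pi>\<^sub>M i\<in>UNIV. distr gauss_tape borel (\<lambda>\<omega>. \<omega> i))"
    unfolding distr_gauss_tape_component by (simp only: gauss_tape_def)
qed auto

text \<open>Independence of the entries gives a product of normal characteristic functions. The
  frequency 1 is enough, because multiples are absorbed into \<open>a\<close>.\<close>

lemma char_inner_prod:
  "char (distr gauss_tape borel (inner_prod d a)) 1 = of_real (exp (- (inner_prod d a a / 2)))"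
proof -
  have "gauss.indep_vars (\<lambda>_. borel) (\<lambda>l \<omega>. a l * \<omega> l) {..<d}"
    using gauss.indep_vars_compose2[OF gauss.indep_vars_subset[OF indep_vars_gauss_tape], of "{..<d}" "\<lambda>l x. a l * x" "\<lambda>_. borel"]
    by simp
  then have "char (distr gauss_tape borel (inner_prod d a)) 1 =
      (\<Prod>l<d. char (distr gauss_tape borel (\<lambda>\<omega>. a l * \<omega> l)) 1)"
    unfolding inner_prod_def by (rule gauss.char_distr_sum)
  also have "\<dots> = (\<Prod>l<d. of_real (exp (- (a l * a l / 2))))"
  proof (intro prod.cong refl)
    fix l
    have "char (distr gauss_tape borel (\<lambda>\<omega>. a l * \<omega> l)) 1 =
        char (distr gauss_tape borel (\<lambda>\<omega>. \<omega> l)) (a l)"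
      by (simp add: char_def integral_distr)
    then show "char (distr gauss_tape borel (\<lambda>\<omega>. a l * \<omega> l)) 1 = of_real (exp (- (a l * a l / 2)))"
      by (simp add: distr_gauss_tape_component char_std_normal_distribution power2_eq_square)
  qed
  also have "\<dots> = of_real (exp (\<Sum>l<d. - (a l * a l / 2)))"
    by (simp add: exp_sum)
  finally show ?thesis
    by (simp add: inner_prod_def sum_negf sum_divide_distrib)
qed

lemma integral_cos_inner_prod:
  "(\<integral>\<omega>. cos (inner_prod d a \<omega> + \<theta>) \<partial>gauss_tape) = exp (- (inner_prod d a a / 2)) * cos \<theta>"
proof -
  have int: "complex_integrable gauss_tape (\<lambda>\<omega>. iexp (inner_prod d a \<omega>))"
    by (intro gauss.integrable_iexp) auto
  have eq: "(\<integral>\<omega>. iexp (inner_prod d a \<omega>) \<partial>gauss_tape) = of_real (exp (- (inner_prod d a a / 2)))"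
    using char_inner_prod[of d a] by (simp add: char_def integral_distr)
  have "(\<integral>\<omega>. cos (inner_prod d a \<omega> + \<theta>) \<partial>gauss_tape) =
      (\<integral>\<omega>. Re (iexp (inner_prod d a \<omega>)) * cos \<theta> - Im (iexp (inner_prod d a \<omega>)) * sin \<theta> \<partial>gauss_tape)"
    by (simp add: Re_exp Im_exp cos_add)
  also have "\<dots> = (\<integral>\<omega>. Re (iexp (inner_prod d a \<omega>)) \<partial>gauss_tape) * cos \<theta> -
      (\<integral>\<omega>. Im (iexp (inner_prod d a \<omega>)) \<partial>gauss_tape) * sin \<theta>"
    using int by (subst Bochner_Integration.integral_diff) (auto intro!: integrable_mult_left)
  also have "\<dots> = exp (- (inner_prod d a a / 2)) * cos \<theta>"
    unfolding integral_Re[OF int] integral_Im[OF int] eq by simp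
  finally show ?thesis .
qed

text \<open>The cosine moments of all combinations of the functionals involve only their Gram
  matrix. The dimensions \<open>d\<close> and \<open>d'\<close> may differ, which permits passing to
  the plane or adding a coordinate.\<close>

lemma gauss_joint_law:
  assumes "inner_prod d a a = inner_prod d' a' a'" "inner_prod d b b = inner_prod d' b' b'"
    "inner_prod d c c = inner_prod d' c' c'" "inner_prod d a b = inner_prod d' a' b'"
    "inner_prod d a c = inner_prod d' a' c'" "inner_prod d b c = inner_prod d' b' c'"
    and "A \<in> sets borel" "B \<in> sets borel" "C \<in> sets borel"
  shows "(\<integral>\<omega>. indicator A (inner_prod d a \<omega>) * indicator B (inner_prod d b \<omega>) *
      indicator C (inner_prod d c \<omega>) \<partial>gauss_tape) =
    (\<integral>\<omega>. indicator A (inner_prod d' a' \<omega>) * indicator B (inner_prod d' b' \<omega>) *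
      indicator C (inner_prod d' c' \<omega>) \<partial>gauss_tape :: real)"
proof (intro joint_law_unique prob_space_gauss_tape assms)
  fix r s t \<theta> :: real
  have lin: "(\<integral>x. cos (r * inner_prod d a x + (s * inner_prod d b x + t * inner_prod d c x) + \<theta>) \<partial>gauss_tape) =
     exp (- ((r * r * inner_prod d a a + s * s * inner_prod d b b + t * t * inner_prod d c c +
       2 * r * s * inner_prod d a b + 2 * r * t * inner_prod d a c + 2 * s * t * inner_prod d b c) / 2)) * cos \<theta>"
     for d a b c
  proof -
    have 1: "r * inner_prod d a x + (s * inner_prod d b x + t * inner_prod d c x) =
        inner_prod d (\<lambda>l. r * a l + (s * b l + t * c l)) x" for x
      by (simp only: inner_prod_bilinear)
    have 2: "inner_prod d (\<lambda>l. r * a l + (s * b l + t * c l)) (\<lambda>l. r * a l + (s * b l + t * c l)) =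
        r * r * inner_prod d a a + s * s * inner_prod d b b + t * t * inner_prod d c c +
       2 * r * s * inner_prod d a b + 2 * r * t * inner_prod d a c + 2 * s * t * inner_prod d b c"
      unfolding inner_prod_bilinear inner_prod_commute[of d b a] inner_prod_commute[of d c a]
        inner_prod_commute[of d c b] by (simp add: algebra_simps)
    show ?thesis
      unfolding 1 integral_cos_inner_prod 2 ..
  qed
  show "(\<integral>x. cos (r * inner_prod d a x + (s * inner_prod d b x + t * inner_prod d c x) + \<theta>) \<partial>gauss_tape) =
    (\<integral>x. cos (r * inner_prod d' a' x + (s * inner_prod d' b' x + t * inner_prod d' c' x) + \<theta>) \<partial>gauss_tape)"
    unfolding lin using assms(1-6) by simp
qed auto

text \<open>A unit vector orthogonal to \<open>p\<close> and \<open>q\<close> has the same Gram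
  matrix with them as a fresh axis in dimension \<open>Suc d\<close>, and that entry of the tape is
  independent of the first \<open>d\<close> ones.\<close>

lemma gauss_independent_of_orthogonal:
  assumes u: "inner_prod d u u = 1" "inner_prod d u p = 0" "inner_prod d u q = 0"
    and [measurable]: "A \<in> sets borel" "B \<in> sets borel" "C \<in> sets borel"
  shows "(\<integral>\<omega>. indicator A (inner_prod d u \<omega>) * indicator B (inner_prod d p \<omega>) *
      indicator C (inner_prod d q \<omega>) \<partial>gauss_tape) =
    (\<integral>\<omega>. indicator A (inner_prod d u \<omega>) \<partial>gauss_tape) *
    (\<integral>\<omega>. indicator B (inner_prod d p \<omega>) * indicator C (inner_prod d q \<omega>) \<partial>gauss_tape :: real)"
proof -
  define e where "e = (\<lambda>l. if l = d then 1 else 0 :: real)"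
  \<comment> \<open>The entry at \<open>d\<close> of a vector of dimension \<open>d\<close> is
    arbitrary and has to be cleared before the dimension grows.\<close>
  define ext where "ext x l = (if l < d then x l else 0 :: real)" for x :: "nat \<Rightarrow> real" and l
  have ext: "inner_prod (Suc d) (ext x) y = inner_prod d x y" for x y
    by (simp add: inner_prod_def ext_def)
  have ext2: "inner_prod d x (ext y) = inner_prod d x y" for x y
    by (simp add: inner_prod_def ext_def)
  have e: "inner_prod (Suc d) e x = x d" for x
    by (simp add: inner_prod_def e_def)
  have e0: "e d = 1" "ext x d = 0" for x by (auto simp: e_def ext_def)
  have law: "(\<integral>\<omega>. indicator A (inner_prod d u \<omega>) * indicator B (inner_prod d p \<omega>) *
      indicator C (inner_prod d q \<omega>) \<partial>gauss_tape) =
    (\<integral>\<omega>. indicator A (inner_prod (Suc d) e \<omega>) * indicator B (inner_prod (Suc d) (ext p) \<omega>) *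
      indicator C (inner_prod (Suc d) (ext q) \<omega>) \<partial>gauss_tape :: real)" if "C \<in> sets borel" "B \<in> sets borel" for B C
    by (rule gauss_joint_law) (simp_all add: u that, simp_all add: ext ext2 e e0)
  have ind: "gauss.indep_var (PiM {d} (\<lambda>_. borel)) (\<lambda>\<omega>. restrict (\<lambda>l. \<omega> l) {d})
      (PiM {..<d} (\<lambda>_. borel)) (\<lambda>\<omega>. restrict (\<lambda>l. \<omega> l) {..<d})"
    by (rule gauss.indep_var_restrict[OF indep_vars_gauss_tape]) auto
  have [measurable]: "(\<lambda>x. \<Sum>l<d. a l * x l) \<in> borel_measurable (PiM {..<d} (\<lambda>_. borel))"
    for a :: "nat \<Rightarrow> real"
    by (intro borel_measurable_sum borel_measurable_times borel_measurable_const
        measurable_component_singleton)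
  have "gauss.indep_var borel
      ((\<lambda>x. indicator A (x d) :: real) \<circ> (\<lambda>\<omega>. restrict (\<lambda>l. \<omega> l) {d})) borel
      ((\<lambda>x. indicator B (\<Sum>l<d. p l * x l) * indicator C (\<Sum>l<d. q l * x l) :: real) \<circ>
        (\<lambda>\<omega>. restrict (\<lambda>l. \<omega> l) {..<d}))"
    by (rule gauss.indep_var_compose[OF ind]) measurable
  then have "gauss.indep_var borel (\<lambda>\<omega>. indicator A (\<omega> d) :: real)
      borel (\<lambda>\<omega>. indicator B (inner_prod d p \<omega>) * indicator C (inner_prod d q \<omega>) :: real)"
    by (simp add: comp_def inner_prod_def)
  then have "(\<integral>\<omega>. indicator A (\<omega> d) * (indicator B (inner_prod d p \<omega>) * indicator C (inner_prod d q \<omega>)) \<partial>gauss_tape :: real) =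
    (\<integral>\<omega>. indicator A (\<omega> d) \<partial>gauss_tape) *
    (\<integral>\<omega>. indicator B (inner_prod d p \<omega>) * indicator C (inner_prod d q \<omega>) \<partial>gauss_tape)"
    by (rule gauss.indep_var_lebesgue_integral)
       (rule gauss_integrable_bounded[where B = 1]; simp add: indicator_def)+
  moreover have "(\<integral>\<omega>. indicator A (inner_prod d u \<omega>) \<partial>gauss_tape :: real) = (\<integral>\<omega>. indicator A (\<omega> d) \<partial>gauss_tape)"
    using law[of UNIV UNIV] by (simp add: e)
  ultimately show ?thesis
    unfolding law[OF \<open>C \<in> _\<close> \<open>B \<in> _\<close>] by (simp add: e ext mult_ac)
qed

text \<open>A unit vector has the law of the first tape entry, which is the case of dimension 1;
  zero vectors fill the two idle places of the joint law.\<close>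

lemma gauss_strip_law:
  assumes "inner_prod d u u = 1" "A \<in> sets borel"
  shows "gauss.prob {\<omega>. inner_prod d u \<omega> \<in> A} = measure std_normal_distribution A"
proof -
  have 1: "inner_prod (Suc 0) (\<lambda>_. 1) x = x 0" for x by (simp add: inner_prod_def)
  have ind: "(\<integral>\<omega>. indicator A (f \<omega>) \<partial>gauss_tape) = gauss.prob {\<omega>. f \<omega> \<in> A}" for f
  proof -
    have "(\<integral>\<omega>. indicator A (f \<omega>) \<partial>gauss_tape) = (\<integral>\<omega>. indicator {\<omega>. f \<omega> \<in> A} \<omega> \<partial>gauss_tape :: real)"
      by (intro Bochner_Integration.integral_cong) (auto simp: indicator_def)
    then show ?thesis by simp
  qed
  have "(\<integral>\<omega>. indicator A (inner_prod d u \<omega>) * indicator UNIV (inner_prod d (\<lambda>_. 0) \<omega>) *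
      indicator UNIV (inner_prod d (\<lambda>_. 0) \<omega>) \<partial>gauss_tape) =
    (\<integral>\<omega>. indicator A (inner_prod (Suc 0) (\<lambda>_. 1) \<omega>) * indicator UNIV (inner_prod (Suc 0) (\<lambda>_. 0) \<omega>) *
      indicator UNIV (inner_prod (Suc 0) (\<lambda>_. 0) \<omega>) \<partial>gauss_tape :: real)"
    using assms by (intro gauss_joint_law) (simp_all, simp_all add: inner_prod_def)
  then have "gauss.prob {\<omega>. inner_prod d u \<omega> \<in> A} = gauss.prob {\<omega>. \<omega> 0 \<in> A}"
    by (simp add: ind 1)
  also have "\<dots> = measure (distr gauss_tape borel (\<lambda>\<omega>. \<omega> 0)) A"
    using assms(2) by (subst measure_distr) (auto simp: vimage_def)
  finally show ?thesis by (simp add: distr_gauss_tape_component)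
qed

text \<open>The standard normal density is at most 1/2 everywhere and at least 1/6 between -1 and 1,
  and the strip is an interval of length \<open>2 * \<delta>\<close>.\<close>

lemma gauss_strip:
  assumes u: "inner_prod d u u = 1" and \<delta>: "0 \<le> \<delta>"
  shows "gauss.prob {\<omega>. \<bar>inner_prod d u \<omega>\<bar> \<le> \<delta>} \<le> \<delta>"
    and "\<delta> \<le> 1 \<Longrightarrow> \<delta> / 3 \<le> gauss.prob {\<omega>. \<bar>inner_prod d u \<omega>\<bar> \<le> \<delta>}"
proof -
  have "gauss.prob {\<omega>. \<bar>inner_prod d u \<omega>\<bar> \<le> \<delta>} = gauss.prob {\<omega>. inner_prod d u \<omega> \<in> {-\<delta>..\<delta>}}"
    by (intro arg_cong[where f = gauss.prob]) auto
  also have "\<dots> = measure std_normal_distribution {-\<delta>..\<delta>}"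
    using u by (rule gauss_strip_law) simp
  also have "ennreal \<dots> = emeasure std_normal_distribution {-\<delta>..\<delta>}"
    using prob_space_normal_density[of 1 0]
    by (simp add: finite_measure.emeasure_eq_measure prob_space_def)
  also have "\<dots> = (\<integral>\<^sup>+x. ennreal (std_normal_density x) * indicator {-\<delta>..\<delta>} x \<partial>lborel)"
    by (subst emeasure_density) auto
  finally have eq: "ennreal (gauss.prob {\<omega>. \<bar>inner_prod d u \<omega>\<bar> \<le> \<delta>}) =
      (\<integral>\<^sup>+x. ennreal (std_normal_density x) * indicator {-\<delta>..\<delta>} x \<partial>lborel)" .
  have sq: "2 \<le> sqrt (2 * pi)"
    using pi_gt3 by (intro real_le_rsqrt) auto
  have "ennreal (gauss.prob {\<omega>. \<bar>inner_prod d u \<omega>\<bar> \<le> \<delta>}) \<le>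
      (\<integral>\<^sup>+x. ennreal (1 / 2) * indicator {-\<delta>..\<delta>} x \<partial>lborel)"
    unfolding eq
  proof (intro nn_integral_mono mult_right_mono ennreal_leI)
    fix x
    have "1 / sqrt (2 * pi) * exp (- x\<^sup>2 / 2) \<le> 1 / 2 * 1"
      using sq by (intro mult_mono) (auto simp: field_simps)
    then show "std_normal_density x \<le> 1 / 2" by (simp add: std_normal_density_def)
  qed auto
  also have "\<dots> = ennreal (1 / 2) * ennreal (2 * \<delta>)"
    using \<delta> by (simp add: nn_integral_cmult_indicator)
  also have "\<dots> = ennreal \<delta>" using \<delta> by (subst ennreal_mult[symmetric]) auto
  finally show "gauss.prob {\<omega>. \<bar>inner_prod d u \<omega>\<bar> \<le> \<delta>} \<le> \<delta>" using \<delta> by simp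
  assume \<delta>1: "\<delta> \<le> 1"
  have sq': "sqrt (2 * pi) \<le> 3"
    using pi_less_4 by (intro real_le_lsqrt) auto
  have "ennreal (\<delta> / 3) = ennreal (1 / 6) * ennreal (2 * \<delta>)"
    using \<delta> by (simp flip: ennreal_mult)
  also have "\<dots> = (\<integral>\<^sup>+x. ennreal (1 / 6) * indicator {-\<delta>..\<delta>} x \<partial>lborel)"
    using \<delta> by (simp add: nn_integral_cmult_indicator)
  also have "\<dots> \<le> ennreal (gauss.prob {\<omega>. \<bar>inner_prod d u \<omega>\<bar> \<le> \<delta>})"
    unfolding eq
  proof (rule nn_integral_mono)
    fix x
    show "ennreal (1 / 6) * indicator {-\<delta>..\<delta>} x \<le> ennreal (std_normal_density x) * indicator {-\<delta>..\<delta>} x"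
    proof (cases "x \<in> {-\<delta>..\<delta>}")
      case True
      then have "\<bar>x\<bar> \<le> 1" using \<delta>1 by auto
      then have "x\<^sup>2 \<le> 1" by (simp add: abs_square_le_1)
      then have "1 / 2 \<le> exp (- x\<^sup>2 / 2)"
        using exp_ge_add_one_self[of "- x\<^sup>2 / 2"] by simp
      then have "1 / 3 * (1 / 2) \<le> 1 / sqrt (2 * pi) * exp (- x\<^sup>2 / 2)"
        using sq' pi_gt_zero by (intro mult_mono) (auto simp: field_simps)
      then show ?thesis using True by (intro mult_right_mono ennreal_leI) (auto simp: std_normal_density_def)
    qed simp
  qed
  finally show "\<delta> / 3 \<le> gauss.prob {\<omega>. \<bar>inner_prod d u \<omega>\<bar> \<le> \<delta>}" by simp
qed

section \<open>The sign correlation\<close>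

text \<open>Never 0, so that the signs always form a cut; ties go to 1, as in the test made by
  \<open>sign_phase\<close>.\<close>

definition sgn_pm :: "real \<Rightarrow> real" where
  "sgn_pm x = (if x < 0 then -1 else 1)"

lemma sgn_pm_measurable [measurable]: "sgn_pm \<in> borel_measurable borel"
  unfolding sgn_pm_def by measurable

lemma sgn_pm_cases: "sgn_pm x = 1 \<or> sgn_pm x = -1"
  by (simp add: sgn_pm_def)

lemma sgn_pm_eq_iff: "sgn_pm x = sgn_pm y \<longleftrightarrow> (x < 0 \<longleftrightarrow> y < 0)"
  by (simp add: sgn_pm_def)

lemma abs_sgn_pm [simp]: "\<bar>sgn_pm x\<bar> = 1"
  by (simp add: sgn_pm_def)

lemma sgn_pm_indicator: "sgn_pm x = indicator {0..} x - indicator {..<0} x"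
  by (auto simp: sgn_pm_def indicator_def)

definition sign_mismatch :: "nat \<Rightarrow> (nat \<Rightarrow> real) \<Rightarrow> (nat \<Rightarrow> real) \<Rightarrow> real" where
  "sign_mismatch d a b =
     gauss.prob {\<omega>. sgn_pm (inner_prod d a \<omega>) \<noteq> sgn_pm (inner_prod d b \<omega>)}"

lemma sign_mismatch_set [measurable]:
  "{\<omega>. sgn_pm (inner_prod d a \<omega>) \<noteq> sgn_pm (inner_prod d b \<omega>)} \<in> sets gauss_tape"
proof -
  have "{\<omega>\<in>space gauss_tape. sgn_pm (inner_prod d a \<omega>) \<noteq> sgn_pm (inner_prod d b \<omega>)} \<in> sets gauss_tape"
    unfolding sgn_pm_eq_iff by measurable
  then show ?thesis by simp
qed

lemma integral_sgn_pm_product: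
  "(\<integral>\<omega>. sgn_pm (inner_prod d a \<omega>) * sgn_pm (inner_prod d b \<omega>) \<partial>gauss_tape) = 1 - 2 * sign_mismatch d a b"
proof -
  have "(\<integral>\<omega>. sgn_pm (inner_prod d a \<omega>) * sgn_pm (inner_prod d b \<omega>) \<partial>gauss_tape) =
    (\<integral>\<omega>. 1 - 2 * indicator {\<omega>. sgn_pm (inner_prod d a \<omega>) \<noteq> sgn_pm (inner_prod d b \<omega>)} \<omega> \<partial>gauss_tape)"
    by (intro Bochner_Integration.integral_cong) (auto simp: sgn_pm_def indicator_def)
  also have "\<dots> = 1 - 2 * sign_mismatch d a b"
  proof -
    have "integrable gauss_tape (indicator {\<omega>. sgn_pm (inner_prod d a \<omega>) \<noteq> sgn_pm (inner_prod d b \<omega>)} :: _ \<Rightarrow> real)"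
      by (intro gauss_integrable_bounded[where B = 1] borel_measurable_indicator sign_mismatch_set)
         (simp add: indicator_def)
    then show ?thesis unfolding sign_mismatch_def by simp
  qed
  finally show ?thesis .
qed

lemma sign_mismatch_law:
  assumes "inner_prod d a a = inner_prod d' a' a'" "inner_prod d b b = inner_prod d' b' b'"
    "inner_prod d a b = inner_prod d' a' b'"
  shows "sign_mismatch d a b = sign_mismatch d' a' b'"
proof -
  have eq: "sign_mismatch d a b =
      (\<integral>\<omega>. indicator {..<0} (inner_prod d a \<omega>) * indicator {0..} (inner_prod d b \<omega>) * indicator UNIV (inner_prod d (\<lambda>_. 0) \<omega>) \<partial>gauss_tape) +
      (\<integral>\<omega>. indicator {0..} (inner_prod d a \<omega>) * indicator {..<0} (inner_prod d b \<omega>) * indicator UNIV (inner_prod d (\<lambda>_. 0) \<omega>) \<partial>gauss_tape)"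
    for d a b
  proof -
    have "sign_mismatch d a b = (\<integral>\<omega>. indicator {\<omega>. sgn_pm (inner_prod d a \<omega>) \<noteq> sgn_pm (inner_prod d b \<omega>)} \<omega> \<partial>gauss_tape)"
      by (simp add: sign_mismatch_def)
    also have "\<dots> = (\<integral>\<omega>. indicator {..<0} (inner_prod d a \<omega>) * indicator {0..} (inner_prod d b \<omega>) * indicator UNIV (inner_prod d (\<lambda>_. 0) \<omega>)
      + indicator {0..} (inner_prod d a \<omega>) * indicator {..<0} (inner_prod d b \<omega>) * indicator UNIV (inner_prod d (\<lambda>_. 0) \<omega>) \<partial>gauss_tape)"
      by (intro Bochner_Integration.integral_cong) (auto simp: sgn_pm_def indicator_def)
    also have "\<dots> = (\<integral>\<omega>. indicator {..<0} (inner_prod d a \<omega>) * indicator {0..} (inner_prod d b \<omega>) * indicator UNIV (inner_prod d (\<lambda>_. 0) \<omega>) \<partial>gauss_tape) +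
      (\<integral>\<omega>. indicator {0..} (inner_prod d a \<omega>) * indicator {..<0} (inner_prod d b \<omega>) * indicator UNIV (inner_prod d (\<lambda>_. 0) \<omega>) \<partial>gauss_tape)"
      by (intro Bochner_Integration.integral_add gauss_integrable_bounded[where B = 1])
         (auto simp: indicator_def)
    finally show ?thesis .
  qed
  have zero: "inner_prod d x (\<lambda>_. 0) = 0" for d x by (simp add: inner_prod_def)
  show ?thesis
    unfolding eq using assms
    by (intro arg_cong2[where f = "(+)"] gauss_joint_law) (auto simp: zero)
qed

lemma inner_prod_uminus: "inner_prod d (\<lambda>l. - a l) x = - inner_prod d a x"
  by (simp add: inner_prod_def sum_negf)

lemma inner_prod_uminus_right: "inner_prod d x (\<lambda>l. - a l) = - inner_prod d x a"
  by (simp add: inner_prod_def sum_negf)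

lemma gauss_null:
  assumes "inner_prod d u u = 1"
  shows "gauss.prob {\<omega>. inner_prod d u \<omega> = 0} = 0"
  using gauss_strip(1)[OF assms, of 0] by (simp add: measure_le_0_iff)

lemma sign_mismatch_commute: "sign_mismatch d a b = sign_mismatch d b a"
  unfolding sign_mismatch_def by (intro arg_cong[where f = gauss.prob]) auto

lemma gauss_strip_sets [measurable]:
  "{\<omega>. inner_prod d u \<omega> = c} \<in> sets gauss_tape"
  "{\<omega>. \<bar>inner_prod d u \<omega>\<bar> \<le> c} \<in> sets gauss_tape"
proof -
  have "{\<omega>\<in>space gauss_tape. inner_prod d u \<omega> = c} \<in> sets gauss_tape"
    "{\<omega>\<in>space gauss_tape. \<bar>inner_prod d u \<omega>\<bar> \<le> c} \<in> sets gauss_tape"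
    by measurable
  then show "{\<omega>. inner_prod d u \<omega> = c} \<in> sets gauss_tape"
    "{\<omega>. \<bar>inner_prod d u \<omega>\<bar> \<le> c} \<in> sets gauss_tape" by simp_all
qed

text \<open>Negating \<open>b\<close> exchanges agreement and disagreement, except where the inner
  product with \<open>b\<close> vanishes: there \<open>sgn_pm\<close> is not odd, but this is a null
  set.\<close>

lemma sign_mismatch_uminus:
  assumes "inner_prod d b b = 1"
  shows "sign_mismatch d a b + sign_mismatch d a (\<lambda>l. - b l) = 1"
proof -
  let ?A = "{\<omega>. sgn_pm (inner_prod d a \<omega>) \<noteq> sgn_pm (inner_prod d b \<omega>)}"
  let ?B = "{\<omega>. sgn_pm (inner_prod d a \<omega>) \<noteq> sgn_pm (inner_prod d (\<lambda>l. - b l) \<omega>)}"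
  let ?Z = "{\<omega>. inner_prod d b \<omega> = 0}"
  have "AE \<omega> in gauss_tape. \<omega> \<notin> ?Z"
    using gauss_null[OF assms] gauss.prob_eq_0[of ?Z] by simp
  then have "(\<integral>\<omega>. indicator ?A \<omega> + indicator ?B \<omega> \<partial>gauss_tape) = (\<integral>\<omega>. 1 \<partial>gauss_tape :: real)"
    by (intro integral_cong_AE, measurable, measurable, elim AE_mp, intro AE_I2)
       (auto simp: indicator_def sgn_pm_def inner_prod_uminus)
  then show ?thesis
    unfolding sign_mismatch_def
    by (subst (asm) Bochner_Integration.integral_add)
       (auto intro!: gauss_integrable_bounded[where B = 1] simp: indicator_def)
qed

text \<open>The point at angle \<open>t\<close> on the unit circle, to be read in dimension
  2.\<close>

definition arc_point :: "real \<Rightarrow> nat \<Rightarrow> real" where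
  "arc_point t = (\<lambda>l. if l = 0 then cos t else sin t)"

lemma inner_prod_arc_point: "inner_prod 2 (arc_point s) x = cos s * x 0 + sin s * x 1"
  by (simp add: inner_prod_def arc_point_def numeral_2_eq_2)

lemma inner_prod_arc_point2: "inner_prod 2 (arc_point s) (arc_point t) = cos (s - t)"
  by (simp add: inner_prod_arc_point cos_diff) (simp add: arc_point_def)

lemma sign_mismatch_arc:
  "sign_mismatch 2 (arc_point s) (arc_point (s + t)) = sign_mismatch 2 (arc_point 0) (arc_point t)"
  by (rule sign_mismatch_law) (simp_all add: inner_prod_arc_point2)

text \<open>The middle vector is a positive combination of the outer two. So it shares their sign
  when they agree, and differs from exactly one of them when they disagree.
  \<open>s + t < pi\<close> keeps the coefficients positive.\<close>

lemma sign_mismatch_arc_add: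
  assumes st: "0 < s" "0 < t" "s + t < pi"
  shows "sign_mismatch 2 (arc_point 0) (arc_point (s + t)) =
    sign_mismatch 2 (arc_point 0) (arc_point s) + sign_mismatch 2 (arc_point 0) (arc_point t)"
proof -
  let ?A = "\<lambda>a b. {\<omega>. sgn_pm (inner_prod 2 (arc_point a) \<omega>) \<noteq> sgn_pm (inner_prod 2 (arc_point b) \<omega>)}"
  have pos: "sin s > 0" "sin t > 0" "sin (s + t) > 0"
    using st by (auto intro!: sin_gt_zero)
  have comb: "sin (s + t) * inner_prod 2 (arc_point s) x =
      sin t * inner_prod 2 (arc_point 0) x + sin s * inner_prod 2 (arc_point (s + t)) x" for x
  proof -
    have "sin (s + t) * cos s = sin t + sin s * cos (s + t)"
    proof -
      have "sin t = sin ((s + t) - s)" by simp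
      also have "\<dots> = sin (s + t) * cos s - cos (s + t) * sin s" by (rule sin_diff)
      finally show ?thesis by simp
    qed
    then have "sin (s + t) * (cos s * y + sin s * z) =
        sin t * (1 * y + 0 * z) + sin s * (cos (s + t) * y + sin (s + t) * z)" for y z
      by (simp only: distrib_left distrib_right mult_1_left mult_zero_left mult_zero_right
          mult.assoc[symmetric]) (simp add: algebra_simps)
    then show ?thesis by (simp only: inner_prod_arc_point cos_zero sin_zero)
  qed
  have "indicator (?A 0 (s + t)) \<omega> = indicator (?A 0 s) \<omega> + (indicator (?A s (s + t)) \<omega> :: real)" for \<omega>
  proof -
    have 1: "inner_prod 2 (arc_point s) \<omega> \<ge> 0"
      if "inner_prod 2 (arc_point 0) \<omega> \<ge> 0" "inner_prod 2 (arc_point (s + t)) \<omega> \<ge> 0"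
    proof -
      have "0 \<le> sin (s + t) * inner_prod 2 (arc_point s) \<omega>"
        unfolding comb using that pos by simp
      then show ?thesis using pos by (simp add: zero_le_mult_iff)
    qed
    have 2: "inner_prod 2 (arc_point s) \<omega> < 0"
      if "inner_prod 2 (arc_point 0) \<omega> < 0" "inner_prod 2 (arc_point (s + t)) \<omega> < 0"
    proof -
      have "sin (s + t) * inner_prod 2 (arc_point s) \<omega> < 0"
        unfolding comb using that pos by (intro add_neg_neg mult_pos_neg) auto
      then show ?thesis using pos by (simp add: mult_less_0_iff)
    qed
    show ?thesis using 1 2
      by (cases "inner_prod 2 (arc_point 0) \<omega> < 0"; cases "inner_prod 2 (arc_point s) \<omega> < 0";
          cases "inner_prod 2 (arc_point (s + t)) \<omega> < 0")
         (simp_all add: indicator_def sgn_pm_eq_iff not_less)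
  qed
  then have "(\<integral>\<omega>. indicator (?A 0 (s + t)) \<omega> \<partial>gauss_tape) =
      (\<integral>\<omega>. indicator (?A 0 s) \<omega> + indicator (?A s (s + t)) \<omega> \<partial>gauss_tape :: real)"
    by simp
  then have "sign_mismatch 2 (arc_point 0) (arc_point (s + t)) =
    sign_mismatch 2 (arc_point 0) (arc_point s) + sign_mismatch 2 (arc_point s) (arc_point (s + t))"
    unfolding sign_mismatch_def
    by (subst (asm) Bochner_Integration.integral_add)
       (auto intro!: gauss_integrable_bounded[where B = 1] simp: indicator_def)
  then show ?thesis by (simp only: sign_mismatch_arc)
qed

text \<open>Cauchy's functional equation: an additive monotone function is linear. The values at
  multiples of \<open>pi / N\<close> are exact, and monotonicity squeezes the rest.\<close>

lemma sign_mismatch_arc_eq: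
  assumes \<theta>: "0 \<le> \<theta>" "\<theta> < pi"
  shows "sign_mismatch 2 (arc_point 0) (arc_point \<theta>) = \<theta> / pi"
proof -
  define h where "h t = sign_mismatch 2 (arc_point 0) (arc_point t)" for t
  have h0: "h 0 = 0" by (simp add: h_def sign_mismatch_def)
  have h_bounds: "0 \<le> h t" "h t \<le> 1" for t by (simp_all add: h_def sign_mismatch_def)
  have h_add: "h (s + t) = h s + h t" if "0 \<le> s" "0 \<le> t" "s + t < pi" for s t
    using that sign_mismatch_arc_add[of s t] h0 unfolding h_def by (cases "s = 0 \<or> t = 0") auto
  have h_mono: "h s \<le> h t" if "0 \<le> s" "s \<le> t" "t < pi" for s t
    using h_add[of s "t - s"] h_bounds[of "t - s"] that by simp
  \<comment> \<open>Additivity stops short of \<open>pi\<close>, so the normalisation cannot come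
    from the value there; the antipode of the point at angle 0 supplies it.\<close>
  have h_compl: "h t + h (pi - t) = 1" for t
  proof -
    have "h (pi - t) = sign_mismatch 2 (arc_point t) (arc_point (t + (pi - t)))"
      by (simp only: sign_mismatch_arc h_def)
    also have "arc_point (t + (pi - t)) = (\<lambda>l. - arc_point 0 l)"
      by (simp add: arc_point_def fun_eq_iff)
    also have "sign_mismatch 2 (arc_point t) (\<lambda>l. - arc_point 0 l) =
        1 - sign_mismatch 2 (arc_point t) (arc_point 0)"
      using sign_mismatch_uminus[of 2 "arc_point 0" "arc_point t"] by (simp add: inner_prod_arc_point2)
    finally show ?thesis by (simp add: h_def sign_mismatch_commute)
  qed
  have grid_less: "real k * (pi / real N) < pi" if "k < N" for k N
  proof -
    have "pi * (real k / real N) < pi * 1" using that by (intro mult_strict_left_mono) auto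
    then show ?thesis by (simp add: mult.commute)
  qed
  have grid: "h (real k * (pi / real N)) = real k / real N" if "k < N" for k N
  proof -
    have step: "h (real k * (pi / real N)) = real k * h (pi / real N)" if "k < N" for k
      using that
    proof (induction k)
      case 0
      then show ?case by (simp add: h0)
    next
      case (Suc k)
      have "real (Suc k) * (pi / real N) < pi" using Suc.prems by (rule grid_less)
      then have "h (real k * (pi / real N) + pi / real N) = h (real k * (pi / real N)) + h (pi / real N)"
        by (intro h_add) (auto simp: algebra_simps add_divide_distrib)
      moreover have "real (Suc k) * (pi / real N) = real k * (pi / real N) + pi / real N"
        by (simp add: algebra_simps add_divide_distrib)
      ultimately show ?case using Suc by (simp only: Suc_lessD) (simp add: algebra_simps)
    qed
    have N: "N > 0" using that by simp
    have "real (N - 1) * h (pi / real N) + h (pi / real N) = 1"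
    proof -
      have "pi - pi / real N = real (N - 1) * (pi / real N)"
        using N by (simp add: of_nat_diff field_simps)
      then show ?thesis using h_compl[of "pi / real N"] step[of "N - 1"] N by simp
    qed
    then have "real N * h (pi / real N) = 1"
      using N by (simp add: of_nat_diff algebra_simps)
    then have "h (pi / real N) = 1 / real N" using N by (simp add: field_simps)
    then show ?thesis using step[OF that] by simp
  qed
  have close: "\<bar>h \<theta> - \<theta> / pi\<bar> \<le> 1 / real N" if N: "N > 0" for N
  proof -
    define k where "k = nat \<lfloor>\<theta> / pi * real N\<rfloor>"
    have k: "real k \<le> \<theta> / pi * real N" "\<theta> / pi * real N < real k + 1"
      using \<theta> by (auto simp: k_def)
    have "\<theta> / pi * real N < 1 * real N" using \<theta> N by (intro mult_strict_right_mono) auto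
    with k have kN: "k < N" by linarith
    have 1: "real k * (pi / real N) \<le> \<theta>" "\<theta> \<le> real (Suc k) * (pi / real N)"
      using k N by (auto simp: field_simps)
    have "real k / real N \<le> h \<theta>"
      using h_mono[OF _ 1(1)] \<theta> grid[OF kN] by simp
    moreover have "h \<theta> \<le> real (Suc k) / real N"
    proof (cases "Suc k < N")
      case True
      then have "real (Suc k) * (pi / real N) < pi" by (rule grid_less)
      then show ?thesis using h_mono[OF _ 1(2)] \<theta> grid[OF True] by simp
    next
      case False
      then have "Suc k = N" using kN by simp
      then show ?thesis using h_bounds[of \<theta>] N by simp
    qed
    moreover have "real k / real N \<le> \<theta> / pi" "\<theta> / pi \<le> real (Suc k) / real N"
      using k N by (simp_all add: field_simps)
    moreover have "real (Suc k) / real N = real k / real N + 1 / real N"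
      by (simp add: add_divide_distrib)
    ultimately show ?thesis by linarith
  qed
  have "\<bar>h \<theta> - \<theta> / pi\<bar> \<le> 0"
  proof (rule field_le_epsilon)
    fix e :: real assume "e > 0"
    then obtain N where "1 / real (Suc N) < e" using nat_approx_posE by blast
    with close[of "Suc N"] show "\<bar>h \<theta> - \<theta> / pi\<bar> \<le> 0 + e" by simp
  qed
  then show ?thesis by (simp add: h_def)
qed

lemma Cauchy_Schwarz_inner_prod:
  assumes "inner_prod d a a = 1" "inner_prod d b b = 1"
  shows "\<bar>inner_prod d a b\<bar> \<le> 1"
proof -
  have "0 \<le> inner_prod d (\<lambda>l. a l - b l) (\<lambda>l. a l - b l)" "0 \<le> inner_prod d (\<lambda>l. a l + b l) (\<lambda>l. a l + b l)"
    by (rule inner_prod_self_nonneg)+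
  then show ?thesis
    using assms inner_prod_commute[of d a b] by (simp add: inner_prod_bilinear abs_le_iff)
qed

lemma sign_mismatch_eq:
  assumes a: "inner_prod d a a = 1" and b: "inner_prod d b b = 1"
  shows "sign_mismatch d a b = arccos (inner_prod d a b) / pi"
proof -
  have ab: "\<bar>inner_prod d a b\<bar> \<le> 1" using a b by (rule Cauchy_Schwarz_inner_prod)
  have *: "sign_mismatch d a b = arccos (inner_prod d a b) / pi"
    if a: "inner_prod d a a = 1" and b: "inner_prod d b b = 1" and ab: "-1 < inner_prod d a b" "inner_prod d a b \<le> 1"
    for a b
  proof -
    have "arccos (inner_prod d a b) < arccos (-1)"
      using ab by (intro arccos_less_arccos) auto
    moreover have "sign_mismatch d a b = sign_mismatch 2 (arc_point 0) (arc_point (arccos (inner_prod d a b)))"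
      using a b ab by (intro sign_mismatch_law) (auto simp: inner_prod_arc_point2)
    ultimately show ?thesis using ab by (simp add: sign_mismatch_arc_eq arccos_lbound)
  qed
  show ?thesis
  \<comment> \<open>The planar formula excludes the angle \<open>pi\<close>; in that case
    \<open>- b\<close> has inner product 1 with \<open>a\<close>, and the two mismatches add up to
    1.\<close>
  proof (cases "inner_prod d a b = -1")
    case True
    have "sign_mismatch d a (\<lambda>l. - b l) = 0"
      using a b True by (subst *) (auto simp: inner_prod_uminus inner_prod_uminus_right)
    then show ?thesis using sign_mismatch_uminus[OF b, of a] True by simp
  qed (use * a b ab in auto)
qed

text \<open>This is Grothendieck's identity. The arcsine takes the place of the arccosine because
  the kernel bound works with its power series.\<close>

lemma integral_sgn_pm_product_eq:
  assumes a: "inner_prod d a a = 1" and b: "inner_prod d b b = 1"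
  shows "(\<integral>\<omega>. sgn_pm (inner_prod d a \<omega>) * sgn_pm (inner_prod d b \<omega>) \<partial>gauss_tape) =
    2 / pi * arcsin (inner_prod d a b)"
proof -
  have "arcsin (inner_prod d a b) = pi / 2 - arccos (inner_prod d a b)"
    using Cauchy_Schwarz_inner_prod[OF a b] by (simp add: arccos_arcsin_eq abs_le_iff)
  then show ?thesis
    by (simp add: integral_sgn_pm_product sign_mismatch_eq[OF a b] field_simps)
qed

text \<open>Restricting the value along \<open>u\<close> does not disturb the signs of vectors
  orthogonal to \<open>u\<close>. Independence is stated for indicators, hence the expansion of both
  signs into four products.\<close>

lemma integral_strip_sgn_pm_product:
  assumes u: "inner_prod d u u = 1" "inner_prod d u p = 0" "inner_prod d u q = 0"
    and p: "inner_prod d p p = 1" and q: "inner_prod d q q = 1" and A[measurable]: "A \<in> sets borel"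
  shows "(\<integral>\<omega>. indicator A (inner_prod d u \<omega>) *
      (sgn_pm (inner_prod d p \<omega>) * sgn_pm (inner_prod d q \<omega>)) \<partial>gauss_tape) =
    (\<integral>\<omega>. indicator A (inner_prod d u \<omega>) \<partial>gauss_tape) * (2 / pi * arcsin (inner_prod d p q))"
proof -
  define N P :: "real set" where "N = {..<0}" and "P = {0..}"
  have [measurable]: "N \<in> sets borel" "P \<in> sets borel" by (auto simp: N_def P_def)
  define J where "J B C \<omega> = indicator B (inner_prod d p \<omega>) * (indicator C (inner_prod d q \<omega>) :: real)" for B C \<omega>
  define I where "I B C \<omega> = indicator A (inner_prod d u \<omega>) * J B C \<omega>" for B C \<omega>
  have int: "integrable gauss_tape (I B C)" "integrable gauss_tape (J B C)"
    if [measurable]: "B \<in> sets borel" "C \<in> sets borel" for B C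
    unfolding I_def J_def by (rule gauss_integrable_bounded[where B = 1]; simp add: indicator_def)+
  have expand: "sgn_pm (inner_prod d p \<omega>) * sgn_pm (inner_prod d q \<omega>) =
      J P P \<omega> + J N N \<omega> - (J P N \<omega> + J N P \<omega>)" for \<omega>
    by (simp add: sgn_pm_indicator J_def N_def P_def algebra_simps)
  have expand': "indicator A (inner_prod d u \<omega>) * (sgn_pm (inner_prod d p \<omega>) * sgn_pm (inner_prod d q \<omega>)) =
      I P P \<omega> + I N N \<omega> - (I P N \<omega> + I N P \<omega>)" for \<omega>
    unfolding expand by (simp add: I_def algebra_simps)
  have I: "(\<integral>\<omega>. I B C \<omega> \<partial>gauss_tape) = (\<integral>\<omega>. indicator A (inner_prod d u \<omega>) \<partial>gauss_tape) * (\<integral>\<omega>. J B C \<omega> \<partial>gauss_tape)"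
    if "B \<in> sets borel" "C \<in> sets borel" for B C
    using gauss_independent_of_orthogonal[OF u A that] by (simp add: I_def J_def mult.assoc)
  have "(\<integral>\<omega>. indicator A (inner_prod d u \<omega>) *
      (sgn_pm (inner_prod d p \<omega>) * sgn_pm (inner_prod d q \<omega>)) \<partial>gauss_tape) =
    (\<integral>\<omega>. indicator A (inner_prod d u \<omega>) \<partial>gauss_tape) *
    ((\<integral>\<omega>. J P P \<omega> \<partial>gauss_tape) + (\<integral>\<omega>. J N N \<omega> \<partial>gauss_tape) - ((\<integral>\<omega>. J P N \<omega> \<partial>gauss_tape) + (\<integral>\<omega>. J N P \<omega> \<partial>gauss_tape)))"
    unfolding expand' by (simp add: int I) (simp add: algebra_simps)
  also have "(\<integral>\<omega>. J P P \<omega> \<partial>gauss_tape) + (\<integral>\<omega>. J N N \<omega> \<partial>gauss_tape) - ((\<integral>\<omega>. J P N \<omega> \<partial>gauss_tape) + (\<integral>\<omega>. J N P \<omega> \<partial>gauss_tape)) =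
      (\<integral>\<omega>. sgn_pm (inner_prod d p \<omega>) * sgn_pm (inner_prod d q \<omega>) \<partial>gauss_tape)"
    unfolding expand by (simp add: int)
  finally show ?thesis by (simp only: integral_sgn_pm_product_eq[OF p q])
qed

section \<open>A lower bound for the arcsine kernel\<close>

definition arcsin_coeff :: "nat \<Rightarrow> real" where
  "arcsin_coeff k = real (2 * k choose k) / (4 ^ k * real (2 * k + 1))"

text \<open>Only the exponential rate matters: the binomial coefficient is at least 1 and
  \<open>2 * k + 1\<close> is at most \<open>3 ^ k\<close>, whence 12 as 4 times 3.\<close>

lemma arcsin_coeff_ge: "1 / 12 ^ k \<le> arcsin_coeff k"
proof -
  have "2 * k + 1 \<le> 3 ^ k" by (induction k) auto
  then have "real (2 * k + 1) \<le> 3 ^ k" by (metis of_nat_le_iff of_nat_numeral of_nat_power)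
  then have "4 ^ k * real (2 * k + 1) \<le> 4 ^ k * 3 ^ k" by (intro mult_left_mono) auto
  also have "(4::real) ^ k * 3 ^ k = 12 ^ k" by (simp flip: power_mult_distrib)
  finally have le: "4 ^ k * real (2 * k + 1) \<le> 12 ^ k" .
  have "1 \<le> (2 * k choose k)" by (simp add: Suc_le_eq)
  then have "1 \<le> real (2 * k choose k)" by linarith
  with le show ?thesis unfolding arcsin_coeff_def by (intro frac_le) auto
qed

lemma arcsin_coeff_nonneg: "0 \<le> arcsin_coeff k"
  by (simp add: arcsin_coeff_def)

text \<open>On both sides the ratio of consecutive terms is (2k + 1) / (2k + 2).\<close>

lemma gbinomial_minus_half: "((-1/2 :: real) gchoose k) * (-1) ^ k = real (2 * k choose k) / 4 ^ k"
proof (induction k)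
  case 0
  then show ?case by simp
next
  case (Suc k)
  have "((-1/2 :: real) gchoose Suc k) * (-1) ^ Suc k =
      (((-1/2) gchoose k) * (-1) ^ k) * ((1/2 + real k) / real (Suc k))"
    using gbinomial_absorb_comp[of "-1/2 :: real" k] gbinomial_absorption'[of "Suc k" "-1/2 :: real"]
    by (simp add: gbinomial_Suc_rec field_simps)
  also have "\<dots> = real (2 * k choose k) / 4 ^ k * ((1/2 + real k) / real (Suc k))"
    by (simp only: Suc)
  also have "\<dots> = real (2 * Suc k choose Suc k) / 4 ^ Suc k"
  proof -
    have "Suc k * (2 * Suc k choose Suc k) = 2 * (2 * k + 1) * (2 * k choose k)"
    proof -
      have "Suc k * (2 * Suc k choose Suc k) = (2 * k + 2) * (2 * k + 1 choose k)"
        using Suc_times_binomial_eq[of "2 * k + 1" k] by (simp add: mult.commute)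
      moreover have "Suc k * (2 * k + 1 choose k) = (2 * k + 1) * (2 * k choose k)"
        using binomial_absorb_comp[of "2 * k + 1" k] by simp
      ultimately have "Suc k * (Suc k * (2 * Suc k choose Suc k)) = Suc k * (2 * (2 * k + 1) * (2 * k choose k))"
        by (simp add: algebra_simps)
      then show ?thesis by (simp only: mult_cancel1) simp
    qed
    then have "real (Suc k) * real (2 * Suc k choose Suc k) = 2 * (2 * real k + 1) * real (2 * k choose k)"
      by (metis (mono_tags, opaque_lifting) of_nat_1 of_nat_add of_nat_mult of_nat_numeral)
    moreover have "C / p * ((1 / 2 + m) / n) = C' / (4 * p)"
      if "n * C' = 2 * (2 * m + 1) * C" "n > 0" "p > 0" for n C' m C p :: real
    proof -
      have "C / p * ((1 / 2 + m) / n) = (2 * (2 * m + 1) * C) / (4 * p * n)"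
        using that(2,3) by (simp add: field_simps)
      then show ?thesis unfolding that(1)[symmetric] using that(2,3) by simp
    qed
    ultimately show ?thesis by (simp only: power_Suc) simp
  qed
  finally show ?case .
qed

text \<open>Newton's binomial series with exponent -1/2, at \<open>- (x\<^sup>2)\<close>.\<close>

lemma inverse_sqrt_series:
  fixes x :: real
  assumes "\<bar>x\<bar> < 1"
  shows "(\<lambda>k. real (2 * k choose k) / 4 ^ k * x ^ (2 * k)) sums (1 / sqrt (1 - x\<^sup>2))"
proof -
  have x2: "x\<^sup>2 < 1" using assms by (simp add: abs_square_less_1)
  have "(\<lambda>k. ((-1/2) gchoose k) * (- (x\<^sup>2)) ^ k) sums ((1 + - (x\<^sup>2)) powr (-1/2))"
    using x2 by (intro gen_binomial_real) (auto simp: abs_less_iff)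
  moreover have "((-1/2) gchoose k) * (- (x\<^sup>2)) ^ k = real (2 * k choose k) / 4 ^ k * x ^ (2 * k)" for k
  proof -
    have "(- (x\<^sup>2)) ^ k = (-1) ^ k * x ^ (2 * k)"
      by (subst power_minus) (simp add: power_mult)
    then show ?thesis by (simp flip: gbinomial_minus_half)
  qed
  moreover have "(1 + - (x\<^sup>2)) powr (-1/2) = 1 / sqrt (1 - x\<^sup>2)"
    using x2 powr_minus_divide[of "1 - x\<^sup>2" "1/2"] by (simp add: powr_half_sqrt)
  ultimately show ?thesis by simp
qed

text \<open>Both sides vanish at 0 and have the same derivative, by differentiating term by term and
  \<open>inverse_sqrt_series\<close>.\<close>

lemma arcsin_series:
  fixes x :: real
  assumes x: "\<bar>x\<bar> < 1"
  shows "(\<lambda>k. arcsin_coeff k * x ^ (2 * k + 1)) sums arcsin x"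
proof -
  \<comment> \<open>Termwise differentiation concerns full power series, so the coefficients are
    interleaved with zeros and reindexed back at the end.\<close>
  define c where "c n = (if even n then 0 else arcsin_coeff (n div 2))" for n
  have reindex: "(\<lambda>n. c n * y ^ n) sums s \<longleftrightarrow> (\<lambda>k. arcsin_coeff k * y ^ (2 * k + 1)) sums s" for y s
  proof -
    have "(\<lambda>k. c (2 * k + 1) * y ^ (2 * k + 1)) sums s \<longleftrightarrow> (\<lambda>n. c n * y ^ n) sums s"
    proof (rule sums_mono_reindex)
      fix n :: nat assume "n \<notin> range (\<lambda>k. 2 * k + 1)"
      then have "even n" by (metis oddE rangeI)
      then show "c n * y ^ n = 0" by (simp add: c_def)
    qed (simp add: strict_mono_def)
    then show ?thesis by (simp add: c_def)
  qed
  have summable: "summable (\<lambda>n. c n * y ^ n)" if "\<bar>y\<bar> < 1" for y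
  proof -
    have "summable (\<lambda>k. arcsin_coeff k * y ^ (2 * k + 1))"
    proof (rule summable_comparison_test)
      show "summable (\<lambda>k. real (2 * k choose k) / 4 ^ k * \<bar>y\<bar> ^ (2 * k))"
        using inverse_sqrt_series[of "\<bar>y\<bar>"] that by (auto simp: sums_iff)
      have "norm (arcsin_coeff k * y ^ (2 * k + 1)) \<le> real (2 * k choose k) / 4 ^ k * \<bar>y\<bar> ^ (2 * k)" for k
      proof -
        have "arcsin_coeff k \<le> real (2 * k choose k) / 4 ^ k"
          unfolding arcsin_coeff_def by (intro divide_left_mono) auto
        moreover have "\<bar>y\<bar> ^ (2 * k + 1) \<le> \<bar>y\<bar> ^ (2 * k)"
          using that by (intro power_decreasing) auto
        ultimately show ?thesis
          unfolding real_norm_def abs_mult power_abs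
          using arcsin_coeff_nonneg[of k] by (intro mult_mono) auto
      qed
      then show "\<exists>N. \<forall>n\<ge>N. norm (arcsin_coeff n * y ^ (2 * n + 1)) \<le> real (2 * n choose n) / 4 ^ n * \<bar>y\<bar> ^ (2 * n)"
        by blast
    qed
    then show ?thesis using reindex by (auto simp: summable_def)
  qed
  define F where "F y = (\<Sum>n. c n * y ^ n)" for y
  have deriv: "(F has_field_derivative 1 / sqrt (1 - y\<^sup>2)) (at y)" if y: "\<bar>y\<bar> < 1" for y
  proof -
    have "(F has_field_derivative (\<Sum>n. diffs c n * y ^ n)) (at y)"
      unfolding F_def using summable y by (intro termdiffs_strong'[where K = 1]) auto
    moreover have "(\<lambda>n. diffs c n * y ^ n) sums (1 / sqrt (1 - y\<^sup>2))"
    proof -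
      have "(\<lambda>k. diffs c (2 * k) * y ^ (2 * k)) sums (1 / sqrt (1 - y\<^sup>2))"
        using inverse_sqrt_series[OF y] by (simp add: diffs_def c_def arcsin_coeff_def add.commute)
      moreover have "(\<lambda>k. diffs c (2 * k) * y ^ (2 * k)) sums s \<longleftrightarrow> (\<lambda>n. diffs c n * y ^ n) sums s" for s
      proof (rule sums_mono_reindex)
        fix n :: nat assume "n \<notin> range (\<lambda>k. 2 * k)"
        then have "odd n" by (auto elim: evenE)
        then show "diffs c n * y ^ n = 0" by (simp add: c_def diffs_def)
      qed (simp add: strict_mono_def)
      ultimately show ?thesis by simp
    qed
    ultimately show ?thesis by (simp add: sums_iff)
  qed
  have "\<exists>K. \<forall>y\<in>{-1<..<1}. F y - arcsin y = K"
  proof (rule has_field_derivative_zero_constant)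
    fix y :: real assume y: "y \<in> {-1<..<1}"
    then have "((\<lambda>y. F y - arcsin y) has_field_derivative 1 / sqrt (1 - y\<^sup>2) - inverse (sqrt (1 - y\<^sup>2))) (at y)"
      by (intro derivative_intros deriv DERIV_arcsin) auto
    then show "((\<lambda>y. F y - arcsin y) has_field_derivative 0) (at y within {-1<..<1})"
      by (simp add: inverse_eq_divide has_field_derivative_at_within)
  qed auto
  then obtain K where K: "\<And>y. y \<in> {-1<..<1} \<Longrightarrow> F y - arcsin y = K" by blast
  have "F 0 = 0" by (simp add: F_def c_def powser_zero)
  then have "K = 0" using K[of 0] by simp
  then have "F x = arcsin x" using K[of x] x by (auto simp: abs_less_iff)
  then have "(\<lambda>n. c n * x ^ n) sums arcsin x"
    using summable[OF x] by (simp add: F_def sums_iff)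
  then show ?thesis by (simp only: reindex)
qed

text \<open>Schur's product argument: one factor of the power, written as a sum over coordinates,
  splits the form into \<open>d\<close> forms of lower degree with coefficients
  \<open>a e * p e l\<close>. This is why the induction is over all \<open>a\<close>.\<close>

lemma power_kernel_nonneg:
  "0 \<le> (\<Sum>e\<in>A. \<Sum>f\<in>A. a e * a f * inner_prod d (p e) (p f) ^ n)"
proof (induction n arbitrary: a)
  case 0
  have "(\<Sum>e\<in>A. \<Sum>f\<in>A. a e * a f * inner_prod d (p e) (p f) ^ 0) = (\<Sum>e\<in>A. a e)\<^sup>2"
    by (simp add: power2_eq_square sum_product)
  then show ?case by simp
next
  case (Suc n)
  have "(\<Sum>e\<in>A. \<Sum>f\<in>A. a e * a f * inner_prod d (p e) (p f) ^ Suc n) =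
      (\<Sum>e\<in>A. \<Sum>f\<in>A. \<Sum>l<d. (a e * p e l) * (a f * p f l) * inner_prod d (p e) (p f) ^ n)"
  proof (intro sum.cong refl)
    fix e f
    have "a e * a f * inner_prod d (p e) (p f) ^ Suc n =
        a e * a f * ((\<Sum>l<d. p e l * p f l) * inner_prod d (p e) (p f) ^ n)"
      by (simp only: power_Suc inner_prod_def[symmetric])
    then show "a e * a f * inner_prod d (p e) (p f) ^ Suc n =
        (\<Sum>l<d. (a e * p e l) * (a f * p f l) * inner_prod d (p e) (p f) ^ n)"
      by (simp add: sum_distrib_left sum_distrib_right mult_ac)
  qed
  also have "\<dots> = (\<Sum>e\<in>A. \<Sum>l<d. \<Sum>f\<in>A. (a e * p e l) * (a f * p f l) * inner_prod d (p e) (p f) ^ n)"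
    by (intro sum.cong refl sum.swap)
  also have "\<dots> = (\<Sum>l<d. \<Sum>e\<in>A. \<Sum>f\<in>A. (a e * p e l) * (a f * p f l) * inner_prod d (p e) (p f) ^ n)"
    by (rule sum.swap)
  also have "\<dots> \<ge> 0" by (intro sum_nonneg Suc.IH)
  finally show ?case .
qed

text \<open>All coefficients of the arcsine series are nonnegative and all powers are positive definite
  kernels, so one term of the series bounds the whole kernel from below. Shrinking the argument by
  a factor \<open>r \<rightarrow> 1\<close> avoids the boundary of the disc of convergence.\<close>

lemma arcsin_kernel_ge:
  assumes fin: "finite A" and p: "\<And>e f. e \<in> A \<Longrightarrow> f \<in> A \<Longrightarrow> \<bar>inner_prod d (p e) (p f)\<bar> \<le> 1"
  shows "arcsin_coeff k * (\<Sum>e\<in>A. \<Sum>f\<in>A. a e * a f * inner_prod d (p e) (p f) ^ (2 * k + 1))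
    \<le> (\<Sum>e\<in>A. \<Sum>f\<in>A. a e * a f * arcsin (inner_prod d (p e) (p f)))"
proof -
  define Q where "Q n = (\<Sum>e\<in>A. \<Sum>f\<in>A. a e * a f * inner_prod d (p e) (p f) ^ n)" for n
  define H where "H r = (\<Sum>e\<in>A. \<Sum>f\<in>A. a e * a f * arcsin (r * inner_prod d (p e) (p f)))" for r
  have ineq: "arcsin_coeff k * r ^ (2 * k + 1) * Q (2 * k + 1) \<le> H r" if r: "0 \<le> r" "r < 1" for r
  proof -
    have small: "\<bar>r * inner_prod d (p e) (p f)\<bar> < 1" if "e \<in> A" "f \<in> A" for e f
    proof -
      have "\<bar>r\<bar> * \<bar>inner_prod d (p e) (p f)\<bar> \<le> r * 1"
        using r p[OF that] by (intro mult_mono) auto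
      then show ?thesis using r by (simp add: abs_mult)
    qed
    have "(\<lambda>n. \<Sum>e\<in>A. \<Sum>f\<in>A. a e * a f * (arcsin_coeff n * (r * inner_prod d (p e) (p f)) ^ (2 * n + 1))) sums H r"
      unfolding H_def using small by (intro sums_sum sums_mult arcsin_series)
    moreover have "(\<Sum>e\<in>A. \<Sum>f\<in>A. a e * a f * (arcsin_coeff n * (r * inner_prod d (p e) (p f)) ^ (2 * n + 1))) =
        arcsin_coeff n * r ^ (2 * n + 1) * Q (2 * n + 1)" for n
      by (simp add: Q_def sum_distrib_left power_mult_distrib mult_ac)
    ultimately have sums: "(\<lambda>n. arcsin_coeff n * r ^ (2 * n + 1) * Q (2 * n + 1)) sums H r"
      by simp
    have "(\<Sum>n\<in>{k}. arcsin_coeff n * r ^ (2 * n + 1) * Q (2 * n + 1)) \<le>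
        (\<Sum>n. arcsin_coeff n * r ^ (2 * n + 1) * Q (2 * n + 1))"
    proof (rule sum_le_suminf)
      show "summable (\<lambda>n. arcsin_coeff n * r ^ (2 * n + 1) * Q (2 * n + 1))"
        using sums by (rule sums_summable)
      have "0 \<le> Q n" for n unfolding Q_def by (rule power_kernel_nonneg)
      then show "0 \<le> arcsin_coeff n * r ^ (2 * n + 1) * Q (2 * n + 1)" for n
        using r(1) arcsin_coeff_nonneg by (intro mult_nonneg_nonneg zero_le_power) auto
    qed simp
    then show ?thesis using sums by (simp add: sums_iff)
  qed
  have lim: "((\<lambda>r. H r) \<longlongrightarrow> H 1) (at_left 1)"
  proof -
    have "((\<lambda>r. arcsin (r * x)) \<longlongrightarrow> arcsin (1 * x)) (at_left 1)" if "\<bar>x\<bar> \<le> 1" for x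
    proof -
      have "continuous_on {0..1} (\<lambda>r. arcsin (r * x))"
      proof (intro continuous_on_arcsin continuous_intros ballI)
        fix r :: real assume "r \<in> {0..1}"
        then have "\<bar>r\<bar> * \<bar>x\<bar> \<le> 1 * 1" using that by (intro mult_mono) auto
        then show "- 1 \<le> r * x \<and> r * x \<le> 1" by (simp add: abs_le_iff flip: abs_mult)
      qed
      then have "((\<lambda>r. arcsin (r * x)) \<longlongrightarrow> arcsin (1 * x)) (at 1 within {0..1})"
        unfolding continuous_on_def by (rule bspec) simp
      moreover have "at 1 within {0..1} = at_left (1::real)"
        by (intro at_within_Icc_at_left) auto
      ultimately show ?thesis by simp
    qed
    then show ?thesis unfolding H_def using p by (intro tendsto_sum tendsto_mult tendsto_const) auto
  qed
  have lim': "((\<lambda>r. arcsin_coeff k * r ^ (2 * k + 1) * Q (2 * k + 1)) \<longlongrightarrow>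
      arcsin_coeff k * 1 ^ (2 * k + 1) * Q (2 * k + 1)) (at_left 1)"
    by (intro tendsto_intros)
  have "arcsin_coeff k * 1 ^ (2 * k + 1) * Q (2 * k + 1) \<le> H 1"
  proof (rule tendsto_le[OF _ lim lim'])
    show "\<forall>\<^sub>F r in at_left 1. arcsin_coeff k * r ^ (2 * k + 1) * Q (2 * k + 1) \<le> H r"
      using eventually_at_left_real[of 0 "1::real"] ineq by (auto elim!: eventually_mono)
  qed simp
  then show ?thesis by (simp add: H_def Q_def)
qed

section \<open>The algorithm\<close>

definition runs :: "(nat \<Rightarrow> real) \<Rightarrow> cmd \<Rightarrow> state \<Rightarrow> nat \<Rightarrow> (state \<Rightarrow> bool) \<Rightarrow> bool" where
  "runs \<omega> C s T Q \<longleftrightarrow> (\<exists>t s'. exec \<omega> C s t s' \<and> t \<le> T \<and> Q s')"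

lemma runs_weaken: "runs \<omega> C s T Q \<Longrightarrow> T \<le> T' \<Longrightarrow> (\<And>s'. Q s' \<Longrightarrow> Q' s') \<Longrightarrow> runs \<omega> C s T' Q'"
  unfolding runs_def by (meson le_trans)

lemma runs_Skip: "Q s \<Longrightarrow> runs \<omega> Skip s 1 Q"
  unfolding runs_def using exec.Skip by blast

lemma runs_IStore:
  "Q (s\<lparr>imem := (imem s)((ival a s, ival i s, ival j s) := ival e s)\<rparr>) \<Longrightarrow> runs \<omega> (IStore a i j e) s 1 Q"
  unfolding runs_def using exec.IStore by blast

lemma runs_RStore:
  "Q (s\<lparr>rmem := (rmem s)((ival a s, ival i s, ival j s) := rval e s)\<rparr>) \<Longrightarrow> runs \<omega> (RStore a i j e) s 1 Q"
  unfolding runs_def using exec.RStore by blast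

lemma runs_Gauss:
  "Q (s\<lparr>rmem := (rmem s)((ival a s, ival i s, ival j s) := \<omega> (drawn s)), drawn := Suc (drawn s)\<rparr>)
    \<Longrightarrow> runs \<omega> (Gauss a i j) s 1 Q"
  unfolding runs_def using exec.Gauss by blast

lemma runs_Seq:
  assumes "runs \<omega> C s T (\<lambda>s'. runs \<omega> D s' T' Q)"
  shows "runs \<omega> (Seq C D) s (T + T') Q"
proof -
  from assms obtain t s' where 1: "exec \<omega> C s t s'" "t \<le> T" "runs \<omega> D s' T' Q"
    by (auto simp: runs_def)
  then obtain t' s'' where "exec \<omega> D s' t' s''" "t' \<le> T'" "Q s''"
    by (auto simp: runs_def)
  with 1 show ?thesis
    unfolding runs_def by (intro exI[of _ "t + t'"] exI[of _ s'']) (auto intro: exec.Seq)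
qed

lemma runs_Cond:
  assumes "bval b s \<Longrightarrow> runs \<omega> C s T Q" "\<not> bval b s \<Longrightarrow> runs \<omega> D s T Q"
  shows "runs \<omega> (Cond b C D) s (Suc T) Q"
proof (cases "bval b s")
  case True
  with assms(1) obtain t s' where "exec \<omega> C s t s'" "t \<le> T" "Q s'" by (auto simp: runs_def)
  with True show ?thesis
    unfolding runs_def by (intro exI[of _ "Suc t"] exI[of _ s']) (auto intro: exec.CondTrue)
next
  case False
  with assms(2) obtain t s' where "exec \<omega> D s t s'" "t \<le> T" "Q s'" by (auto simp: runs_def)
  with False show ?thesis
    unfolding runs_def by (intro exI[of _ "Suc t"] exI[of _ s']) (auto intro: exec.CondFalse)
qed

definition ivar :: "nat \<Rightarrow> iexp" where
  "ivar c = ILoad (IConst c) (IConst 0) (IConst 0)"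

definition rcell :: "nat \<Rightarrow> rexp" where
  "rcell c = RLoad (IConst 6) (IConst c) (IConst 0)"

definition set_rcell :: "nat \<Rightarrow> rexp \<Rightarrow> cmd" where
  "set_rcell c e = RStore (IConst 6) (IConst c) (IConst 0) e"

lemma ival_ivar [simp]: "ival (ivar c) s = imem s (c, 0, 0)"
  by (simp add: ivar_def)

lemma rval_rcell [simp]: "rval (rcell c) s = rmem s (6, c, 0)"
  by (simp add: rcell_def)

definition for_loop :: "nat \<Rightarrow> iexp \<Rightarrow> cmd \<Rightarrow> cmd" where
  "for_loop c b C = Seq (IStore (IConst c) (IConst 0) (IConst 0) (IConst 0))
    (While (ILess (ivar c) b)
      (Seq C (IStore (IConst c) (IConst 0) (IConst 0) (IAdd (ivar c) (IConst 1)))))"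

abbreviation set_counter :: "nat \<Rightarrow> nat \<Rightarrow> state \<Rightarrow> state" where
  "set_counter c i s \<equiv> s\<lparr>imem := (imem s)((c, 0, 0) := i)\<rparr>"

text \<open>A pass costs the body, a test and an increment, at most \<open>T + 3\<close> in all. The
  time refers to any \<open>m\<close> above the number \<open>N\<close> of passes, so that nested
  loops over vertices and coordinates get bounds in the single variable \<open>m\<close>.\<close>

lemma runs_for_loop:
  assumes init: "I 0 (set_counter c 0 s)"
    and body: "\<And>i s. i < N \<Longrightarrow> I i s \<Longrightarrow> imem s (c, 0, 0) = i \<Longrightarrow>
      runs \<omega> C s T (\<lambda>s'. imem s' (c, 0, 0) = i \<and> I (Suc i) (set_counter c (Suc i) s'))"
    and bound: "\<And>i s. I i s \<Longrightarrow> ival b s = N"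
    and post: "\<And>s. I N s \<Longrightarrow> Q s"
    and N: "N \<le> m"
  shows "runs \<omega> (for_loop c b C) s (m * (T + 3) + 3) Q"
proof -
  let ?W = "While (ILess (ivar c) b)
      (Seq C (IStore (IConst c) (IConst 0) (IConst 0) (IAdd (ivar c) (IConst 1))))"
  have while: "runs \<omega> ?W s ((N - i) * (T + 3) + 1) Q"
    if "I i s" "imem s (c, 0, 0) = i" "i \<le> N" for i s
    using that
  proof (induction "N - i" arbitrary: i s)
    case 0
    then have "i = N" by simp
    with 0 bound[OF 0(2)] have "\<not> bval (ILess (ivar c) b) s" by simp
    then have "exec \<omega> ?W s 1 s" by (rule exec.WhileFalse)
    then show ?case using post 0(2) \<open>i = N\<close> unfolding runs_def by auto
  next
    case (Suc r)
    then have iN: "i < N" by simp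
    from body[OF iN Suc(3,4)] obtain t s1 where s1: "exec \<omega> C s t s1" "t \<le> T"
      "imem s1 (c, 0, 0) = i" "I (Suc i) (set_counter c (Suc i) s1)"
      by (auto simp: runs_def)
    have step: "exec \<omega> (IStore (IConst c) (IConst 0) (IConst 0) (IAdd (ivar c) (IConst 1))) s1 1
        (set_counter c (Suc i) s1)"
      using exec.IStore[of \<omega> "IConst c" "IConst 0" "IConst 0" "IAdd (ivar c) (IConst 1)" s1] s1(3)
      by simp
    have "runs \<omega> ?W (set_counter c (Suc i) s1) ((N - Suc i) * (T + 3) + 1) Q"
      using Suc(2) iN by (intro Suc(1) s1(4)) auto
    then obtain t' s' where s': "exec \<omega> ?W (set_counter c (Suc i) s1) t' s'"
      "t' \<le> (N - Suc i) * (T + 3) + 1" "Q s'"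
      by (auto simp: runs_def)
    have "exec \<omega> ?W s (Suc ((t + 1) + t')) s'"
      using bound[OF Suc(3)] Suc(4) iN s1(1) step s'(1) by (intro exec.WhileTrue exec.Seq) auto
    moreover have "Suc ((t + 1) + t') \<le> (N - i) * (T + 3) + 1"
    proof -
      have "N - i = Suc (N - Suc i)" using iN by simp
      then have "(N - i) * (T + 3) = (T + 3) + (N - Suc i) * (T + 3)" by simp
      then show ?thesis using s1(2) s'(2) by linarith
    qed
    ultimately show ?case unfolding runs_def using s'(3) by blast
  qed
  have "runs \<omega> ?W (set_counter c 0 s) (N * (T + 3) + 1) Q"
    using while[OF init] by simp
  then have "runs \<omega> (for_loop c b C) s (1 + (N * (T + 3) + 1)) Q"
    unfolding for_loop_def by (intro runs_Seq runs_IStore) simp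
  moreover have "1 + (N * (T + 3) + 1) \<le> m * (T + 3) + 3"
    using mult_le_mono1[OF N, of "T + 3"] by linarith
  ultimately show ?thesis by (rule runs_weaken) simp
qed

definition sum_loop :: "nat \<Rightarrow> nat \<Rightarrow> iexp \<Rightarrow> rexp \<Rightarrow> cmd" where
  "sum_loop k c b e = Seq (set_rcell k (RConst 0)) (for_loop c b (set_rcell k (RAdd (rcell k) e)))"

abbreviation set_acc :: "nat \<Rightarrow> real \<Rightarrow> state \<Rightarrow> state" where
  "set_acc k x s \<equiv> s\<lparr>rmem := (rmem s)((6, k, 0) := x)\<rparr>"

text \<open>The final state is given exactly, so no invariant for the rest of the memory is needed.
  In return the summand must evaluate to \<open>f l\<close> whatever the accumulator holds.\<close>

lemma runs_sum_loop:
  assumes e: "\<And>l x. l < N \<Longrightarrow> rval e (set_acc k x (set_counter c l s)) = f l"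
    and b: "\<And>l x. ival b (set_acc k x (set_counter c l s)) = N"
    and Q: "Q (set_acc k (\<Sum>l<N. f l) (set_counter c N s))"
    and N: "N \<le> m"
  shows "runs \<omega> (sum_loop k c b e) s (1 + (m * (1 + 3) + 3)) Q"
  unfolding sum_loop_def set_rcell_def
proof (intro runs_Seq runs_RStore)
  let ?I = "\<lambda>i s'. s' = set_acc k (\<Sum>l<i. f l) (set_counter c i s)"
  show "runs \<omega> (for_loop c b (RStore (IConst 6) (IConst k) (IConst 0) (RAdd (rcell k) e)))
     (s\<lparr>rmem := (rmem s)((ival (IConst 6) s, ival (IConst k) s, ival (IConst 0) s) := rval (RConst 0) s)\<rparr>)
     (m * (1 + 3) + 3) Q"
  proof (rule runs_for_loop[where I = ?I, OF _ _ _ _ N])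
    fix i s' assume i: "i < N" and s': "s' = set_acc k (\<Sum>l<i. f l) (set_counter c i s)"
    show "runs \<omega> (RStore (IConst 6) (IConst k) (IConst 0) (RAdd (rcell k) e)) s' 1
        (\<lambda>s''. imem s'' (c, 0, 0) = i \<and>
          set_counter c (Suc i) s'' = set_acc k (\<Sum>l<Suc i. f l) (set_counter c (Suc i) s))"
      using e[OF i, of "\<Sum>l<i. f l"] by (intro runs_RStore) (simp add: s')
  qed (use b Q in auto)
qed

text \<open>Integer cells \<open>2\<close> to \<open>5\<close> are loop counters, the last two of them for the pair \<open>u\<close>, \<open>k\<close>. Real array \<open>3\<close>
  holds the Gaussians, \<open>4\<close> the signs, \<open>7\<close> the indicator of the current cluster. The cells of real array
  \<open>6\<close> are: \<open>0\<close> the current inner product, \<open>1\<close> the best gain so far, \<open>2\<close> the inner product of \<open>k\<close> and \<open>u\<close>,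
  \<open>3\<close> the gain of the current cluster, \<open>4\<close> its current row sum. The best cut so far is kept in the
  output array \<open>2\<close>.\<close>

definition dot_loop :: "nat \<Rightarrow> iexp \<Rightarrow> iexp \<Rightarrow> cmd" where
  "dot_loop k i j = sum_loop k 2 (ivar 1)
     (RMul (RLoad (IConst 1) i (ivar 2)) (RLoad (IConst 1) j (ivar 2)))"

definition draw_phase :: cmd where
  "draw_phase = for_loop 2 (ivar 1) (Gauss (IConst 3) (ivar 2) (IConst 0))"

definition sign_phase :: cmd where
  "sign_phase = for_loop 3 (ivar 0)
     (Seq (sum_loop 0 2 (ivar 1)
            (RMul (RLoad (IConst 1) (ivar 3) (ivar 2)) (RLoad (IConst 3) (ivar 2) (IConst 0))))
     (Seq (Cond (RLess (rcell 0) (RConst 0))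
            (RStore (IConst 4) (ivar 3) (IConst 0) (RConst (-1)))
            (RStore (IConst 4) (ivar 3) (IConst 0) (RConst 1)))
          (RStore (IConst 2) (ivar 3) (IConst 0) (RLoad (IConst 4) (ivar 3) (IConst 0)))))"

definition cluster_loop :: cmd where
  "cluster_loop = for_loop 3 (ivar 0)
     (Seq (dot_loop 0 (ivar 3) (ivar 4))
       (Cond (RLess (RMul (rcell 0) (rcell 0)) (RMul (rcell 2) (rcell 2)))
         (RStore (IConst 7) (ivar 3) (IConst 0) (RConst 0))
         (RStore (IConst 7) (ivar 3) (IConst 0) (RConst 1))))"

definition gain_loop :: cmd where
  "gain_loop = for_loop 3 (ivar 0)
     (Seq (sum_loop 4 2 (ivar 0)
            (RMul (RMul (RLoad (IConst 0) (ivar 3) (ivar 2))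
                (RMul (RLoad (IConst 4) (ivar 3) (IConst 0)) (RLoad (IConst 4) (ivar 2) (IConst 0))))
              (RMul (RLoad (IConst 7) (ivar 3) (IConst 0))
                (RSub (RConst 1) (RLoad (IConst 7) (ivar 2) (IConst 0))))))
       (set_rcell 3 (RAdd (rcell 3) (rcell 4))))"

definition update_step :: cmd where
  "update_step = Cond (RLess (rcell 1) (rcell 3))
     (Seq (set_rcell 1 (rcell 3))
       (for_loop 3 (ivar 0)
         (RStore (IConst 2) (ivar 3) (IConst 0)
           (RMul (RLoad (IConst 4) (ivar 3) (IConst 0))
             (RSub (RConst 1) (RMul (RConst 2) (RLoad (IConst 7) (ivar 3) (IConst 0))))))))
     Skip"

definition rounding_algorithm :: cmd where
  "rounding_algorithm = Seq draw_phase (Seq sign_phase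
     (for_loop 4 (ivar 0) (for_loop 5 (ivar 0)
       (Seq (dot_loop 2 (ivar 5) (ivar 4)) (Seq cluster_loop
         (Seq (set_rcell 3 (RConst 0)) (Seq gain_loop update_step)))))))"

definition gw_sign :: "nat \<Rightarrow> (nat \<Rightarrow> nat \<Rightarrow> real) \<Rightarrow> (nat \<Rightarrow> real) \<Rightarrow> nat \<Rightarrow> real" where
  "gw_sign d v \<omega> i = sgn_pm (inner_prod d (v i) \<omega>)"

text \<open>The squares make the cluster surround the line of \<open>u\<close>, so vertices near
  \<open>u\<close> and near its antipode are flipped together. A threshold matters only through the
  vertices above it, so the values at vertices \<open>k\<close> represent all thresholds with a
  nonempty cluster.\<close>

definition cluster :: "nat \<Rightarrow> (nat \<Rightarrow> nat \<Rightarrow> real) \<Rightarrow> nat \<Rightarrow> nat \<Rightarrow> nat set" where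
  "cluster d v u k = {i. (inner_prod d (v k) (v u))\<^sup>2 \<le> (inner_prod d (v i) (v u))\<^sup>2}"

text \<open>The change of the cut weight when the signs on \<open>C\<close> are negated:
  \<open>x i * x j\<close> is 1 on an uncut edge, which becomes cut, and -1 on a cut one. The last
  factor is asymmetric because the adjacency matrix holds each edge twice.\<close>

definition flip_gain :: "nat \<Rightarrow> (nat \<Rightarrow> nat \<Rightarrow> real) \<Rightarrow> (nat \<Rightarrow> real) \<Rightarrow> nat set \<Rightarrow> real" where
  "flip_gain n A x C =
     (\<Sum>i<n. \<Sum>j<n. A i j * (x i * x j) * (indicator C i * (1 - indicator C j)))"

definition flip :: "(nat \<Rightarrow> real) \<Rightarrow> nat set \<Rightarrow> nat \<Rightarrow> real" where
  "flip x C i = x i * (1 - 2 * indicator C i)"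

text \<open>The nesting repeats the shape of the program, so that composing the rules for
  \<open>runs\<close> yields this very expression.\<close>

definition cluster_step_time :: "nat \<Rightarrow> nat" where
  "cluster_step_time m = (1 + (m * (1 + 3) + 3)) +
    ((m * (((1 + (m * (1 + 3) + 3)) + Suc 1) + 3) + 3) +
      (1 + ((m * (((1 + (m * (1 + 3) + 3)) + 1) + 3) + 3) + Suc (1 + (m * (1 + 3) + 3)))))"

definition algorithm_time :: "nat \<Rightarrow> nat" where
  "algorithm_time m = (m * (1 + 3) + 3) + ((m * (((1 + (m * (1 + 3) + 3)) + (Suc 1 + 1)) + 3) + 3) +
    (m * ((m * (cluster_step_time m + 3) + 3) + 3) + 3))"

section \<open>Correctness of the program for a fixed tape\<close>

context
  fixes n d :: nat and A v :: "nat \<Rightarrow> nat \<Rightarrow> real" and \<omega> :: "nat \<Rightarrow> real"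
begin

definition core :: "state \<Rightarrow> bool" where
  "core s \<longleftrightarrow> imem s (0, 0, 0) = n \<and> imem s (1, 0, 0) = d \<and>
     (\<forall>i<n. \<forall>j<n. rmem s (0, i, j) = A i j) \<and> (\<forall>i<n. \<forall>l<d. rmem s (1, i, l) = v i l)"

definition signs_ready :: "state \<Rightarrow> bool" where
  "signs_ready s \<longleftrightarrow> core s \<and> (\<forall>i<n. rmem s (4, i, 0) = gw_sign d v \<omega> i)"

text \<open>The stored gain dominates those of the pairs in \<open>S\<close>, which have been tried,
  and it is realised by the cut in the output array. The gain 0 stands for the unflipped
  signs.\<close>

definition best :: "state \<Rightarrow> (nat \<times> nat) set \<Rightarrow> bool" where
  "best s S \<longleftrightarrow> 0 \<le> rmem s (6, 1, 0) \<and>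
     (\<forall>(u, k)\<in>S. flip_gain n A (gw_sign d v \<omega>) (cluster d v u k) \<le> rmem s (6, 1, 0)) \<and>
     (rmem s (6, 1, 0) = 0 \<and> (\<forall>i<n. rmem s (2, i, 0) = gw_sign d v \<omega> i) \<or>
      (\<exists>u<n. \<exists>k<n. rmem s (6, 1, 0) = flip_gain n A (gw_sign d v \<omega>) (cluster d v u k) \<and>
         (\<forall>i<n. rmem s (2, i, 0) = flip (gw_sign d v \<omega>) (cluster d v u k) i)))"

lemma core_preserved:
  assumes "core s" "\<And>c. c < 2 \<Longrightarrow> imem s' (c, 0, 0) = imem s (c, 0, 0)"
    "\<And>a i j. a < 2 \<Longrightarrow> rmem s' (a, i, j) = rmem s (a, i, j)"
  shows "core s'"
  using assms(1) assms(2)[of 0] assms(2)[of 1] assms(3)[of 0] assms(3)[of 1] by (simp add: core_def)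

lemma signs_ready_preserved:
  assumes "signs_ready s" "\<And>c. c < 2 \<Longrightarrow> imem s' (c, 0, 0) = imem s (c, 0, 0)"
    "\<And>a i j. a < 2 \<or> a = 4 \<Longrightarrow> rmem s' (a, i, j) = rmem s (a, i, j)"
  shows "signs_ready s'"
  using assms core_preserved[of s s'] by (simp add: signs_ready_def)

lemma best_preserved:
  assumes "best s S" "rmem s' (6, 1, 0) = rmem s (6, 1, 0)"
    "\<And>i. rmem s' (2, i, 0) = rmem s (2, i, 0)"
  shows "best s' S"
  using assms by (simp add: best_def)

lemma core_set_counter: "core s \<Longrightarrow> 2 \<le> c \<Longrightarrow> core (set_counter c i s)"
  by (simp add: core_def)

lemma signs_ready_set_counter: "signs_ready s \<Longrightarrow> 2 \<le> c \<Longrightarrow> signs_ready (set_counter c i s)"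
  by (simp add: signs_ready_def core_def)

lemma best_set_counter: "best s S \<Longrightarrow> best (set_counter c i s) S"
  by (simp add: best_def)

lemma coreD:
  assumes "core s"
  shows "imem s (0, 0, 0) = n" "imem s (1, 0, 0) = d"
    "\<And>i j. i < n \<Longrightarrow> j < n \<Longrightarrow> rmem s (0, i, j) = A i j"
    "\<And>i l. i < n \<Longrightarrow> l < d \<Longrightarrow> rmem s (1, i, l) = v i l"
  using assms by (auto simp: core_def)

lemma signs_readyD:
  assumes "signs_ready s"
  shows "core s" "\<And>i. i < n \<Longrightarrow> rmem s (4, i, 0) = gw_sign d v \<omega> i"
  using assms by (auto simp: signs_ready_def)

lemma signs_ready_n: "signs_ready s \<Longrightarrow> imem s (0, 0, 0) = n"
  by (simp add: signs_ready_def core_def)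

context
  fixes m :: nat
  assumes nd: "n \<le> m" "d \<le> m"
begin

text \<open>The invariant \<open>drawn s = i\<close> ties the draws to the first \<open>d\<close>
  entries of the tape, so the Gaussian vector of the program is \<open>\<omega>\<close>
  itself.\<close>

lemma runs_draw_phase:
  assumes "core s" "drawn s = 0" "rmem s (6, 1, 0) = 0"
  shows "runs \<omega> draw_phase s (m * (1 + 3) + 3)
    (\<lambda>s'. core s' \<and> (\<forall>l<d. rmem s' (3, l, 0) = \<omega> l) \<and> rmem s' (6, 1, 0) = 0)"
  unfolding draw_phase_def
proof (rule runs_for_loop[where N = d and I = "\<lambda>i s. core s \<and> drawn s = i \<and>
          (\<forall>l<i. rmem s (3, l, 0) = \<omega> l) \<and> rmem s (6, 1, 0) = 0"])
  fix i s assume s: "core s \<and> drawn s = i \<and> (\<forall>l<i. rmem s (3, l, 0) = \<omega> l) \<and> rmem s (6, 1, 0) = 0"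
    "imem s (2, 0, 0) = i"
  note [simp] = s(2) s(1)[THEN conjunct2, THEN conjunct1] s(1)[THEN conjunct2, THEN conjunct2, THEN conjunct2]
  show "runs \<omega> (Gauss (IConst 3) (ivar 2) (IConst 0)) s 1 (\<lambda>s. imem s (2, 0, 0) = i \<and>
      core (set_counter 2 (Suc i) s) \<and> drawn (set_counter 2 (Suc i) s) = Suc i \<and>
      (\<forall>l<Suc i. rmem (set_counter 2 (Suc i) s) (3, l, 0) = \<omega> l) \<and>
      rmem (set_counter 2 (Suc i) s) (6, 1, 0) = 0)"
    using s(1) by (intro runs_Gauss conjI core_preserved[OF conjunct1[OF s(1)]]) (auto simp: less_Suc_eq simp del: One_nat_def)
qed (use assms nd coreD(1,2) in \<open>auto intro: core_set_counter simp del: One_nat_def\<close>)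

lemma runs_sign_phase:
  assumes "core s" "\<forall>l<d. rmem s (3, l, 0) = \<omega> l" "rmem s (6, 1, 0) = 0"
  shows "runs \<omega> sign_phase s (m * (((1 + (m * (1 + 3) + 3)) + (Suc 1 + 1)) + 3) + 3)
    (\<lambda>s'. signs_ready s' \<and> best s' {})"
  unfolding sign_phase_def
proof (rule runs_for_loop[where N = n and I = "\<lambda>i s. core s \<and> (\<forall>l<d. rmem s (3, l, 0) = \<omega> l) \<and>
      (\<forall>j<i. rmem s (4, j, 0) = gw_sign d v \<omega> j \<and> rmem s (2, j, 0) = gw_sign d v \<omega> j) \<and>
      rmem s (6, 1, 0) = 0"])
  fix i s
  assume i: "i < n" and s: "core s \<and> (\<forall>l<d. rmem s (3, l, 0) = \<omega> l) \<and>
      (\<forall>j<i. rmem s (4, j, 0) = gw_sign d v \<omega> j \<and> rmem s (2, j, 0) = gw_sign d v \<omega> j) \<and>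
      rmem s (6, 1, 0) = 0" and c: "imem s (3, 0, 0) = i"
  from s have core: "core s" and [simp]: "\<And>l. l < d \<Longrightarrow> rmem s (3, l, 0) = \<omega> l"
    "\<And>j. j < i \<Longrightarrow> rmem s (4, j, 0) = gw_sign d v \<omega> j" "\<And>j. j < i \<Longrightarrow> rmem s (2, j, 0) = gw_sign d v \<omega> j"
    "rmem s (6, 1, 0) = 0" by auto
  note [simp] = c i coreD[OF core]
  have sign: "gw_sign d v \<omega> i = (if (\<Sum>l<d. v i l * \<omega> l) < 0 then -1 else 1)"
    by (simp add: gw_sign_def sgn_pm_def inner_prod_def)
  show "runs \<omega> (Seq (sum_loop 0 2 (ivar 1)
            (RMul (RLoad (IConst 1) (ivar 3) (ivar 2)) (RLoad (IConst 3) (ivar 2) (IConst 0))))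
     (Seq (Cond (RLess (rcell 0) (RConst 0))
            (RStore (IConst 4) (ivar 3) (IConst 0) (RConst (-1)))
            (RStore (IConst 4) (ivar 3) (IConst 0) (RConst 1)))
          (RStore (IConst 2) (ivar 3) (IConst 0) (RLoad (IConst 4) (ivar 3) (IConst 0)))))
     s ((1 + (m * (1 + 3) + 3)) + (Suc 1 + 1))
     (\<lambda>s. imem s (3, 0, 0) = i \<and> core (set_counter 3 (Suc i) s) \<and>
      (\<forall>l<d. rmem (set_counter 3 (Suc i) s) (3, l, 0) = \<omega> l) \<and>
      (\<forall>j<Suc i. rmem (set_counter 3 (Suc i) s) (4, j, 0) = gw_sign d v \<omega> j \<and>
        rmem (set_counter 3 (Suc i) s) (2, j, 0) = gw_sign d v \<omega> j) \<and>
      rmem (set_counter 3 (Suc i) s) (6, 1, 0) = 0)"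
    using nd(2)
    by (intro runs_Seq runs_sum_loop[where N = d and f = "\<lambda>l. v i l * \<omega> l"] runs_Cond runs_RStore
          conjI core_preserved[OF core])
       (auto simp: less_Suc_eq sign simp del: One_nat_def)
next
  fix s
  assume "core s \<and> (\<forall>l<d. rmem s (3, l, 0) = \<omega> l) \<and>
      (\<forall>j<n. rmem s (4, j, 0) = gw_sign d v \<omega> j \<and> rmem s (2, j, 0) = gw_sign d v \<omega> j) \<and>
      rmem s (6, 1, 0) = 0"
  then show "signs_ready s \<and> best s {}" by (simp add: signs_ready_def best_def)
qed (use assms nd coreD(1,2) in \<open>auto intro: core_set_counter simp del: One_nat_def\<close>)

lemma runs_cluster_loop:
  assumes s: "signs_ready s" "best s S" "imem s (4, 0, 0) = u" "imem s (5, 0, 0) = k" "u < n"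
    "rmem s (6, 2, 0) = inner_prod d (v k) (v u)"
  shows "runs \<omega> cluster_loop s (m * (((1 + (m * (1 + 3) + 3)) + Suc 1) + 3) + 3)
    (\<lambda>s. signs_ready s \<and> best s S \<and> imem s (4, 0, 0) = u \<and> imem s (5, 0, 0) = k \<and>
      (\<forall>i<n. rmem s (7, i, 0) = indicator (cluster d v u k) i))"
  unfolding cluster_loop_def
proof (rule runs_for_loop[where N = n and I = "\<lambda>i s. signs_ready s \<and> best s S \<and>
      imem s (4, 0, 0) = u \<and> imem s (5, 0, 0) = k \<and> rmem s (6, 2, 0) = inner_prod d (v k) (v u) \<and>
      (\<forall>j<i. rmem s (7, j, 0) = indicator (cluster d v u k) j)"])
  fix i s
  assume i: "i < n" and s: "signs_ready s \<and> best s S \<and>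
      imem s (4, 0, 0) = u \<and> imem s (5, 0, 0) = k \<and> rmem s (6, 2, 0) = inner_prod d (v k) (v u) \<and>
      (\<forall>j<i. rmem s (7, j, 0) = indicator (cluster d v u k) j)" and c: "imem s (3, 0, 0) = i"
  from s have ready: "signs_ready s" and best: "best s S"
    and [simp]: "imem s (4, 0, 0) = u" "imem s (5, 0, 0) = k"
    "rmem s (6, 2, 0) = inner_prod d (v k) (v u)"
    "\<And>j. j < i \<Longrightarrow> rmem s (7, j, 0) = indicator (cluster d v u k) j" by auto
  note [simp] = c i \<open>u < n\<close> coreD[OF signs_readyD(1)[OF ready]]
  define a b where "a = inner_prod d (v i) (v u)" and "b = inner_prod d (v k) (v u)"
  have sum: "(\<Sum>l<d. v i l * v u l) = a" by (simp add: a_def inner_prod_def)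
  have ind: "indicator (cluster d v u k) i = (if a * a < b * b then 0 else 1 :: real)"
    by (auto simp: indicator_def cluster_def power2_eq_square a_def b_def)
  show "runs \<omega> (Seq (dot_loop 0 (ivar 3) (ivar 4))
       (Cond (RLess (RMul (rcell 0) (rcell 0)) (RMul (rcell 2) (rcell 2)))
         (RStore (IConst 7) (ivar 3) (IConst 0) (RConst 0))
         (RStore (IConst 7) (ivar 3) (IConst 0) (RConst 1))))
     s ((1 + (m * (1 + 3) + 3)) + Suc 1)
     (\<lambda>s. imem s (3, 0, 0) = i \<and> signs_ready (set_counter 3 (Suc i) s) \<and>
      best (set_counter 3 (Suc i) s) S \<and> imem (set_counter 3 (Suc i) s) (4, 0, 0) = u \<and>
      imem (set_counter 3 (Suc i) s) (5, 0, 0) = k \<and>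
      rmem (set_counter 3 (Suc i) s) (6, 2, 0) = inner_prod d (v k) (v u) \<and>
      (\<forall>j<Suc i. rmem (set_counter 3 (Suc i) s) (7, j, 0) = indicator (cluster d v u k) j))"
    unfolding dot_loop_def using nd(2)
    by (intro runs_Seq runs_sum_loop[where N = d and f = "\<lambda>l. v i l * v u l"] runs_Cond runs_RStore
          conjI signs_ready_preserved[OF ready] best_preserved[OF best])
       (auto simp: less_Suc_eq ind sum b_def[symmetric] simp del: One_nat_def)
qed (simp_all add: s nd signs_ready_n signs_ready_set_counter best_set_counter del: One_nat_def)

lemma runs_gain_loop:
  assumes s: "signs_ready s" "best s S" "imem s (4, 0, 0) = u" "imem s (5, 0, 0) = k"
    "rmem s (6, 3, 0) = 0" and c: "\<forall>i<n. rmem s (7, i, 0) = indicator C i"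
  shows "runs \<omega> gain_loop s (m * (((1 + (m * (1 + 3) + 3)) + 1) + 3) + 3)
    (\<lambda>s. signs_ready s \<and> best s S \<and> imem s (4, 0, 0) = u \<and> imem s (5, 0, 0) = k \<and>
      (\<forall>i<n. rmem s (7, i, 0) = indicator C i) \<and>
      rmem s (6, 3, 0) = flip_gain n A (gw_sign d v \<omega>) C)"
proof -
  define f where "f i j = A i j * (gw_sign d v \<omega> i * gw_sign d v \<omega> j) *
        (indicator C i * (1 - indicator C j))" for i j
  have gain: "flip_gain n A (gw_sign d v \<omega>) C = (\<Sum>i<n. \<Sum>j<n. f i j)"
    by (simp add: flip_gain_def f_def)
  show ?thesis
    unfolding gain_loop_def gain
  proof (rule runs_for_loop[where N = n and I = "\<lambda>i s. signs_ready s \<and> best s S \<and>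
      imem s (4, 0, 0) = u \<and> imem s (5, 0, 0) = k \<and> (\<forall>i<n. rmem s (7, i, 0) = indicator C i) \<and>
      rmem s (6, 3, 0) = (\<Sum>i<i. \<Sum>j<n. f i j)"])
    fix i s
    assume i: "i < n" and s: "signs_ready s \<and> best s S \<and>
      imem s (4, 0, 0) = u \<and> imem s (5, 0, 0) = k \<and> (\<forall>i<n. rmem s (7, i, 0) = indicator C i) \<and>
      rmem s (6, 3, 0) = (\<Sum>i<i. \<Sum>j<n. f i j)" and c: "imem s (3, 0, 0) = i"
    from s have ready: "signs_ready s" and best: "best s S"
      and [simp]: "imem s (4, 0, 0) = u" "imem s (5, 0, 0) = k"
      "\<And>j. j < n \<Longrightarrow> rmem s (7, j, 0) = indicator C j"
      "rmem s (6, 3, 0) = (\<Sum>i<i. \<Sum>j<n. f i j)" by auto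
    note [simp] = c i coreD[OF signs_readyD(1)[OF ready]] signs_readyD(2)[OF ready]
    show "runs \<omega> (Seq (sum_loop 4 2 (ivar 0)
            (RMul (RMul (RLoad (IConst 0) (ivar 3) (ivar 2))
                (RMul (RLoad (IConst 4) (ivar 3) (IConst 0)) (RLoad (IConst 4) (ivar 2) (IConst 0))))
              (RMul (RLoad (IConst 7) (ivar 3) (IConst 0))
                (RSub (RConst 1) (RLoad (IConst 7) (ivar 2) (IConst 0))))))
       (set_rcell 3 (RAdd (rcell 3) (rcell 4))))
      s ((1 + (m * (1 + 3) + 3)) + 1)
      (\<lambda>s. imem s (3, 0, 0) = i \<and> signs_ready (set_counter 3 (Suc i) s) \<and>
      best (set_counter 3 (Suc i) s) S \<and>
      imem (set_counter 3 (Suc i) s) (4, 0, 0) = u \<and> imem (set_counter 3 (Suc i) s) (5, 0, 0) = k \<and>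
      (\<forall>j<n. rmem (set_counter 3 (Suc i) s) (7, j, 0) = indicator C j) \<and>
      rmem (set_counter 3 (Suc i) s) (6, 3, 0) = (\<Sum>i<Suc i. \<Sum>j<n. f i j))"
      unfolding set_rcell_def using nd(1)
      by (intro runs_Seq runs_RStore runs_sum_loop[where N = n and f = "f i"]
            conjI signs_ready_preserved[OF ready] best_preserved[OF best])
         (auto simp: f_def simp del: One_nat_def)
  qed (simp_all add: s c nd signs_ready_n signs_ready_set_counter best_set_counter del: One_nat_def)
qed

text \<open>On a strict improvement the output is rebuilt from the signs in array 4 and not from the
  previous best cut, so flips never accumulate.\<close>

lemma runs_update_step:
  assumes s: "signs_ready s" "best s S" "imem s (4, 0, 0) = u" "imem s (5, 0, 0) = k" "u < n" "k < n"
    "rmem s (6, 3, 0) = flip_gain n A (gw_sign d v \<omega>) (cluster d v u k)"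
    and c: "\<forall>i<n. rmem s (7, i, 0) = indicator (cluster d v u k) i"
  shows "runs \<omega> update_step s (Suc (1 + (m * (1 + 3) + 3)))
    (\<lambda>s. signs_ready s \<and> best s (insert (u, k) S) \<and> imem s (4, 0, 0) = u \<and> imem s (5, 0, 0) = k)"
proof -
  define I where "I i s \<longleftrightarrow> signs_ready s \<and> imem s (4, 0, 0) = u \<and> imem s (5, 0, 0) = k \<and>
      rmem s (6, 1, 0) = flip_gain n A (gw_sign d v \<omega>) (cluster d v u k) \<and>
      (\<forall>j<n. rmem s (7, j, 0) = indicator (cluster d v u k) j) \<and>
      (\<forall>j<i. rmem s (2, j, 0) = flip (gw_sign d v \<omega>) (cluster d v u k) j)" for i s
  have body: "runs \<omega> (RStore (IConst 2) (ivar 3) (IConst 0)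
           (RMul (RLoad (IConst 4) (ivar 3) (IConst 0))
             (RSub (RConst 1) (RMul (RConst 2) (RLoad (IConst 7) (ivar 3) (IConst 0)))))) s 1
      (\<lambda>s. imem s (3, 0, 0) = i \<and> I (Suc i) (set_counter 3 (Suc i) s))"
    if i: "i < n" and s: "I i s" and c: "imem s (3, 0, 0) = i" for i s
  proof -
    from s have ready: "signs_ready s"
      and [simp]: "imem s (4, 0, 0) = u" "imem s (5, 0, 0) = k"
      "\<And>j. j < n \<Longrightarrow> rmem s (7, j, 0) = indicator (cluster d v u k) j"
      "\<And>j. j < i \<Longrightarrow> rmem s (2, j, 0) = flip (gw_sign d v \<omega>) (cluster d v u k) j"
      "rmem s (6, 1, 0) = flip_gain n A (gw_sign d v \<omega>) (cluster d v u k)" by (auto simp: I_def)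
    note [simp] = c i coreD[OF signs_readyD(1)[OF ready]] signs_readyD(2)[OF ready]
    show ?thesis
      unfolding I_def by (intro runs_RStore conjI signs_ready_preserved[OF ready])
         (auto simp: less_Suc_eq flip_def simp del: One_nat_def)
  qed
  have better: "runs \<omega> (Seq (set_rcell 1 (rcell 3))
       (for_loop 3 (ivar 0)
         (RStore (IConst 2) (ivar 3) (IConst 0)
           (RMul (RLoad (IConst 4) (ivar 3) (IConst 0))
             (RSub (RConst 1) (RMul (RConst 2) (RLoad (IConst 7) (ivar 3) (IConst 0))))))))
       s (1 + (m * (1 + 3) + 3))
    (\<lambda>s. signs_ready s \<and> best s (insert (u, k) S) \<and> imem s (4, 0, 0) = u \<and> imem s (5, 0, 0) = k)"
    if less: "rmem s (6, 1, 0) < rmem s (6, 3, 0)"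
    unfolding set_rcell_def
  proof (intro runs_Seq runs_RStore, rule runs_for_loop[where N = n and I = I, OF _ body _ _ nd(1)])
    show "I 0 (set_counter 3 0 (s\<lparr>rmem := (rmem s)((ival (IConst 6) s, ival (IConst 1) s,
        ival (IConst 0) s) := rval (rcell 3) s)\<rparr>))"
      unfolding I_def by (intro conjI signs_ready_preserved[OF s(1)]) (use s(3,4,7) c in \<open>auto simp del: One_nat_def\<close>)
  next
    fix i s' assume "I i s'"
    then show "ival (ivar 0) s' = n" by (simp add: I_def signs_ready_n)
  next
    fix s' assume s': "I n s'"
    let ?g = "\<lambda>u k. flip_gain n A (gw_sign d v \<omega>) (cluster d v u k)"
    have "0 \<le> rmem s (6, 1, 0)" and prev: "\<And>a b. (a, b) \<in> S \<Longrightarrow> ?g a b \<le> rmem s (6, 1, 0)"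
      using s(2) by (auto simp: best_def)
    then have nonneg: "0 \<le> ?g u k" using less s(7) by linarith
    have max: "?g a b \<le> ?g u k" if "(a, b) \<in> insert (u, k) S" for a b
    proof (cases "(a, b) \<in> S")
      case True
      then show ?thesis using prev[OF True] less s(7) by linarith
    next
      case False
      then show ?thesis using that by simp
    qed
    have gain: "rmem s' (6, 1, 0) = ?g u k"
      and out: "\<forall>i<n. rmem s' (2, i, 0) = flip (gw_sign d v \<omega>) (cluster d v u k) i"
      using s' by (simp_all add: I_def)
    have "best s' (insert (u, k) S)"
      unfolding best_def gain
    proof (intro conjI nonneg)
      show "\<forall>(a, b)\<in>insert (u, k) S. ?g a b \<le> ?g u k" using max by blast
      show "?g u k = 0 \<and> (\<forall>i<n. rmem s' (2, i, 0) = gw_sign d v \<omega> i) \<or>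
        (\<exists>a<n. \<exists>b<n. ?g u k = ?g a b \<and>
          (\<forall>i<n. rmem s' (2, i, 0) = flip (gw_sign d v \<omega>) (cluster d v a b) i))"
        using s(5,6) out by blast
    qed
    with s' show "signs_ready s' \<and> best s' (insert (u, k) S) \<and> imem s' (4, 0, 0) = u \<and> imem s' (5, 0, 0) = k"
      by (simp add: I_def)
  qed
  show ?thesis
    unfolding update_step_def
  proof (rule runs_Cond)
    assume "bval (RLess (rcell 1) (rcell 3)) s"
    then show "runs \<omega> (Seq (set_rcell 1 (rcell 3))
       (for_loop 3 (ivar 0)
         (RStore (IConst 2) (ivar 3) (IConst 0)
           (RMul (RLoad (IConst 4) (ivar 3) (IConst 0))
             (RSub (RConst 1) (RMul (RConst 2) (RLoad (IConst 7) (ivar 3) (IConst 0))))))))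
       s (1 + (m * (1 + 3) + 3))
      (\<lambda>s. signs_ready s \<and> best s (insert (u, k) S) \<and> imem s (4, 0, 0) = u \<and> imem s (5, 0, 0) = k)"
      by (intro better) (simp only: bval.simps rval_rcell)
  next
    assume "\<not> bval (RLess (rcell 1) (rcell 3)) s"
    then have "flip_gain n A (gw_sign d v \<omega>) (cluster d v u k) \<le> rmem s (6, 1, 0)"
      by (simp add: s(7))
    with s(2) have "best s (insert (u, k) S)" by (simp add: best_def)
    with s(1,3,4) have "runs \<omega> Skip s 1
      (\<lambda>s. signs_ready s \<and> best s (insert (u, k) S) \<and> imem s (4, 0, 0) = u \<and> imem s (5, 0, 0) = k)"
      by (intro runs_Skip conjI)
    then show "runs \<omega> Skip s (1 + (m * (1 + 3) + 3))
      (\<lambda>s. signs_ready s \<and> best s (insert (u, k) S) \<and> imem s (4, 0, 0) = u \<and> imem s (5, 0, 0) = k)"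
      by (rule runs_weaken) auto
  qed
qed

lemma runs_Seq_trans:
  assumes "runs \<omega> C s T R" "\<And>s'. R s' \<Longrightarrow> runs \<omega> D s' T' Q"
  shows "runs \<omega> (Seq C D) s (T + T') Q"
  by (rule runs_Seq, rule runs_weaken[OF assms(1) order.refl assms(2)])

lemma runs_dot_loop:
  assumes s: "signs_ready s" "best s S" "imem s (4, 0, 0) = u" "imem s (5, 0, 0) = k" "u < n" "k < n"
  shows "runs \<omega> (dot_loop 2 (ivar 5) (ivar 4)) s (1 + (m * (1 + 3) + 3))
    (\<lambda>s. signs_ready s \<and> best s S \<and> imem s (4, 0, 0) = u \<and> imem s (5, 0, 0) = k \<and>
      rmem s (6, 2, 0) = inner_prod d (v k) (v u))"
proof -
  note [simp] = s(3-6) coreD[OF signs_readyD(1)[OF s(1)]]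
  show ?thesis
    unfolding dot_loop_def using nd(2)
    by (intro runs_sum_loop[where N = d and f = "\<lambda>l. v k l * v u l"]
          conjI signs_ready_preserved[OF s(1)] best_preserved[OF s(2)])
       (auto simp: inner_prod_def simp del: One_nat_def)
qed

lemma runs_cluster_step:
  assumes s: "signs_ready s" "best s S" "imem s (4, 0, 0) = u" "imem s (5, 0, 0) = k" "u < n" "k < n"
  shows "runs \<omega> (Seq (dot_loop 2 (ivar 5) (ivar 4)) (Seq cluster_loop
         (Seq (set_rcell 3 (RConst 0)) (Seq gain_loop update_step)))) s (cluster_step_time m)
    (\<lambda>s. signs_ready s \<and> best s (insert (u, k) S) \<and> imem s (4, 0, 0) = u \<and> imem s (5, 0, 0) = k)"
  unfolding cluster_step_time_def
proof (rule runs_Seq_trans[OF runs_dot_loop[OF s]], rule runs_Seq_trans[OF runs_cluster_loop], simp_all only: s(5))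
  let ?I = "\<lambda>s. signs_ready s \<and> best s S \<and> imem s (4, 0, 0) = u \<and> imem s (5, 0, 0) = k \<and>
      (\<forall>i<n. rmem s (7, i, 0) = indicator (cluster d v u k) i)"
  fix s assume s': "?I s"
  have "runs \<omega> (set_rcell 3 (RConst 0)) s 1 (\<lambda>s. ?I s \<and> rmem s (6, 3, 0) = 0)"
    unfolding set_rcell_def
    by (intro runs_RStore conjI signs_ready_preserved[OF conjunct1[OF s']]
          best_preserved[OF conjunct1[OF conjunct2[OF s']]]) (use s' in \<open>auto simp del: One_nat_def\<close>)
  then show "runs \<omega> (Seq (set_rcell 3 (RConst 0)) (Seq gain_loop update_step)) s
      (1 + ((m * (((1 + (m * (1 + 3) + 3)) + 1) + 3) + 3) + Suc (1 + (m * (1 + 3) + 3))))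
      (\<lambda>s. signs_ready s \<and> best s (insert (u, k) S) \<and> imem s (4, 0, 0) = u \<and> imem s (5, 0, 0) = k)"
  proof (rule runs_Seq_trans)
    fix s assume s'': "?I s \<and> rmem s (6, 3, 0) = 0"
    show "runs \<omega> (Seq gain_loop update_step) s
      ((m * (((1 + (m * (1 + 3) + 3)) + 1) + 3) + 3) + Suc (1 + (m * (1 + 3) + 3)))
      (\<lambda>s. signs_ready s \<and> best s (insert (u, k) S) \<and> imem s (4, 0, 0) = u \<and> imem s (5, 0, 0) = k)"
      by (rule runs_Seq_trans[OF runs_gain_loop runs_update_step]) (use s'' s(5,6) in blast)+
  qed
qed auto

lemma runs_rounding_algorithm:
  assumes "core s" "drawn s = 0" "rmem s (6, 1, 0) = 0"
  shows "runs \<omega> rounding_algorithm s (algorithm_time m) (\<lambda>s. best s ({..<n} \<times> {..<n}))"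
  unfolding rounding_algorithm_def algorithm_time_def
proof (rule runs_Seq_trans[OF runs_draw_phase[OF assms]], rule runs_Seq_trans[OF runs_sign_phase])
  let ?C = "Seq (dot_loop 2 (ivar 5) (ivar 4)) (Seq cluster_loop
         (Seq (set_rcell 3 (RConst 0)) (Seq gain_loop update_step)))"
  fix s assume s: "signs_ready s \<and> best s {}"
  define I where "I u s \<longleftrightarrow> signs_ready s \<and> best s ({..<u} \<times> {..<n})" for u s
  \<comment> \<open>The pairs tried so far form a lexicographic initial segment: the full rows
    before \<open>u\<close> and the part of row \<open>u\<close> before \<open>k\<close>.\<close>
  define J where "J u k s \<longleftrightarrow> signs_ready s \<and> best s ({..<u} \<times> {..<n} \<union> {u} \<times> {..<k}) \<and>
    imem s (4, 0, 0) = u" for u k s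
  have inner: "runs \<omega> (for_loop 5 (ivar 0) ?C) s (m * ((cluster_step_time m) + 3) + 3)
      (\<lambda>s. imem s (4, 0, 0) = u \<and> I (Suc u) (set_counter 4 (Suc u) s))"
    if u: "u < n" and s: "I u s" and c: "imem s (4, 0, 0) = u" for u s
  proof (rule runs_for_loop[where N = n and I = "J u", OF _ _ _ _ nd(1)])
    show "J u 0 (set_counter 5 0 s)"
      using s c by (simp add: I_def J_def signs_ready_set_counter best_set_counter)
  next
    fix k s assume k: "k < n" and s: "J u k s" and c: "imem s (5, 0, 0) = k"
    have "runs \<omega> ?C s (cluster_step_time m) (\<lambda>s. signs_ready s \<and>
        best s (insert (u, k) ({..<u} \<times> {..<n} \<union> {u} \<times> {..<k})) \<and> imem s (4, 0, 0) = u \<and> imem s (5, 0, 0) = k)"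
      using s c u k by (intro runs_cluster_step) (auto simp: J_def)
    then show "runs \<omega> ?C s (cluster_step_time m)
        (\<lambda>s'. imem s' (5, 0, 0) = k \<and> J u (Suc k) (set_counter 5 (Suc k) s'))"
    proof (rule runs_weaken)
      have eq: "insert (u, k) ({..<u} \<times> {..<n} \<union> {u} \<times> {..<k}) = {..<u} \<times> {..<n} \<union> {u} \<times> {..<Suc k}"
        by (auto simp: less_Suc_eq)
      fix s assume "signs_ready s \<and> best s (insert (u, k) ({..<u} \<times> {..<n} \<union> {u} \<times> {..<k})) \<and>
        imem s (4, 0, 0) = u \<and> imem s (5, 0, 0) = k"
      then show "imem s (5, 0, 0) = k \<and> J u (Suc k) (set_counter 5 (Suc k) s)"
        unfolding eq J_def by (simp add: signs_ready_set_counter best_set_counter)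
    qed simp
  next
    fix k s assume "J u k s"
    then show "ival (ivar 0) s = n" by (simp add: J_def signs_ready_n)
  next
    fix s assume s: "J u n s"
    have eq: "{..<u} \<times> {..<n} \<union> {u} \<times> {..<n} = {..<Suc u} \<times> {..<n}"
      by (auto simp: less_Suc_eq)
    from s show "imem s (4, 0, 0) = u \<and> I (Suc u) (set_counter 4 (Suc u) s)"
      unfolding I_def J_def eq by (simp add: signs_ready_set_counter best_set_counter)
  qed
  show "runs \<omega> (for_loop 4 (ivar 0) (for_loop 5 (ivar 0) ?C)) s
      (m * ((m * ((cluster_step_time m) + 3) + 3) + 3) + 3) (\<lambda>s. best s ({..<n} \<times> {..<n}))"
  proof (rule runs_for_loop[where N = n and I = I, OF _ inner _ _ nd(1)])
    show "I 0 (set_counter 4 0 s)"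
      using s by (simp add: I_def signs_ready_set_counter best_set_counter)
  next
    fix i s assume "I i s"
    then show "ival (ivar 0) s = n" by (simp add: I_def signs_ready_n)
  next
    fix s assume "I n s"
    then show "best s ({..<n} \<times> {..<n})" by (simp add: I_def)
  qed
qed auto

end

end

section \<open>Polynomial running time\<close>

definition poly_fun :: "(nat \<Rightarrow> nat) \<Rightarrow> bool" where
  "poly_fun f \<longleftrightarrow> (\<exists>p. \<forall>x. poly p x = f x)"

lemma poly_fun_const: "poly_fun (\<lambda>x. c)"
  unfolding poly_fun_def by (intro exI[of _ "[:c:]"]) simp

lemma poly_fun_id: "poly_fun (\<lambda>x. x)"
  unfolding poly_fun_def by (intro exI[of _ "[:0, 1:]"]) simp

lemma poly_fun_add: "poly_fun f \<Longrightarrow> poly_fun g \<Longrightarrow> poly_fun (\<lambda>x. f x + g x)"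
  unfolding poly_fun_def by (metis poly_add)

lemma poly_fun_mult: "poly_fun f \<Longrightarrow> poly_fun g \<Longrightarrow> poly_fun (\<lambda>x. f x * g x)"
  unfolding poly_fun_def by (metis poly_mult)

lemma poly_fun_algorithm_time: "poly_fun (\<lambda>x. algorithm_time x)"
  unfolding algorithm_time_def cluster_step_time_def Suc_eq_plus1
  by (intro poly_fun_add poly_fun_mult poly_fun_const poly_fun_id)

lemma exec_rounding_algorithm:
  "\<exists>t s. exec \<omega> rounding_algorithm (input d n E w v) t s \<and> t \<le> algorithm_time (n + d) \<and>
     best n d (adj_matrix E w) v \<omega> s ({..<n} \<times> {..<n})"
proof -
  have "core n d (adj_matrix E w) v (input d n E w v)"
    by (simp add: core_def input_def)
  moreover have "drawn (input d n E w v) = 0" "rmem (input d n E w v) (6, 1, 0) = 0"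
    by (simp_all add: input_def)
  ultimately show ?thesis
    using runs_rounding_algorithm[of n "n + d" d "adj_matrix E w" v "input d n E w v" \<omega>]
    by (auto simp: runs_def)
qed

lemma poly_time_rounding_algorithm: "poly_time rounding_algorithm"
proof -
  obtain p where "\<And>x. poly p x = algorithm_time x"
    using poly_fun_algorithm_time by (auto simp: poly_fun_def)
  then show ?thesis
    unfolding poly_time_def using exec_rounding_algorithm by (intro exI[of _ p] allI) (simp, blast)
qed

text \<open>The matrix holds each edge at two disjoint places, since \<open>i < j\<close> on
  \<open>E\<close>. For an edge with one end in \<open>C\<close>, exactly one of the two leads from
  inside to outside.\<close>

lemma flip_gain_eq:
  assumes G: "weighted_graph n E w"
  shows "flip_gain n (adj_matrix E w) x C =
    (\<Sum>(i, j)\<in>E. if (i \<in> C) \<noteq> (j \<in> C) then w i j * (x i * x j) else 0)"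
proof -
  have E: "E \<subseteq> {..<n} \<times> {..<n}" "\<And>i j. (i, j) \<in> E \<Longrightarrow> i < j"
    using G by (auto simp: weighted_graph_def)
  have fin: "finite E" using E(1) finite_subset by blast
  define t where "t i j = x i * x j * (indicator C i * (1 - indicator C j))" for i j
  have "flip_gain n (adj_matrix E w) x C = (\<Sum>p\<in>{..<n} \<times> {..<n}. adj_matrix E w (fst p) (snd p) * t (fst p) (snd p))"
    unfolding flip_gain_def t_def sum.cartesian_product by (simp add: case_prod_unfold mult.assoc)
  also have "\<dots> = (\<Sum>p\<in>E \<union> prod.swap ` E. adj_matrix E w (fst p) (snd p) * t (fst p) (snd p))"
  proof (rule sum.mono_neutral_right)
    show "\<forall>p\<in>{..<n} \<times> {..<n} - (E \<union> prod.swap ` E). adj_matrix E w (fst p) (snd p) * t (fst p) (snd p) = 0"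
    proof
      fix p assume p: "p \<in> {..<n} \<times> {..<n} - (E \<union> prod.swap ` E)"
      then have "prod.swap p \<notin> E" by (metis DiffE UnI2 image_eqI swap_swap)
      with p show "adj_matrix E w (fst p) (snd p) * t (fst p) (snd p) = 0"
        by (cases p) (auto simp: adj_matrix_def)
    qed
  qed (use E(1) in auto)
  also have "\<dots> = (\<Sum>p\<in>E. adj_matrix E w (fst p) (snd p) * t (fst p) (snd p)) +
      (\<Sum>p\<in>prod.swap ` E. adj_matrix E w (fst p) (snd p) * t (fst p) (snd p))"
  proof (rule sum.union_disjoint)
    have "(j, i) \<notin> E" if "(i, j) \<in> E" for i j
      using E(2) that order.asym by blast
    then show "E \<inter> prod.swap ` E = {}" by auto
  qed (use fin in auto)
  also have "(\<Sum>p\<in>E. adj_matrix E w (fst p) (snd p) * t (fst p) (snd p)) = (\<Sum>(i, j)\<in>E. w i j * t i j)"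
    by (intro sum.cong) (auto simp: adj_matrix_def)
  also have "(\<Sum>p\<in>prod.swap ` E. adj_matrix E w (fst p) (snd p) * t (fst p) (snd p)) = (\<Sum>(i, j)\<in>E. w i j * t j i)"
  proof -
    have "(j, i) \<notin> E" if "(i, j) \<in> E" for i j
      using E(2) that order.asym by blast
    then have "(\<Sum>p\<in>E. adj_matrix E w (snd p) (fst p) * t (snd p) (fst p)) = (\<Sum>(i, j)\<in>E. w i j * t j i)"
      by (intro sum.cong) (auto simp: adj_matrix_def)
    then show ?thesis by (simp add: sum.reindex)
  qed
  finally have gain: "flip_gain n (adj_matrix E w) x C = (\<Sum>(i, j)\<in>E. w i j * (t i j + t j i))"
    by (simp only: sum.distrib[symmetric] case_prod_unfold distrib_left)
  show ?thesis
    unfolding gain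
  proof (intro sum.cong refl, clarify)
    fix i j
    show "w i j * (t i j + t j i) = (if (i \<in> C) \<noteq> (j \<in> C) then w i j * (x i * x j) else 0)"
      by (cases "i \<in> C"; cases "j \<in> C") (simp_all add: t_def)
  qed
qed

text \<open>Negating the signs on \<open>C\<close> toggles exactly the edges with one end in
  \<open>C\<close>, and for these \<open>x i * x j\<close> is the signed effect per unit of
  weight.\<close>

lemma cut_weight_flip:
  assumes G: "weighted_graph n E w" and x: "\<And>i. i < n \<Longrightarrow> x i = 1 \<or> x i = (-1::real)"
  shows "cut_weight E w (flip x C) = cut_weight E w x + flip_gain n (adj_matrix E w) x C"
proof -
  have E: "E \<subseteq> {..<n} \<times> {..<n}" "\<And>i j. (i, j) \<in> E \<Longrightarrow> i < j"
    using G by (auto simp: weighted_graph_def)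
  have fin: "finite E" using E(1) finite_subset by blast
  have cut: "cut_weight E w y = (\<Sum>(i, j)\<in>E. if y i \<noteq> y j then w i j else 0)" for y
  proof -
    have "{(i, j)\<in>E. y i \<noteq> y j} = {p\<in>E. y (fst p) \<noteq> y (snd p)}" by auto
    then show ?thesis
      unfolding cut_weight_def using sum.inter_filter[OF fin] by (simp add: case_prod_unfold)
  qed
  show ?thesis
    unfolding cut flip_gain_eq[OF G] sum.distrib[symmetric]
  proof (intro sum.cong refl, clarify)
    fix i j assume "(i, j) \<in> E"
    then have "x i = 1 \<or> x i = -1" "x j = 1 \<or> x j = -1" using x E(1) by auto
    then show "(if flip x C i \<noteq> flip x C j then w i j else 0) =
        (if x i \<noteq> x j then w i j else 0) + (if (i \<in> C) \<noteq> (j \<in> C) then w i j * (x i * x j) else 0)"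
      by (cases "i \<in> C"; cases "j \<in> C") (auto simp: flip_def)
  qed
qed

lemma cut_weight_cong:
  assumes "weighted_graph n E w" "\<And>i. i < n \<Longrightarrow> x i = y i"
  shows "cut_weight E w x = cut_weight E w y"
proof -
  have "{(i, j)\<in>E. x i \<noteq> x j} = {(i, j)\<in>E. y i \<noteq> y j}"
    using assms by (fastforce simp: weighted_graph_def)
  then show ?thesis by (simp add: cut_weight_def)
qed

definition cluster_gain :: "nat \<Rightarrow> nat \<Rightarrow> (nat \<times> nat) set \<Rightarrow> (nat \<Rightarrow> nat \<Rightarrow> real) \<Rightarrow>
    (nat \<Rightarrow> nat \<Rightarrow> real) \<Rightarrow> (nat \<Rightarrow> real) \<Rightarrow> nat \<Rightarrow> nat \<Rightarrow> real" where
  "cluster_gain d n E w v \<omega> u k = flip_gain n (adj_matrix E w) (gw_sign d v \<omega>) (cluster d v u k)"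

text \<open>After all pairs have been tried, the stored gain bounds every candidate and is itself
  one of them, so it is the maximum.\<close>

lemma rounding_algorithm_output:
  assumes G: "weighted_graph n E w"
  shows "i < n \<Longrightarrow> alg_cut rounding_algorithm d n E w v \<omega> i \<in> {1, -1}"
    and "cut_weight E w (alg_cut rounding_algorithm d n E w v \<omega>) =
      cut_weight E w (gw_sign d v \<omega>) +
      Max (insert 0 ((\<lambda>(u, k). cluster_gain d n E w v \<omega> u k) ` ({..<n} \<times> {..<n})))"
proof -
  obtain t s where "exec \<omega> rounding_algorithm (input d n E w v) t s"
    and best: "best n d (adj_matrix E w) v \<omega> s ({..<n} \<times> {..<n})"
    using exec_rounding_algorithm by blast
  then have out: "alg_cut rounding_algorithm d n E w v \<omega> = (\<lambda>i. rmem s (2, i, 0))"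
    by (simp add: alg_cut_def final_state_eq output_cut_def fun_eq_iff)
  have pm: "gw_sign d v \<omega> i = 1 \<or> gw_sign d v \<omega> i = -1" for i
    by (simp add: gw_sign_def sgn_pm_cases)
  let ?g = "cluster_gain d n E w v \<omega>" and ?b = "rmem s (6, 1, 0)"
  have le: "0 \<le> ?b" "\<And>u k. u < n \<Longrightarrow> k < n \<Longrightarrow> ?g u k \<le> ?b"
    using best by (auto simp: best_def cluster_gain_def)
  consider "?b = 0" "\<forall>i<n. rmem s (2, i, 0) = gw_sign d v \<omega> i"
    | u k where "u < n" "k < n" "?b = ?g u k" "\<forall>i<n. rmem s (2, i, 0) = flip (gw_sign d v \<omega>) (cluster d v u k) i"
    using best unfolding best_def cluster_gain_def by blast
  then have "(\<forall>i<n. rmem s (2, i, 0) \<in> {1, -1}) \<and>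
     cut_weight E w (\<lambda>i. rmem s (2, i, 0)) = cut_weight E w (gw_sign d v \<omega>) + ?b \<and>
     ?b \<in> insert 0 ((\<lambda>(u, k). ?g u k) ` ({..<n} \<times> {..<n}))"
  proof cases
    case 1
    moreover have "cut_weight E w (\<lambda>i. rmem s (2, i, 0)) = cut_weight E w (gw_sign d v \<omega>)"
      using 1(2) by (intro cut_weight_cong[OF G]) auto
    ultimately show ?thesis using pm by auto
  next
    case 2
    have "cut_weight E w (\<lambda>i. rmem s (2, i, 0)) = cut_weight E w (flip (gw_sign d v \<omega>) (cluster d v u k))"
      using 2(4) by (intro cut_weight_cong[OF G]) auto
    also have "\<dots> = cut_weight E w (gw_sign d v \<omega>) + ?g u k"
      unfolding cluster_gain_def using pm by (intro cut_weight_flip[OF G])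
    finally have "cut_weight E w (\<lambda>i. rmem s (2, i, 0)) = cut_weight E w (gw_sign d v \<omega>) + ?b"
      using 2(3) by simp
    moreover have "flip (gw_sign d v \<omega>) (cluster d v u k) i \<in> {1, -1}" for i
      using pm[of i] by (auto simp: flip_def indicator_def)
    ultimately show ?thesis using 2 by auto
  qed
  moreover from this have "Max (insert 0 ((\<lambda>(u, k). ?g u k) ` ({..<n} \<times> {..<n}))) = ?b"
    using le by (intro Max_eqI) auto
  ultimately show "i < n \<Longrightarrow> alg_cut rounding_algorithm d n E w v \<omega> i \<in> {1, -1}"
    and "cut_weight E w (alg_cut rounding_algorithm d n E w v \<omega>) =
      cut_weight E w (gw_sign d v \<omega>) +
      Max (insert 0 ((\<lambda>(u, k). ?g u k) ` ({..<n} \<times> {..<n})))"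
    unfolding out by simp_all
qed

section \<open>Gain on a thin strip\<close>

lemma sin_ge_chord:
  assumes "0 \<le> t" "t \<le> 1"
  shows "t \<le> sin (t * (pi / 2))"
proof -
  have "convex_on {0..pi/2} (\<lambda>x. - sin x)"
  proof (rule f''_ge0_imp_convex[where f' = "\<lambda>x. - cos x" and f'' = sin])
    show "0 \<le> sin x" if "x \<in> {0..pi/2}" for x
      using that by (intro sin_ge_zero) auto
  qed (auto intro!: derivative_eq_intros)
  from convex_onD[OF this, of t 0 "pi/2"] assms show ?thesis by simp
qed

text \<open>A chord is no longer than its arc, by 1 - cos t = 2 sin^2 (t/2). This is what gives an
  edge that jumps over a gap a minimum angle.\<close>

lemma arccos_square_ge:
  assumes "-1 \<le> \<rho>" "\<rho> \<le> 1"
  shows "2 * (1 - \<rho>) \<le> (arccos \<rho>)\<^sup>2"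
proof -
  have "\<rho> = cos (2 * (arccos \<rho> / 2))" using assms by simp
  also have "\<dots> = 1 - 2 * (sin (arccos \<rho> / 2))\<^sup>2" by (rule cos_double_sin)
  finally have "1 - \<rho> = 2 * (sin (arccos \<rho> / 2))\<^sup>2" by simp
  moreover have "(sin (arccos \<rho> / 2))\<^sup>2 \<le> (arccos \<rho> / 2)\<^sup>2"
    using abs_sin_x_le_abs_x[of "arccos \<rho> / 2"] by (simp only: abs_le_square_iff)
  ultimately show ?thesis by (simp add: power_divide)
qed

text \<open>The converse comparison, from the concavity of the sine. It turns closeness of a cluster
  vertex to \<open>u\<close> into a small mismatch probability.\<close>

lemma arccos_square_le:
  assumes "-1 \<le> \<rho>" "\<rho> \<le> 1"
  shows "(arccos \<rho> / pi)\<^sup>2 \<le> (1 - \<rho>) / 2"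
proof -
  have "\<rho> = cos (2 * (arccos \<rho> / 2))" using assms by simp
  also have "\<dots> = 1 - 2 * (sin (arccos \<rho> / 2))\<^sup>2" by (rule cos_double_sin)
  finally have "(1 - \<rho>) / 2 = (sin (arccos \<rho> / 2))\<^sup>2" by simp
  moreover have "arccos \<rho> / pi \<le> sin (arccos \<rho> / pi * (pi / 2))"
    using assms arccos_bounded[of \<rho>] by (intro sin_ge_chord) auto
  then have "arccos \<rho> / pi \<le> sin (arccos \<rho> / 2)" by simp
  ultimately show ?thesis
    using assms by (simp add: arccos_lbound power_mono)
qed

lemma arccos_ge_chord:
  assumes "0 \<le> \<rho>" "\<rho> \<le> 1"
  shows "(1 - \<rho>) / 2 \<le> arccos \<rho> / pi"
proof -
  have b: "0 \<le> arccos \<rho>" "arccos \<rho> \<le> pi / 2"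
    using assms arccos_le_pi2 by (auto simp: arccos_lbound)
  have "1 - 2 * arccos \<rho> / pi \<le> sin ((1 - 2 * arccos \<rho> / pi) * (pi / 2))"
    using b by (intro sin_ge_chord) (auto simp: field_simps)
  also have "(1 - 2 * arccos \<rho> / pi) * (pi / 2) = pi / 2 - arccos \<rho>"
    by (simp add: field_simps)
  also have "sin \<dots> = \<rho>" using assms by (simp add: sin_diff)
  finally show ?thesis by simp
qed

lemma arccos_ge_alpha_GW:
  assumes "-1 \<le> \<rho>" "\<rho> \<le> 1"
  shows "alpha_GW * ((1 - \<rho>) / 2) \<le> arccos \<rho> / pi"
proof (cases "\<rho> = 1")
  case False
  then have "alpha_GW \<le> gw_ratio \<rho>"
    using alpha_GW_attained assms by (metis atLeastLessThan_iff order_le_less)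
  then show ?thesis using False assms by (simp add: gw_ratio_def field_simps)
qed simp

text \<open>The ratio at -1/2, where the angle is 2 pi / 3: it is (2/3) / (3/4).\<close>

lemma alpha_GW_le: "alpha_GW \<le> 8 / 9"
proof -
  have "arccos (-(1/2)) = 2 * pi / 3"
    using arccos_minus[of "1/2"] arccos_cos[of "pi/3"] cos_60 by simp
  moreover have "alpha_GW * ((1 - (-(1/2))) / 2) \<le> arccos (-(1/2)) / pi"
    by (rule arccos_ge_alpha_GW) auto
  ultimately show ?thesis by simp
qed

text \<open>Near -1 the angle is almost \<open>pi\<close>; just below 0 it is at least
  \<open>pi / 2\<close> while \<open>(1 - \<rho>) / 2\<close> barely exceeds 1/2; from 0 on the
  ratio is at least 1. The constant 19/20 only has to lie far enough above the bound 8/9 on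
  \<open>alpha_GW\<close>.\<close>

lemma ratio_away_from_critical:
  "\<exists>\<epsilon>>0. \<epsilon> < 1/2 \<and> (\<forall>\<rho>. -1 \<le> \<rho> \<longrightarrow> \<rho> \<le> 1 \<longrightarrow> \<rho> \<notin> {-1 + \<epsilon>..-\<epsilon>} \<longrightarrow>
     19 / 20 * ((1 - \<rho>) / 2) \<le> arccos \<rho> / pi)"
proof -
  \<comment> \<open>The first bound makes 19/20 times 21/40 at most 1/2, for the interval below 0.
    The second puts every \<open>\<rho>\<close> below \<open>-1 + \<epsilon>\<close> at an angle of
    at least \<open>19 / 20 * pi\<close>.\<close>
  define \<epsilon> where "\<epsilon> = min (1 / 20) (1 + cos (19 / 20 * pi))"
  have "cos pi < cos (19 / 20 * pi)"
    by (intro cos_monotone_0_pi) auto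
  then have "0 < \<epsilon>" by (simp add: \<epsilon>_def)
  moreover have "\<epsilon> \<le> 1 / 20" unfolding \<epsilon>_def by (rule min.cobounded1)
  ultimately have \<epsilon>: "0 < \<epsilon>" "\<epsilon> \<le> 1 / 20" .
  have "19 / 20 * ((1 - \<rho>) / 2) \<le> arccos \<rho> / pi"
    if \<rho>: "-1 \<le> \<rho>" "\<rho> \<le> 1" "\<rho> \<notin> {-1 + \<epsilon>..-\<epsilon>}" for \<rho>
  proof -
    consider "\<rho> < -1 + \<epsilon>" | "-\<epsilon> < \<rho>" "\<rho> \<le> 0" | "0 \<le> \<rho>" using \<rho>(3) by fastforce
    then show ?thesis
    proof cases
      case 1
      then have "\<rho> \<le> cos (19 / 20 * pi)" by (simp add: \<epsilon>_def)
      then have "arccos (cos (19 / 20 * pi)) \<le> arccos \<rho>"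
        using \<rho>(1) by (intro arccos_le_arccos) auto
      then have "19 / 20 * pi \<le> arccos \<rho>" by (simp add: arccos_cos)
      then have "19 / 20 \<le> arccos \<rho> / pi" by (simp add: field_simps)
      moreover have "19 / 20 * ((1 - \<rho>) / 2) \<le> 19 / 20" using \<rho>(1) by simp
      ultimately show ?thesis by (rule order.trans[rotated])
    next
      case 2
      then have "arccos 0 \<le> arccos \<rho>" using \<rho> by (intro arccos_le_arccos) auto
      then have "1 / 2 \<le> arccos \<rho> / pi" by (simp add: field_simps)
      moreover have "19 / 20 * ((1 - \<rho>) / 2) \<le> 1 / 2" using 2 \<epsilon>(2) by simp
      ultimately show ?thesis by (rule order.trans[rotated])
    next
      case 3
      have "19 / 20 * ((1 - \<rho>) / 2) \<le> (1 - \<rho>) / 2" using \<rho>(2) by simp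
      then show ?thesis using arccos_ge_chord[OF 3 \<rho>(2)] by (rule order.trans)
    qed
  qed
  with \<epsilon> show ?thesis by (intro exI[of _ \<epsilon>]) auto
qed

text \<open>Since \<open>\<langle>b e + u, b f + u\<rangle> \<ge> 0\<close>, the projections of the \<open>b e\<close> onto the orthogonal complement of
  \<open>u\<close> have inner products at least \<open>- (1 - \<eta>) / (1 + \<eta>)\<close>. A high odd power of these is negligible
  unless it is positive.\<close>

locale boundary_edges =
  fixes d :: nat and u :: "nat \<Rightarrow> real" and A :: "'e set" and W :: "'e \<Rightarrow> real"
    and b :: "'e \<Rightarrow> nat \<Rightarrow> real" and \<eta> :: real
  assumes fin: "finite A" and W: "\<And>e. e \<in> A \<Longrightarrow> 0 \<le> W e"
    and u: "inner_prod d u u = 1" and b: "\<And>e. e \<in> A \<Longrightarrow> inner_prod d (b e) (b e) = 1"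
    and \<eta>: "0 < \<eta>" "\<eta> < 1"
    and window: "\<And>e. e \<in> A \<Longrightarrow> -1 + \<eta> \<le> inner_prod d u (b e)" "\<And>e. e \<in> A \<Longrightarrow> inner_prod d u (b e) \<le> -\<eta>"
    and triangle: "\<And>e f. e \<in> A \<Longrightarrow> f \<in> A \<Longrightarrow>
      0 \<le> 1 + inner_prod d u (b e) + inner_prod d u (b f) + inner_prod d (b e) (b f)"
begin

definition corr :: "'e \<Rightarrow> real" where
  "corr e = inner_prod d u (b e)"

text \<open>The length of the component of \<open>b e\<close> orthogonal to
  \<open>u\<close>.\<close>

definition height :: "'e \<Rightarrow> real" where
  "height e = sqrt (1 - (corr e)\<^sup>2)"

definition proj :: "'e \<Rightarrow> nat \<Rightarrow> real" where
  "proj e = (\<lambda>l. (1 / height e) * (b e l - corr e * u l))"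

definition total :: real where
  "total = (\<Sum>e\<in>A. W e)"

lemma height_bounds:
  assumes "e \<in> A"
  shows "(height e)\<^sup>2 = 1 - (corr e)\<^sup>2" "\<eta> \<le> height e" "0 < height e"
proof -
  have c: "-1 + \<eta> \<le> corr e" "corr e \<le> -\<eta>" using window assms by (auto simp: corr_def)
  have eq: "1 - (corr e)\<^sup>2 = (1 - corr e) * (1 + corr e)" by (simp add: power2_eq_square algebra_simps)
  \<comment> \<open>As \<open>corr e\<close> is negative, the first factor is at least 1; the second
    is at least \<open>\<eta>\<close>.\<close>
  have "1 * \<eta> \<le> (1 - corr e) * (1 + corr e)"
    using c \<eta> by (intro mult_mono) auto
  moreover have "\<eta>\<^sup>2 \<le> \<eta>" using \<eta> by (simp add: power2_eq_square mult_left_le)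
  ultimately have le: "\<eta>\<^sup>2 \<le> 1 - (corr e)\<^sup>2" unfolding eq by linarith
  then show "\<eta> \<le> height e" unfolding height_def by (rule real_le_rsqrt)
  then show "0 < height e" using \<eta> by simp
  show "(height e)\<^sup>2 = 1 - (corr e)\<^sup>2"
    unfolding height_def using le by (intro real_sqrt_pow2) (meson order_trans zero_le_power2)
qed

lemma inner_prod_proj:
  "inner_prod d (proj e) (proj f) = (inner_prod d (b e) (b f) - corr e * corr f) / (height e * height f)"
proof -
  have "inner_prod d (\<lambda>l. b e l - corr e * u l) (\<lambda>l. b f l - corr f * u l) =
      inner_prod d (b e) (b f) - corr e * corr f"
    unfolding inner_prod_bilinear using u by (simp add: corr_def inner_prod_commute[of d "b e" u])
  then show ?thesis
    unfolding proj_def inner_prod_scale_left inner_prod_scale_right by simp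
qed

lemma proj_unit: "e \<in> A \<Longrightarrow> inner_prod d (proj e) (proj e) = 1"
  using height_bounds(3)[of e] height_bounds(1)[of e, symmetric]
  by (simp add: inner_prod_proj b flip: power2_eq_square)

lemma proj_orthogonal: "inner_prod d u (proj e) = 0"
  unfolding proj_def inner_prod_scale_right inner_prod_diff_right by (simp add: u corr_def)

lemma inner_prod_b: "e \<in> A \<Longrightarrow> inner_prod d (b e) x = corr e * inner_prod d u x + height e * inner_prod d (proj e) x"
  using height_bounds[of e]
  unfolding proj_def inner_prod_scale_left inner_prod_diff_left by simp

definition slope :: real where
  "slope = (1 - \<eta>) / (1 + \<eta>)"

lemma slope_bounds: "0 \<le> slope" "slope < 1"
  using \<eta> by (auto simp: slope_def)

text \<open>The triangle inequality says that the numerator in \<open>inner_prod_proj\<close> is at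
  least \<open>- ((1 + corr e) * (1 + corr f))\<close>. Divided by its height, each factor is the
  root of (1 + c) / (1 - c), which increases with the correlation c and is \<open>sqrt slope\<close>
  at \<open>- \<eta>\<close>.\<close>

lemma proj_correlation_ge:
  assumes e: "e \<in> A" and f: "f \<in> A"
  shows "- slope \<le> inner_prod d (proj e) (proj f)"
proof -
  have s: "(1 + corr g) / height g \<le> sqrt slope" "0 \<le> (1 + corr g) / height g" if "g \<in> A" for g
  proof -
    have c: "-1 + \<eta> \<le> corr g" "corr g \<le> -\<eta>" using window that by (auto simp: corr_def)
    have "((1 + corr g) / height g)\<^sup>2 = (1 + corr g) * (1 + corr g) / ((1 - corr g) * (1 + corr g))"
      unfolding power_divide height_bounds(1)[OF that] by (simp add: power2_eq_square algebra_simps)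
    also have "\<dots> = (1 + corr g) / (1 - corr g)" using c \<eta> by simp
    also have "\<dots> \<le> slope" unfolding slope_def using c \<eta> by (intro frac_le) auto
    finally show "(1 + corr g) / height g \<le> sqrt slope" by (rule real_le_rsqrt)
    show "0 \<le> (1 + corr g) / height g" using c \<eta> height_bounds(3)[OF that] by simp
  qed
  have "(1 + corr e) / height e * ((1 + corr f) / height f) \<le> sqrt slope * sqrt slope"
    using s[OF e] s[OF f] slope_bounds by (intro mult_mono) auto
  then have "- slope \<le> - ((1 + corr e) * (1 + corr f)) / (height e * height f)"
    using slope_bounds by simp
  also have "\<dots> \<le> inner_prod d (proj e) (proj f)"
    unfolding inner_prod_proj
  proof (rule divide_right_mono)
    show "- ((1 + corr e) * (1 + corr f)) \<le> inner_prod d (b e) (b f) - corr e * corr f"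
      using triangle[OF e f] by (simp add: corr_def algebra_simps)
    show "0 \<le> height e * height f"
      using height_bounds(3)[OF e] height_bounds(3)[OF f] by simp
  qed
  finally show ?thesis .
qed

text \<open>\<open>cl\<close> groups edges with the same neighbour vector. Pairs within a class have
  power 1, and by Cauchy-Schwarz over at most \<open>M\<close> classes they carry at least a share
  \<open>1 / real M\<close> of the squared weight; any other pair costs at most
  \<open>slope ^ (2 * k + 1)\<close>.\<close>

lemma proj_power_kernel_ge:
  assumes cl: "\<And>e f. e \<in> A \<Longrightarrow> f \<in> A \<Longrightarrow> cl e = cl f \<Longrightarrow> inner_prod d (b e) (b f) = 1 \<and> corr e = corr f"
    and card: "card (cl ` A) \<le> M" and M: "M > 0"
  shows "total\<^sup>2 * (1 / real M - slope ^ (2 * k + 1)) \<le>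
    (\<Sum>e\<in>A. \<Sum>f\<in>A. W e * W f * inner_prod d (proj e) (proj f) ^ (2 * k + 1))"
proof -
  define S where "S c = (\<Sum>e\<in>{e\<in>A. cl e = c}. W e)" for c
  have total_S: "total = (\<Sum>c\<in>cl ` A. S c)"
    unfolding total_def S_def using fin by (rule sum.image_gen)
  have same: "(\<Sum>e\<in>A. \<Sum>f\<in>A. W e * W f * (if cl e = cl f then 1 else 0)) = (\<Sum>c\<in>cl ` A. (S c)\<^sup>2)"
  proof -
    have "(\<Sum>e\<in>A. \<Sum>f\<in>A. W e * W f * (if cl e = cl f then 1 else 0)) = (\<Sum>e\<in>A. W e * S (cl e))"
      unfolding S_def using fin
      by (intro sum.cong refl) (simp add: sum.inter_filter sum_distrib_left if_distrib eq_commute cong: if_cong)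
    also have "\<dots> = (\<Sum>c\<in>cl ` A. \<Sum>e\<in>{e\<in>A. cl e = c}. W e * S (cl e))"
      using fin by (rule sum.image_gen)
    also have "\<dots> = (\<Sum>c\<in>cl ` A. (S c)\<^sup>2)"
      unfolding power2_eq_square by (intro sum.cong refl) (simp add: S_def sum_distrib_right)
    finally show ?thesis .
  qed
  have "total\<^sup>2 \<le> real (card (cl ` A)) * (\<Sum>c\<in>cl ` A. (S c)\<^sup>2)"
    unfolding total_S using sum_squared_le_sum_of_squares[of S "cl ` A"] fin by (simp add: mult.commute)
  also have "\<dots> \<le> real M * (\<Sum>c\<in>cl ` A. (S c)\<^sup>2)"
    using card by (intro mult_right_mono sum_nonneg) auto
  finally have CS: "total\<^sup>2 / real M \<le> (\<Sum>c\<in>cl ` A. (S c)\<^sup>2)"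
    using M by (simp add: field_simps)
  have "total\<^sup>2 * (1 / real M - slope ^ (2 * k + 1)) \<le>
      (\<Sum>e\<in>A. \<Sum>f\<in>A. W e * W f * (if cl e = cl f then 1 else 0)) - slope ^ (2 * k + 1) * total\<^sup>2"
    unfolding same using CS by (simp add: algebra_simps)
  also have "slope ^ (2 * k + 1) * total\<^sup>2 = (\<Sum>e\<in>A. \<Sum>f\<in>A. W e * W f * slope ^ (2 * k + 1))"
  proof -
    have t: "total\<^sup>2 = (\<Sum>e\<in>A. \<Sum>f\<in>A. W e * W f)"
      by (simp add: total_def power2_eq_square sum_product)
    have "q * total\<^sup>2 = (\<Sum>e\<in>A. \<Sum>f\<in>A. W e * W f * q)" for q
      unfolding t sum_distrib_left by (intro sum.cong refl) (rule mult.commute)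
    then show ?thesis .
  qed
  also have "(\<Sum>e\<in>A. \<Sum>f\<in>A. W e * W f * (if cl e = cl f then 1 else 0)) - \<dots> =
      (\<Sum>e\<in>A. \<Sum>f\<in>A. W e * W f * ((if cl e = cl f then 1 else 0) - slope ^ (2 * k + 1)))"
    by (simp only: sum_subtractf[symmetric] right_diff_distrib)
  also have "\<dots> \<le> (\<Sum>e\<in>A. \<Sum>f\<in>A. W e * W f * inner_prod d (proj e) (proj f) ^ (2 * k + 1))"
  proof (intro sum_mono mult_left_mono)
    fix e f assume ef: "e \<in> A" "f \<in> A"
    show "0 \<le> W e * W f" using W ef by simp
    show "(if cl e = cl f then 1 else 0) - slope ^ (2 * k + 1) \<le> inner_prod d (proj e) (proj f) ^ (2 * k + 1)"
    proof (cases "cl e = cl f")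
      case True
      have "height e = height f" using cl[OF ef True] by (simp add: height_def)
      then have "inner_prod d (proj e) (proj f) = 1"
        using cl[OF ef True] height_bounds(3)[OF ef(2)] height_bounds(1)[OF ef(2), symmetric]
        by (simp add: inner_prod_proj flip: power2_eq_square)
      then show ?thesis using True slope_bounds by simp
    next
      case False
      have "(- slope) ^ (2 * k + 1) \<le> inner_prod d (proj e) (proj f) ^ (2 * k + 1)"
        using proj_correlation_ge[OF ef] by (intro power_mono_odd) auto
      then show ?thesis using False by simp
    qed
  qed
  finally show ?thesis .
qed

definition strip :: "real \<Rightarrow> (nat \<Rightarrow> real) set" where
  "strip \<delta> = {\<omega>. \<bar>inner_prod d u \<omega>\<bar> \<le> \<delta>}"

definition Z :: "(nat \<Rightarrow> real) \<Rightarrow> real" where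
  "Z \<omega> = (\<Sum>e\<in>A. W e * sgn_pm (inner_prod d (proj e) \<omega>))"

lemma strip_sets [measurable]: "strip \<delta> \<in> sets gauss_tape"
  unfolding strip_def by (rule gauss_strip_sets)

lemma indicator_strip: "indicator (strip \<delta>) \<omega> = (indicator {-\<delta>..\<delta>} (inner_prod d u \<omega>) :: real)"
  by (auto simp: strip_def indicator_def abs_le_iff)

lemma strip_integrable:
  fixes f :: "(nat \<Rightarrow> real) \<Rightarrow> real"
  assumes "f \<in> borel_measurable gauss_tape" "\<And>\<omega>. \<bar>f \<omega>\<bar> \<le> B"
  shows "integrable gauss_tape (\<lambda>\<omega>. indicator (strip \<delta>) \<omega> * f \<omega>)"
proof -
  have "\<bar>indicator (strip \<delta>) \<omega> * f \<omega>\<bar> \<le> B" for \<omega>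
    using assms(2)[of \<omega>] abs_ge_zero[of "f \<omega>"] by (auto simp: indicator_def simp del: abs_ge_zero)
  then show ?thesis
    using assms(1) by (intro gauss_integrable_bounded[where B = B]) auto
qed

lemma Z_measurable [measurable]: "Z \<in> borel_measurable gauss_tape"
  unfolding Z_def by measurable

lemma abs_Z_le: "\<bar>Z \<omega>\<bar> \<le> total"
proof -
  have "\<bar>Z \<omega>\<bar> \<le> (\<Sum>e\<in>A. \<bar>W e * sgn_pm (inner_prod d (proj e) \<omega>)\<bar>)"
    unfolding Z_def by (rule sum_abs)
  also have "\<dots> = total" unfolding total_def using W by (intro sum.cong) (auto simp: abs_mult)
  finally show ?thesis .
qed

lemma total_nonneg: "0 \<le> total"
  unfolding total_def using W by (rule sum_nonneg)

text \<open>Expanding the square gives pairs of signs; each product is independent of the strip and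
  contributes the arcsine of Grothendieck's identity.\<close>

lemma strip_second_moment:
  "(\<integral>\<omega>. indicator (strip \<delta>) \<omega> * (Z \<omega>)\<^sup>2 \<partial>gauss_tape) =
    gauss.prob (strip \<delta>) * (2 / pi * (\<Sum>e\<in>A. \<Sum>f\<in>A. W e * W f * arcsin (inner_prod d (proj e) (proj f))))"
proof -
  define Y where "Y e f \<omega> = indicator {-\<delta>..\<delta>} (inner_prod d u \<omega>) *
      (sgn_pm (inner_prod d (proj e) \<omega>) * sgn_pm (inner_prod d (proj f) \<omega>))" for e f \<omega>
  have int: "integrable gauss_tape (Y e f)" for e f
    unfolding Y_def indicator_strip[symmetric]
    by (rule strip_integrable[where B = 1]) (auto simp: abs_mult)
  have P: "(\<integral>\<omega>. indicator {-\<delta>..\<delta>} (inner_prod d u \<omega>) \<partial>gauss_tape) = gauss.prob (strip \<delta>)"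
    unfolding indicator_strip[symmetric] by simp
  have "(\<integral>\<omega>. indicator (strip \<delta>) \<omega> * (Z \<omega>)\<^sup>2 \<partial>gauss_tape) =
      (\<integral>\<omega>. (\<Sum>e\<in>A. \<Sum>f\<in>A. W e * W f * Y e f \<omega>) \<partial>gauss_tape)"
    unfolding indicator_strip Y_def Z_def power2_eq_square sum_product
    by (simp add: sum_distrib_left mult_ac)
  also have "\<dots> = (\<Sum>e\<in>A. \<Sum>f\<in>A. W e * W f * (\<integral>\<omega>. Y e f \<omega> \<partial>gauss_tape))"
    using int by (simp add: Bochner_Integration.integral_sum)
  also have "\<dots> = (\<Sum>e\<in>A. \<Sum>f\<in>A. W e * W f * (gauss.prob (strip \<delta>) * (2 / pi * arcsin (inner_prod d (proj e) (proj f)))))"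
  proof (intro sum.cong refl)
    fix e f assume "e \<in> A" "f \<in> A"
    then have "(\<integral>\<omega>. Y e f \<omega> \<partial>gauss_tape) = gauss.prob (strip \<delta>) * (2 / pi * arcsin (inner_prod d (proj e) (proj f)))"
      unfolding Y_def P[symmetric] by (intro integral_strip_sgn_pm_product) (auto simp: u proj_orthogonal proj_unit)
    then show "W e * W f * (\<integral>\<omega>. Y e f \<omega> \<partial>gauss_tape) =
        W e * W f * (gauss.prob (strip \<delta>) * (2 / pi * arcsin (inner_prod d (proj e) (proj f))))" by simp
  qed
  also have "\<dots> = gauss.prob (strip \<delta>) * (2 / pi * (\<Sum>e\<in>A. \<Sum>f\<in>A. W e * W f * arcsin (inner_prod d (proj e) (proj f))))"
    by (simp add: sum_distrib_left mult_ac)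
  finally show ?thesis .
qed

text \<open>By the symmetry \<open>p \<mapsto> - p\<close> of the joint law.\<close>

lemma integral_indicator_sgn_pm:
  assumes p: "inner_prod d p p = 1" "inner_prod d u p = 0" and B: "B \<in> sets borel"
  shows "(\<integral>\<omega>. indicator B (inner_prod d u \<omega>) * sgn_pm (inner_prod d p \<omega>) \<partial>gauss_tape) = 0"
proof -
  have [measurable]: "B \<in> sets borel" by fact
  define J where "J C = (\<integral>\<omega>. indicator B (inner_prod d u \<omega>) * indicator C (inner_prod d p \<omega>) \<partial>gauss_tape :: real)" for C
  have int: "integrable gauss_tape (\<lambda>\<omega>. indicator B (inner_prod d u \<omega>) * (indicator C (inner_prod d p \<omega>) :: real))"
    if [measurable]: "C \<in> sets borel" for C
    by (rule gauss_integrable_bounded[where B = 1]) (auto simp: indicator_def)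
  have "(\<integral>\<omega>. indicator B (inner_prod d u \<omega>) * sgn_pm (inner_prod d p \<omega>) \<partial>gauss_tape) = J {0..} - J {..<0}"
    unfolding sgn_pm_indicator right_diff_distrib J_def by (intro Bochner_Integration.integral_diff int) auto
  moreover have "J {0..} = J {..0}"
  proof -
    have "J {0..} = (\<integral>\<omega>. indicator B (inner_prod d u \<omega>) * indicator {0..} (inner_prod d p \<omega>) *
        indicator UNIV (inner_prod d p \<omega>) \<partial>gauss_tape)" by (simp add: J_def)
    also have "\<dots> = (\<integral>\<omega>. indicator B (inner_prod d u \<omega>) * indicator {0..} (inner_prod d (\<lambda>l. - p l) \<omega>) *
        indicator UNIV (inner_prod d (\<lambda>l. - p l) \<omega>) \<partial>gauss_tape)"
      using p by (intro gauss_joint_law) (auto simp: inner_prod_uminus inner_prod_uminus_right)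
    also have "\<dots> = J {..0}"
      unfolding J_def by (intro Bochner_Integration.integral_cong) (auto simp: inner_prod_uminus indicator_def)
    finally show ?thesis .
  qed
  moreover have "J {..0} = J {..<0}"
  proof -
    have "AE \<omega> in gauss_tape. \<omega> \<notin> {\<omega>. inner_prod d p \<omega> = 0}"
      using gauss_null[OF p(1)] gauss.prob_eq_0[of "{\<omega>. inner_prod d p \<omega> = 0}"] by simp
    then show ?thesis
      unfolding J_def by (intro integral_cong_AE, measurable, measurable, elim AE_mp, intro AE_I2) (auto simp: indicator_def)
  qed
  ultimately show ?thesis by simp
qed

text \<open>Cutting the strip at 0 fixes the sign of \<open>u\<close>, and on either half every
  projected sign has mean 0. Hence the positive and the negative part of the product have equal
  means.\<close>

lemma strip_first_moment:
  "(\<integral>\<omega>. indicator (strip \<delta>) \<omega> * (sgn_pm (inner_prod d u \<omega>) * Z \<omega>) \<partial>gauss_tape) = 0"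
proof -
  define P N where "P = {-\<delta>..\<delta>} \<inter> {0..}" and "N = {-\<delta>..\<delta>} \<inter> {..<0::real}"
  have [measurable]: "P \<in> sets borel" "N \<in> sets borel" by (auto simp: P_def N_def)
  define Y where "Y B e \<omega> = indicator B (inner_prod d u \<omega>) * sgn_pm (inner_prod d (proj e) \<omega>)" for B e \<omega>
  have int: "integrable gauss_tape (Y B e)" if [measurable]: "B \<in> sets borel" for B e
    unfolding Y_def by (rule gauss_integrable_bounded[where B = 1]) (auto simp: indicator_def)
  have zero: "(\<integral>\<omega>. Y B e \<omega> \<partial>gauss_tape) = 0" if "B \<in> sets borel" "e \<in> A" for B e
    unfolding Y_def using that by (intro integral_indicator_sgn_pm proj_unit proj_orthogonal)
  have ind: "indicator (strip \<delta>) \<omega> * sgn_pm (inner_prod d u \<omega>) =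
      indicator P (inner_prod d u \<omega>) - indicator N (inner_prod d u \<omega>)" for \<omega>
    by (auto simp: strip_def indicator_def sgn_pm_def P_def N_def abs_le_iff)
  have "(\<integral>\<omega>. indicator (strip \<delta>) \<omega> * (sgn_pm (inner_prod d u \<omega>) * Z \<omega>) \<partial>gauss_tape) =
      (\<integral>\<omega>. (\<Sum>e\<in>A. W e * (Y P e \<omega> - Y N e \<omega>)) \<partial>gauss_tape)"
    unfolding mult.assoc[symmetric] ind unfolding Z_def Y_def
    by (simp add: sum_distrib_left algebra_simps)
  also have "\<dots> = (\<Sum>e\<in>A. W e * ((\<integral>\<omega>. Y P e \<omega> \<partial>gauss_tape) - (\<integral>\<omega>. Y N e \<omega> \<partial>gauss_tape)))"
    using int by (simp add: Bochner_Integration.integral_sum)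
  also have "\<dots> = 0" using zero by (intro sum.neutral) auto
  finally show ?thesis .
qed

text \<open>The square of \<open>Z\<close> is at most \<open>total\<close> times its absolute value,
  and an absolute value is twice the positive part minus the number itself, here of mean 0 over the
  strip. So the second moment controls the mean positive part.\<close>

lemma strip_positive_part:
  assumes lam: "\<kappa> * total\<^sup>2 \<le> 2 / pi * (\<Sum>e\<in>A. \<Sum>f\<in>A. W e * W f * arcsin (inner_prod d (proj e) (proj f)))"
  shows "gauss.prob (strip \<delta>) * \<kappa> * total / 2 \<le>
    (\<integral>\<omega>. indicator (strip \<delta>) \<omega> * max 0 (sgn_pm (inner_prod d u \<omega>) * Z \<omega>) \<partial>gauss_tape)"
proof (cases "total = 0")
  case True
  then show ?thesis by (simp add: Bochner_Integration.integral_nonneg)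
next
  case False
  then have pos: "0 < total" using total_nonneg by simp
  let ?x = "\<lambda>\<omega>. sgn_pm (inner_prod d u \<omega>)" and ?I = "\<lambda>\<omega>. indicator (strip \<delta>) \<omega> :: real"
  have int: "integrable gauss_tape (\<lambda>\<omega>. ?I \<omega> * (Z \<omega>)\<^sup>2)" "integrable gauss_tape (\<lambda>\<omega>. ?I \<omega> * (?x \<omega> * Z \<omega>))"
    "integrable gauss_tape (\<lambda>\<omega>. ?I \<omega> * max 0 (?x \<omega> * Z \<omega>))"
  proof -
    have "(Z \<omega>)\<^sup>2 \<le> total\<^sup>2" for \<omega>
      using abs_Z_le[of \<omega>] total_nonneg by (simp add: abs_le_square_iff[symmetric])
    then show "integrable gauss_tape (\<lambda>\<omega>. ?I \<omega> * (Z \<omega>)\<^sup>2)"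
      by (intro strip_integrable[where B = "total\<^sup>2"]) auto
    show "integrable gauss_tape (\<lambda>\<omega>. ?I \<omega> * (?x \<omega> * Z \<omega>))"
      using abs_Z_le by (intro strip_integrable[where B = total]) (auto simp: abs_mult)
    have "\<bar>max 0 (?x \<omega> * Z \<omega>)\<bar> \<le> total" for \<omega>
      using abs_Z_le[of \<omega>] total_nonneg by (auto simp: max_def sgn_pm_def)
    then show "integrable gauss_tape (\<lambda>\<omega>. ?I \<omega> * max 0 (?x \<omega> * Z \<omega>))"
      by (intro strip_integrable[where B = total]) auto
  qed
  have point: "1/2 * (?I \<omega> * (Z \<omega>)\<^sup>2) + total / 2 * (?I \<omega> * (?x \<omega> * Z \<omega>)) \<le> total * (?I \<omega> * max 0 (?x \<omega> * Z \<omega>))" for \<omega>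
  proof -
    have "(Z \<omega>)\<^sup>2 = \<bar>Z \<omega>\<bar> * \<bar>Z \<omega>\<bar>" by (simp add: power2_eq_square)
    also have "\<dots> \<le> total * \<bar>Z \<omega>\<bar>" using abs_Z_le by (intro mult_right_mono) auto
    also have "\<bar>Z \<omega>\<bar> = 2 * max 0 (?x \<omega> * Z \<omega>) - ?x \<omega> * Z \<omega>" by (auto simp: sgn_pm_def max_def)
    finally have "1/2 * (Z \<omega>)\<^sup>2 + total / 2 * (?x \<omega> * Z \<omega>) \<le> total * max 0 (?x \<omega> * Z \<omega>)"
      by (simp add: algebra_simps)
    then show ?thesis by (auto simp: indicator_def)
  qed
  have "1/2 * (gauss.prob (strip \<delta>) * (\<kappa> * total\<^sup>2)) \<le> 1/2 * (\<integral>\<omega>. ?I \<omega> * (Z \<omega>)\<^sup>2 \<partial>gauss_tape)"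
    unfolding strip_second_moment using lam by (intro mult_left_mono) auto
  also have "\<dots> = (\<integral>\<omega>. 1/2 * (?I \<omega> * (Z \<omega>)\<^sup>2) + total / 2 * (?I \<omega> * (?x \<omega> * Z \<omega>)) \<partial>gauss_tape)"
    using int strip_first_moment by (subst Bochner_Integration.integral_add) auto
  also have "\<dots> \<le> (\<integral>\<omega>. total * (?I \<omega> * max 0 (?x \<omega> * Z \<omega>)) \<partial>gauss_tape)"
    using int point by (intro integral_mono) auto
  also have "\<dots> = total * (\<integral>\<omega>. ?I \<omega> * max 0 (?x \<omega> * Z \<omega>) \<partial>gauss_tape)" by simp
  finally have "total * (gauss.prob (strip \<delta>) * \<kappa> * total / 2) \<le> total * (\<integral>\<omega>. ?I \<omega> * max 0 (?x \<omega> * Z \<omega>) \<partial>gauss_tape)"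
    by (simp add: power2_eq_square mult_ac)
  then show ?thesis using pos by simp
qed

text \<open>On the strip, \<open>inner_prod_b\<close> shifts \<open>height e\<close> times the
  projected value by at most \<open>\<delta>\<close>. The sign can change only if the projection is
  within \<open>\<delta> / \<eta>\<close> of 0, an event independent of the strip.\<close>

lemma strip_mismatch:
  assumes e: "e \<in> A" and \<delta>: "0 \<le> \<delta>"
  shows "(\<integral>\<omega>. indicator (strip \<delta>) \<omega> * indicator {\<omega>. sgn_pm (inner_prod d (b e) \<omega>) \<noteq> sgn_pm (inner_prod d (proj e) \<omega>)} \<omega> \<partial>gauss_tape)
    \<le> gauss.prob (strip \<delta>) * (\<delta> / \<eta>)"
proof -
  let ?D = "{\<omega>. sgn_pm (inner_prod d (b e) \<omega>) \<noteq> sgn_pm (inner_prod d (proj e) \<omega>)}"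
  define r where "r = \<delta> / \<eta>"
  have r: "0 \<le> r" using \<delta> \<eta> by (simp add: r_def)
  have le: "indicator (strip \<delta>) \<omega> * indicator ?D \<omega> \<le>
      indicator {-\<delta>..\<delta>} (inner_prod d u \<omega>) * (indicator {-r..r} (inner_prod d (proj e) \<omega>) :: real)" for \<omega>
  proof -
    have "\<bar>inner_prod d (proj e) \<omega>\<bar> \<le> r" if T: "\<bar>inner_prod d u \<omega>\<bar> \<le> \<delta>" and D: "\<omega> \<in> ?D"
    proof -
      have "height e * \<bar>inner_prod d (proj e) \<omega>\<bar> = \<bar>height e * inner_prod d (proj e) \<omega>\<bar>"
        using height_bounds(3)[OF e] by (simp add: abs_mult)
      also have "\<dots> \<le> \<bar>corr e * inner_prod d u \<omega>\<bar>"
      proof -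
        have sg: "height e * inner_prod d (proj e) \<omega> < 0 \<longleftrightarrow> inner_prod d (proj e) \<omega> < 0"
          using height_bounds(3)[OF e] by (simp add: mult_less_0_iff)
        show ?thesis
          using D sg inner_prod_b[OF e, of \<omega>] by (auto simp: sgn_pm_eq_iff)
      qed
      also have "\<dots> \<le> 1 * \<delta>"
        unfolding abs_mult using T window[OF e] \<eta> by (intro mult_mono) (auto simp: corr_def)
      finally have "height e * \<bar>inner_prod d (proj e) \<omega>\<bar> \<le> \<delta>" by simp
      moreover have "\<eta> * \<bar>inner_prod d (proj e) \<omega>\<bar> \<le> height e * \<bar>inner_prod d (proj e) \<omega>\<bar>"
        using height_bounds(2)[OF e] by (intro mult_right_mono) auto
      ultimately show ?thesis using \<eta> by (simp add: r_def field_simps)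
    qed
    then show ?thesis by (auto simp: strip_def indicator_def abs_le_iff)
  qed
  have "(\<integral>\<omega>. indicator (strip \<delta>) \<omega> * indicator ?D \<omega> \<partial>gauss_tape) \<le>
      (\<integral>\<omega>. indicator {-\<delta>..\<delta>} (inner_prod d u \<omega>) * indicator {-r..r} (inner_prod d (proj e) \<omega>) \<partial>gauss_tape :: real)"
  proof (rule integral_mono)
    show "integrable gauss_tape (\<lambda>\<omega>. indicator (strip \<delta>) \<omega> * indicator ?D \<omega> :: real)"
      by (intro strip_integrable[where B = 1] borel_measurable_indicator sign_mismatch_set) (auto simp: indicator_def)
    show "integrable gauss_tape (\<lambda>\<omega>. indicator {-\<delta>..\<delta>} (inner_prod d u \<omega>) * indicator {-r..r} (inner_prod d (proj e) \<omega>) :: real)"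
      by (rule gauss_integrable_bounded[where B = 1]) (auto simp: indicator_def)
  qed (rule le)
  also have "\<dots> = (\<integral>\<omega>. indicator {-\<delta>..\<delta>} (inner_prod d u \<omega>) \<partial>gauss_tape) *
      (\<integral>\<omega>. indicator {-r..r} (inner_prod d (proj e) \<omega>) \<partial>gauss_tape)"
    using gauss_independent_of_orthogonal[OF u proj_orthogonal[of e] proj_orthogonal[of e], of "{-\<delta>..\<delta>}" "{-r..r}" UNIV]
    by simp
  also have "(\<integral>\<omega>. indicator {-\<delta>..\<delta>} (inner_prod d u \<omega>) \<partial>gauss_tape) = gauss.prob (strip \<delta>)"
    unfolding indicator_strip[symmetric] by simp
  also have "(\<integral>\<omega>. indicator {-r..r} (inner_prod d (proj e) \<omega>) \<partial>gauss_tape) \<le> r"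
  proof -
    have "(\<integral>\<omega>. indicator {-r..r} (inner_prod d (proj e) \<omega>) \<partial>gauss_tape) =
        (\<integral>\<omega>. indicator {\<omega>. \<bar>inner_prod d (proj e) \<omega>\<bar> \<le> r} \<omega> \<partial>gauss_tape :: real)"
      by (intro Bochner_Integration.integral_cong) (auto simp: indicator_def abs_le_iff)
    then show ?thesis using gauss_strip(1)[OF proj_unit[OF e] r] by simp
  qed
  finally show ?thesis by (simp add: r_def mult_left_mono)
qed

text \<open>On a thin strip around the hyperplane orthogonal to \<open>u\<close>, the sign of \<open>u\<close> is independent of
  the signs of the projections, so about half of the time it is the wrong one for \<open>Z\<close>.\<close>

lemma strip_gain:
  fixes c :: "'e \<Rightarrow> nat \<Rightarrow> real" and G :: "(nat \<Rightarrow> real) \<Rightarrow> real"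
  assumes lam: "\<kappa> * total\<^sup>2 \<le> 2 / pi * (\<Sum>e\<in>A. \<Sum>f\<in>A. W e * W f * arcsin (inner_prod d (proj e) (proj f)))"
    and c: "\<And>e. e \<in> A \<Longrightarrow> sign_mismatch d (c e) u \<le> s" and \<delta>: "0 \<le> \<delta>" and R: "0 \<le> R"
    and G: "G \<in> borel_measurable gauss_tape" "\<And>\<omega>. \<bar>G \<omega>\<bar> \<le> B"
    and G_ge: "AE \<omega> in gauss_tape. (\<Sum>e\<in>A. W e * (sgn_pm (inner_prod d (c e) \<omega>) * sgn_pm (inner_prod d (b e) \<omega>))) - R \<le> G \<omega>"
  shows "total * (gauss.prob (strip \<delta>) * \<kappa> / 2 - 2 * s - 2 * gauss.prob (strip \<delta>) * (\<delta> / \<eta>)) - gauss.prob (strip \<delta>) * R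
    \<le> (\<integral>\<omega>. max 0 (G \<omega>) \<partial>gauss_tape)"
proof -
  let ?P = "gauss.prob (strip \<delta>)"
  let ?x = "\<lambda>\<omega>. sgn_pm (inner_prod d u \<omega>)" and ?I = "\<lambda>\<omega>. indicator (strip \<delta>) \<omega> :: real"
  let ?C = "\<lambda>e. {\<omega>. sgn_pm (inner_prod d (c e) \<omega>) \<noteq> sgn_pm (inner_prod d u \<omega>)}"
  let ?D = "\<lambda>e. {\<omega>. sgn_pm (inner_prod d (b e) \<omega>) \<noteq> sgn_pm (inner_prod d (proj e) \<omega>)}"
  have intC: "integrable gauss_tape (indicator (?C e) :: _ \<Rightarrow> real)" for e
    by (intro gauss_integrable_bounded[where B = 1] borel_measurable_indicator sign_mismatch_set) (auto simp: indicator_def)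
  have intD: "integrable gauss_tape (\<lambda>\<omega>. ?I \<omega> * indicator (?D e) \<omega>)" for e
    by (intro strip_integrable[where B = 1] borel_measurable_indicator sign_mismatch_set) (auto simp: indicator_def)
  have intZ: "integrable gauss_tape (\<lambda>\<omega>. ?I \<omega> * max 0 (?x \<omega> * Z \<omega>))"
  proof -
    have "\<bar>max 0 (?x \<omega> * Z \<omega>)\<bar> \<le> total" for \<omega>
      using abs_Z_le[of \<omega>] total_nonneg by (auto simp: max_def sgn_pm_def)
    then show ?thesis by (intro strip_integrable[where B = total]) auto
  qed
  have intI: "integrable gauss_tape ?I"
    by (rule gauss_integrable_bounded[where B = 1]) (auto simp: indicator_def)
  have intG: "integrable gauss_tape (\<lambda>\<omega>. max 0 (G \<omega>))"
  proof -
    have "\<bar>max 0 (G \<omega>)\<bar> \<le> B" for \<omega> using G(2)[of \<omega>] by (auto simp: max_def)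
    then show ?thesis using G(1) by (intro gauss_integrable_bounded[where B = B]) auto
  qed
  \<comment> \<open>A wrong sign costs \<open>2 * W e\<close>, once for \<open>c e\<close> in place
    of \<open>u\<close> and once for \<open>b e\<close> in place of \<open>proj e\<close>. Only the
    second error is confined to the strip, so \<open>s\<close> enters the bound without the factor
    \<open>gauss.prob (strip \<delta>)\<close>.\<close>
  define err where "err \<omega> = (\<Sum>e\<in>A. W e * (2 * indicator (?C e) \<omega> + 2 * (?I \<omega> * indicator (?D e) \<omega>)))" for \<omega>
  have int_err: "integrable gauss_tape err"
    unfolding err_def using intC intD by auto
  have "AE \<omega> in gauss_tape. ?I \<omega> * max 0 (?x \<omega> * Z \<omega>) - err \<omega> - R * ?I \<omega> \<le> max 0 (G \<omega>)"
    using G_ge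
  proof eventually_elim
    fix \<omega> assume ge: "(\<Sum>e\<in>A. W e * (sgn_pm (inner_prod d (c e) \<omega>) * sgn_pm (inner_prod d (b e) \<omega>))) - R \<le> G \<omega>"
    show "?I \<omega> * max 0 (?x \<omega> * Z \<omega>) - err \<omega> - R * ?I \<omega> \<le> max 0 (G \<omega>)"
    proof (cases "\<omega> \<in> strip \<delta>")
      case True
      have "?x \<omega> * Z \<omega> - err \<omega> = (\<Sum>e\<in>A. W e * (?x \<omega> * sgn_pm (inner_prod d (proj e) \<omega>) -
          (2 * indicator (?C e) \<omega> + 2 * indicator (?D e) \<omega>)))"
        using True by (simp add: Z_def err_def sum_subtractf sum_distrib_left algebra_simps)
      also have "\<dots> \<le> (\<Sum>e\<in>A. W e * (sgn_pm (inner_prod d (c e) \<omega>) * sgn_pm (inner_prod d (b e) \<omega>)))"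
      proof (intro sum_mono mult_left_mono W)
        fix e
        show "?x \<omega> * sgn_pm (inner_prod d (proj e) \<omega>) - (2 * indicator (?C e) \<omega> + 2 * indicator (?D e) \<omega>) \<le>
            sgn_pm (inner_prod d (c e) \<omega>) * sgn_pm (inner_prod d (b e) \<omega>)"
          by (auto simp: indicator_def sgn_pm_def)
      qed
      finally have "?x \<omega> * Z \<omega> - err \<omega> - R \<le> G \<omega>" using ge by linarith
      moreover have "0 \<le> err \<omega>"
        unfolding err_def using W by (intro sum_nonneg mult_nonneg_nonneg) auto
      ultimately show ?thesis using True R by (auto simp: max_def)
    next
      \<comment> \<open>Outside the strip the left side is at most 0, so \<open>R\<close> is charged
        on the strip only.\<close>
      case False
      have "0 \<le> err \<omega>"
        unfolding err_def using W by (intro sum_nonneg mult_nonneg_nonneg) auto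
      with False show ?thesis by simp
    qed
  qed
  then have "(\<integral>\<omega>. ?I \<omega> * max 0 (?x \<omega> * Z \<omega>) - err \<omega> - R * ?I \<omega> \<partial>gauss_tape) \<le> (\<integral>\<omega>. max 0 (G \<omega>) \<partial>gauss_tape)"
    using intZ int_err intI intG by (intro integral_mono_AE) auto
  moreover have "(\<integral>\<omega>. ?I \<omega> * max 0 (?x \<omega> * Z \<omega>) - err \<omega> - R * ?I \<omega> \<partial>gauss_tape) =
      (\<integral>\<omega>. ?I \<omega> * max 0 (?x \<omega> * Z \<omega>) \<partial>gauss_tape) - (\<integral>\<omega>. err \<omega> \<partial>gauss_tape) - R * ?P"
    using intZ int_err intI by simp
  moreover have "(\<integral>\<omega>. err \<omega> \<partial>gauss_tape) \<le> total * (2 * s + 2 * ?P * (\<delta> / \<eta>))"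
  proof -
    have "(\<integral>\<omega>. err \<omega> \<partial>gauss_tape) = (\<Sum>e\<in>A. W e * (2 * sign_mismatch d (c e) u +
        2 * (\<integral>\<omega>. ?I \<omega> * indicator (?D e) \<omega> \<partial>gauss_tape)))"
      unfolding err_def using intC intD by (simp add: sign_mismatch_def)
    also have "\<dots> \<le> (\<Sum>e\<in>A. W e * (2 * s + 2 * (?P * (\<delta> / \<eta>))))"
      using c strip_mismatch[OF _ \<delta>] by (intro sum_mono mult_left_mono add_mono W) auto
    also have "\<dots> = total * (2 * s + 2 * ?P * (\<delta> / \<eta>))"
      by (simp add: total_def sum_distrib_right mult.assoc)
    finally show ?thesis .
  qed
  moreover have "?P * \<kappa> * total / 2 \<le> (\<integral>\<omega>. ?I \<omega> * max 0 (?x \<omega> * Z \<omega>) \<partial>gauss_tape)"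
    by (rule strip_positive_part[OF lam])
  moreover have "total * (?P * \<kappa> / 2 - 2 * s - 2 * ?P * (\<delta> / \<eta>)) - ?P * R =
      ?P * \<kappa> * total / 2 - total * (2 * s + 2 * ?P * (\<delta> / \<eta>)) - R * ?P"
    by (simp add: algebra_simps)
  ultimately show ?thesis by linarith
qed

end

section \<open>The cluster around a heavy vertex\<close>

lemma inner_prod_square_le:
  assumes "inner_prod d y y = 1"
  shows "(inner_prod d x y)\<^sup>2 \<le> inner_prod d x x"
proof -
  let ?c = "inner_prod d x y"
  have "0 \<le> inner_prod d (\<lambda>l. x l - ?c * y l) (\<lambda>l. x l - ?c * y l)"
    by (rule inner_prod_self_nonneg)
  also have "\<dots> = inner_prod d x x - ?c\<^sup>2"
    unfolding inner_prod_bilinear using assms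
    by (simp add: inner_prod_commute[of d y x] power2_eq_square algebra_simps)
  finally show ?thesis by simp
qed

text \<open>Functions that agree below \<open>d\<close> denote the same vector; clearing the other
  entries gives one representative, so that vectors can be counted and compared by equality.\<close>

definition trunc_vec :: "nat \<Rightarrow> (nat \<Rightarrow> real) \<Rightarrow> nat \<Rightarrow> real" where
  "trunc_vec d x = (\<lambda>l. if l < d then x l else 0)"

lemma inner_prod_trunc: "inner_prod d (trunc_vec d x) y = inner_prod d x y"
  "inner_prod d y (trunc_vec d x) = inner_prod d y x"
  by (simp_all add: inner_prod_def trunc_vec_def)

locale sdp_solution =
  fixes d n :: nat and E :: "(nat \<times> nat) set" and w v :: "nat \<Rightarrow> nat \<Rightarrow> real" and \<epsilon> :: real
  assumes graph: "weighted_graph n E w" and feasible: "sdp_feasible d n v"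
    and eps: "0 < \<epsilon>" "\<epsilon> < 1 / 2"
    and away: "\<And>\<rho>. -1 \<le> \<rho> \<Longrightarrow> \<rho> \<le> 1 \<Longrightarrow> \<rho> \<notin> {-1 + \<epsilon>..-\<epsilon>} \<Longrightarrow> 19 / 20 * ((1 - \<rho>) / 2) \<le> arccos \<rho> / pi"
begin

lemma unit: "i < n \<Longrightarrow> inner_prod d (v i) (v i) = 1"
  using feasible norm2_power2[of "v i" d] by (simp add: sdp_feasible_def)

text \<open>By the law of cosines, the two sides of the triangle inequality differ by twice the
  inner product of the differences taken at \<open>a * v i\<close>.\<close>

lemma nonobtuse_signed:
  assumes "i < n" "j < n" "k < n" "a \<in> {1, -1}" "b \<in> {1, -1}" "c \<in> {1, -1}"
  shows "0 \<le> inner_prod d (\<lambda>l. b * v j l - a * v i l) (\<lambda>l. c * v k l - a * v i l)"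
proof -
  have "inner_prod d (\<lambda>l. b * v j l - c * v k l) (\<lambda>l. b * v j l - c * v k l) \<le>
      inner_prod d (\<lambda>l. a * v i l - b * v j l) (\<lambda>l. a * v i l - b * v j l) +
      inner_prod d (\<lambda>l. a * v i l - c * v k l) (\<lambda>l. a * v i l - c * v k l)"
    using feasible assms unfolding sdp_feasible_def norm2_power2 by blast
  then show ?thesis
    unfolding inner_prod_bilinear inner_prod_commute[of d "v j" "v i"]
      inner_prod_commute[of d "v k" "v i"] inner_prod_commute[of d "v k" "v j"]
    by (simp add: algebra_simps)
qed

text \<open>Both signs are present because the neighbours in a cluster boundary are later multiplied
  by signs.\<close>

definition points :: "(nat \<Rightarrow> real) set" where
  "points = (\<lambda>(a, i). trunc_vec d (\<lambda>l. a * v i l)) ` ({1, -1} \<times> {..<n})"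

lemma finite_points: "finite points"
  by (simp add: points_def)

lemma card_points: "card points \<le> 2 ^ d"
proof (rule nonobtuse_card_le[OF finite_points])
  fix x y assume "x \<in> points" "y \<in> points" "x \<noteq> y"
  then show "\<exists>l<d. x l \<noteq> y l"
    by (fastforce simp: points_def trunc_vec_def)
next
  fix x y z assume "x \<in> points" "y \<in> points" "z \<in> points"
  then obtain a i b j c k where "i < n" "j < n" "k < n" "a \<in> {1, -1}" "b \<in> {1, -1}" "c \<in> {1, -1}"
    "x = trunc_vec d (\<lambda>l. a * v i l)" "y = trunc_vec d (\<lambda>l. b * v j l)" "z = trunc_vec d (\<lambda>l. c * v k l)"
    unfolding points_def by fastforce
  with nonobtuse_signed[of i j k a b c] show "0 \<le> inner_prod d (\<lambda>l. y l - x l) (\<lambda>l. z l - x l)"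
    by (simp add: inner_prod_diff_left inner_prod_diff_right inner_prod_trunc)
qed

lemma edge: "(i, j) \<in> E \<Longrightarrow> i < n" "(i, j) \<in> E \<Longrightarrow> j < n" "(i, j) \<in> E \<Longrightarrow> 0 \<le> w i j"
  using graph by (auto simp: weighted_graph_def)

lemma finite_E: "finite E"
proof (rule finite_subset)
  show "E \<subseteq> {..<n} \<times> {..<n}" using edge by auto
qed simp

definition rho :: "nat \<times> nat \<Rightarrow> real" where
  "rho e = inner_prod d (v (fst e)) (v (snd e))"

definition weight :: "nat \<times> nat \<Rightarrow> real" where
  "weight e = w (fst e) (snd e)"

text \<open>The expected weight that hyperplane rounding cuts at \<open>e\<close>.\<close>

definition gw_value :: "nat \<times> nat \<Rightarrow> real" where
  "gw_value e = weight e * (arccos (rho e) / pi)"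

definition edge_value :: "nat \<times> nat \<Rightarrow> real" where
  "edge_value e = weight e * ((1 - rho e) / 2)"

definition good :: "(nat \<times> nat) set" where
  "good = {e \<in> E. rho e \<in> {-1 + \<epsilon>..-\<epsilon>}}"

lemma edgeD:
  assumes "e \<in> E"
  shows "fst e < n" "snd e < n" "0 \<le> weight e" "-1 \<le> rho e" "rho e \<le> 1"
proof -
  show 1: "fst e < n" "snd e < n" "0 \<le> weight e" using edge[of "fst e" "snd e"] assms by (auto simp: weight_def)
  show "-1 \<le> rho e" "rho e \<le> 1"
    using Cauchy_Schwarz_inner_prod[OF unit[OF 1(1)] unit[OF 1(2)]] by (auto simp: rho_def abs_le_iff)
qed

lemma gw_value_nonneg: "e \<in> E \<Longrightarrow> 0 \<le> gw_value e"
  unfolding gw_value_def using edgeD[of e] by (auto simp: arccos_lbound)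

lemma sdp_value_eq: "sdp_value d E w v = (\<Sum>e\<in>E. edge_value e)"
  by (simp add: sdp_value_def edge_value_def weight_def rho_def case_prod_unfold sum_divide_distrib)

lemma expected_gw_cut:
  "integrable gauss_tape (\<lambda>\<omega>. cut_weight E w (gw_sign d v \<omega>))"
  "(\<integral>\<omega>. cut_weight E w (gw_sign d v \<omega>) \<partial>gauss_tape) = (\<Sum>e\<in>E. gw_value e)"
proof -
  define D where "D e = {\<omega>. sgn_pm (inner_prod d (v (fst e)) \<omega>) \<noteq> sgn_pm (inner_prod d (v (snd e)) \<omega>)}" for e
  have int: "integrable gauss_tape (indicator (D e) :: _ \<Rightarrow> real)" for e
    unfolding D_def
    by (intro gauss_integrable_bounded[where B = 1] borel_measurable_indicator sign_mismatch_set) (auto simp: indicator_def)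
  have cut: "cut_weight E w (gw_sign d v \<omega>) = (\<Sum>e\<in>E. weight e * indicator (D e) \<omega>)" for \<omega>
  proof -
    have "{(i, j)\<in>E. gw_sign d v \<omega> i \<noteq> gw_sign d v \<omega> j} = {e\<in>E. \<omega> \<in> D e}"
      by (auto simp: D_def gw_sign_def)
    then show ?thesis
      unfolding cut_weight_def using sum.inter_filter[OF finite_E]
      by (simp add: case_prod_unfold weight_def indicator_def of_bool_def if_distrib cong: if_cong)
  qed
  show "integrable gauss_tape (\<lambda>\<omega>. cut_weight E w (gw_sign d v \<omega>))"
    unfolding cut using int by auto
  have "(\<integral>\<omega>. cut_weight E w (gw_sign d v \<omega>) \<partial>gauss_tape) = (\<Sum>e\<in>E. weight e * sign_mismatch d (v (fst e)) (v (snd e)))"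
    unfolding cut using int by (simp add: sign_mismatch_def D_def)
  also have "\<dots> = (\<Sum>e\<in>E. gw_value e)"
    unfolding gw_value_def rho_def by (intro sum.cong refl) (use edgeD unit in \<open>simp add: sign_mismatch_eq\<close>)
  finally show "(\<integral>\<omega>. cut_weight E w (gw_sign d v \<omega>) \<partial>gauss_tape) = (\<Sum>e\<in>E. gw_value e)" .
qed

text \<open>Measured by expected cut instead of weight: at an angle near 0 the cut is a negligible
  part of the weight, and it is the cut that yields the excess over \<open>alpha_GW\<close>.\<close>

definition bad_value :: real where
  "bad_value = (\<Sum>e\<in>E - good. gw_value e)"

lemma bad_edge:
  assumes "e \<in> E - good"
  shows "edge_value e \<le> 20 / 19 * gw_value e"
proof -
  have e: "e \<in> E" "rho e \<notin> {-1 + \<epsilon>..-\<epsilon>}" using assms by (auto simp: good_def)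
  have "weight e * (19 / 20 * ((1 - rho e) / 2)) \<le> weight e * (arccos (rho e) / pi)"
    using edgeD[OF e(1)] away[OF _ _ e(2)] by (intro mult_left_mono)
  then have "19 / 20 * edge_value e \<le> gw_value e"
    by (simp only: edge_value_def gw_value_def mult.left_commute)
  then show ?thesis by linarith
qed

text \<open>Bad edges have ratio at least 19/20, while \<open>alpha_GW\<close> is at most 8/9. As
  8/9 times 20/19 is 160/171, just below 15/16, a sixteenth of their expected cut is left
  over.\<close>

lemma gw_excess:
  "alpha_GW * sdp_value d E w v + bad_value / 16 \<le> (\<Sum>e\<in>E. gw_value e)"
proof -
  have ge: "alpha_GW * edge_value e \<le> gw_value e" if "e \<in> E" for e
  proof -
    have "weight e * (alpha_GW * ((1 - rho e) / 2)) \<le> weight e * (arccos (rho e) / pi)"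
      using edgeD[OF that] by (intro mult_left_mono arccos_ge_alpha_GW)
    then show ?thesis by (simp add: edge_value_def gw_value_def mult_ac)
  qed
  have bad: "alpha_GW * edge_value e + gw_value e / 16 \<le> gw_value e" if "e \<in> E - good" for e
  proof -
    have "0 \<le> edge_value e" using edgeD[of e] that by (simp add: edge_value_def)
    then have "alpha_GW * edge_value e \<le> 8 / 9 * edge_value e"
      using alpha_GW_le by (intro mult_right_mono) auto
    also have "\<dots> \<le> 8 / 9 * (20 / 19 * gw_value e)"
      using bad_edge[OF that] by (intro mult_left_mono) auto
    finally show ?thesis using gw_value_nonneg[of e] that by simp
  qed
  have split: "(\<Sum>e\<in>E. f e) = (\<Sum>e\<in>good. f e) + (\<Sum>e\<in>E - good. f e)" for f :: "nat \<times> nat \<Rightarrow> real"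
    using finite_E by (subst sum.subset_diff[of good]) (auto simp: good_def)
  have "alpha_GW * sdp_value d E w v + bad_value / 16 =
      (\<Sum>e\<in>good. alpha_GW * edge_value e) + (\<Sum>e\<in>E - good. alpha_GW * edge_value e + gw_value e / 16)"
    unfolding sdp_value_eq bad_value_def split[of edge_value]
    by (simp add: sum.distrib sum_distrib_left sum_divide_distrib distrib_left)
  also have "\<dots> \<le> (\<Sum>e\<in>good. gw_value e) + (\<Sum>e\<in>E - good. gw_value e)"
    using ge bad by (intro add_mono sum_mono) (auto simp: good_def)
  finally show ?thesis by (simp only: split[symmetric])
qed

definition good_weight :: real where
  "good_weight = (\<Sum>e\<in>good. weight e)"

lemma good_weight_ge: "sdp_value d E w v - 20 / 19 * bad_value \<le> good_weight"
proof -
  have "sdp_value d E w v = (\<Sum>e\<in>good. edge_value e) + (\<Sum>e\<in>E - good. edge_value e)"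
    unfolding sdp_value_eq using finite_E by (subst sum.subset_diff[of good]) (auto simp: good_def)
  moreover have "(\<Sum>e\<in>good. edge_value e) \<le> good_weight"
    unfolding good_weight_def
  proof (rule sum_mono)
    fix e assume "e \<in> good"
    then have "e \<in> E" by (simp add: good_def)
    then have "weight e * ((1 - rho e) / 2) \<le> weight e * 1"
      using edgeD by (intro mult_left_mono) auto
    then show "edge_value e \<le> weight e" by (simp add: edge_value_def)
  qed
  moreover have "(\<Sum>e\<in>E - good. edge_value e) \<le> 20 / 19 * bad_value"
    unfolding bad_value_def sum_distrib_left by (intro sum_mono bad_edge)
  ultimately show ?thesis by linarith
qed

text \<open>Pigeonhole over the at most \<open>2 ^ d\<close> distinct vectors. A good edge is
  attributed to its first endpoint only, so the groups form a partition; vertices with coinciding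
  vectors are pooled.\<close>

lemma heavy_vertex:
  assumes "0 < good_weight"
  obtains i0 where "i0 < n"
    "good_weight / 2 ^ d \<le> (\<Sum>e\<in>{e\<in>good. trunc_vec d (v (fst e)) = trunc_vec d (v i0)}. weight e)"
proof -
  define V where "V = (\<lambda>i. trunc_vec d (v i)) ` {..<n}"
  define h where "h a = (\<Sum>e\<in>{e\<in>good. trunc_vec d (v (fst e)) = a}. weight e)" for a
  have fin: "finite good" using finite_E by (simp add: good_def)
  have "V \<subseteq> points"
    unfolding V_def points_def by (auto simp: image_iff intro!: bexI[of _ "(1, _)"])
  then have card: "card V \<le> 2 ^ d"
    using card_mono[OF finite_points] card_points order.trans by blast
  have sum: "good_weight = (\<Sum>a\<in>V. h a)"
    unfolding good_weight_def h_def using fin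
    by (intro sum.group[symmetric]) (auto simp: V_def good_def dest: edge(1))
  have "\<exists>a\<in>V. good_weight / 2 ^ d \<le> h a"
  proof (rule ccontr)
    assume "\<not> ?thesis"
    then have less: "\<And>a. a \<in> V \<Longrightarrow> h a < good_weight / 2 ^ d" by (auto simp: not_le)
    have "V \<noteq> {}" using sum assms by auto
    then have "(\<Sum>a\<in>V. h a) < (\<Sum>a\<in>V. good_weight / 2 ^ d)"
      using less by (intro sum_strict_mono) (auto simp: V_def)
    also have "\<dots> = real (card V) * (good_weight / 2 ^ d)" by simp
    also have "\<dots> \<le> 2 ^ d * (good_weight / 2 ^ d)"
    proof (rule mult_right_mono)
      have "real (card V) \<le> real (2 ^ d)" using card by (rule of_nat_mono)
      then show "real (card V) \<le> 2 ^ d" by simp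
    qed (use assms in simp)
    finally show False using sum by simp
  qed
  then show ?thesis using that by (auto simp: V_def h_def)
qed

text \<open>A cluster whose threshold lies in such a gap is left only by edges of angle at least \<open>h\<close>. This
  bounds the weight of an edge of angle close to \<open>0\<close> by its contribution to the expected cut.\<close>

lemma gap:
  fixes u :: "nat \<Rightarrow> real"
  assumes h: "0 < h"
  obtains k where "k \<le> 2 ^ d"
    "\<And>i. i < n \<Longrightarrow> \<bar>inner_prod d (v i) u\<bar> \<notin> {t0 + real k * h..<t0 + real (Suc k) * h}"
proof -
  define F where "F = (\<lambda>i. \<bar>inner_prod d (v i) u\<bar>) ` {..<n}"
  have "F \<subseteq> (\<lambda>x. \<bar>inner_prod d x u\<bar>) ` points"
  proof
    fix y assume "y \<in> F"
    then obtain i where i: "i < n" "y = \<bar>inner_prod d (v i) u\<bar>" by (auto simp: F_def)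
    then have "trunc_vec d (\<lambda>l. 1 * v i l) \<in> points" unfolding points_def by force
    then show "y \<in> (\<lambda>x. \<bar>inner_prod d x u\<bar>) ` points"
      using i(2) by (intro image_eqI[of _ _ "trunc_vec d (\<lambda>l. 1 * v i l)"]) (simp_all add: inner_prod_trunc)
  qed
  then have card: "card F \<le> 2 ^ d"
    using card_mono[OF finite_imageI[OF finite_points]] card_image_le[OF finite_points] card_points
    by (meson order.trans)
  have "\<exists>k\<le>2 ^ d. F \<inter> {t0 + real k * h..<t0 + real (Suc k) * h} = {}"
  proof (rule ccontr)
    assume "\<not> ?thesis"
    then have ne: "\<And>k. k \<le> 2 ^ d \<Longrightarrow> \<exists>x\<in>F. t0 + real k * h \<le> x \<and> x < t0 + real (Suc k) * h"
      by fastforce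
    \<comment> \<open>Each of the 2^d + 1 intervals would contain a value, and a value determines
      its interval; but there are at most 2^d values.\<close>
    have "{..2 ^ d} \<subseteq> (\<lambda>x. nat \<lfloor>(x - t0) / h\<rfloor>) ` F"
    proof
      fix k :: nat assume "k \<in> {..2 ^ d}"
      then obtain x where x: "x \<in> F" "t0 + real k * h \<le> x" "x < t0 + real (Suc k) * h" using ne by auto
      have "real k \<le> (x - t0) / h" "(x - t0) / h < real k + 1"
        using x h by (simp_all add: field_simps)
      then have "\<lfloor>(x - t0) / h\<rfloor> = int k" by (intro floor_unique) auto
      then show "k \<in> (\<lambda>x. nat \<lfloor>(x - t0) / h\<rfloor>) ` F" using x(1) by force
    qed
    then have "card {..2 ^ d :: nat} \<le> card F"
      by (metis F_def card_image_le card_mono finite_imageI finite_lessThan order.trans)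
    then show False using card by simp
  qed
  then show ?thesis using that by (fastforce simp: F_def)
qed

text \<open>The probability depends on the half-width alone. \<open>strip\<close> involves
  \<open>u\<close>, which is not yet chosen when the constants are fixed.\<close>

definition strip_prob :: "real \<Rightarrow> real" where
  "strip_prob \<delta> = measure std_normal_distribution {-\<delta>..\<delta>}"

text \<open>The losses: \<open>2 * s\<close> for vertices of the cluster in place of
  \<open>u\<close>, the \<open>\<delta>\<close> term for projections in place of neighbours, and the
  last one for bad edges leaving the cluster. \<open>\<epsilon> / 2\<close> appears because the
  inner products with \<open>u\<close> differ slightly from those along the edges.\<close>

lemma expected_gain:
  assumes s: "0 < s" "4 * s \<le> \<epsilon>" and \<delta>: "0 \<le> \<delta>"
    and lam: "0 \<le> \<kappa>" "\<kappa> \<le> 2 / pi * arcsin_coeff k * (1 / 2 ^ d - ((1 - \<epsilon> / 2) / (1 + \<epsilon> / 2)) ^ (2 * k + 1))"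
    and pos: "0 < good_weight"
    and rate: "0 \<le> strip_prob \<delta> * \<kappa> / 2 - 2 * s - 2 * strip_prob \<delta> * (\<delta> / (\<epsilon> / 2))"
  shows "\<exists>i0<n. \<exists>k0<n.
    good_weight / 2 ^ d * (strip_prob \<delta> * \<kappa> / 2 - 2 * s - 2 * strip_prob \<delta> * (\<delta> / (\<epsilon> / 2)))
      - strip_prob \<delta> * (pi * bad_value / (s\<^sup>2 / (2 ^ d + 1)))
    \<le> (\<integral>\<omega>. max 0 (cluster_gain d n E w v \<omega> i0 k0) \<partial>gauss_tape) \<and>
    integrable gauss_tape (\<lambda>\<omega>. max 0 (cluster_gain d n E w v \<omega> i0 k0))"
proof -
  obtain i0 where i0: "i0 < n"
    "good_weight / 2 ^ d \<le> (\<Sum>e\<in>{e\<in>good. trunc_vec d (v (fst e)) = trunc_vec d (v i0)}. weight e)"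
    using heavy_vertex[OF pos] by blast
  define u where "u = v i0"
  define f where "f i = \<bar>inner_prod d (v i) u\<bar>" for i
  \<comment> \<open>The 2^d + 1 candidate gaps of width \<open>h\<close> fill the interval from
    \<open>1 - 2 * s\<^sup>2\<close> to \<open>1 - s\<^sup>2\<close>. So the threshold is close to
    1, but below it, and \<open>i0\<close> belongs to the cluster.\<close>
  define h where "h = s\<^sup>2 / (2 ^ d + 1)"
  have pow1: "(0::real) < 2 ^ d + 1" by (rule add_pos_pos) auto
  have h: "0 < h" using s(1) pow1 by (simp add: h_def)
  have s2: "2 * s\<^sup>2 < \<epsilon>"
  proof -
    have "s * s \<le> (1 / 8) * s" using s eps by (intro mult_right_mono) auto
    then show ?thesis unfolding power2_eq_square using s by linarith
  qed
  have u: "inner_prod d u u = 1" using unit[OF i0(1)] by (simp add: u_def)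
  obtain k' where k': "k' \<le> 2 ^ d"
    "\<And>i. i < n \<Longrightarrow> f i \<notin> {(1 - 2 * s\<^sup>2) + real k' * h..<(1 - 2 * s\<^sup>2) + real (Suc k') * h}"
    using gap[OF h, of u "1 - 2 * s\<^sup>2"] unfolding f_def by blast
  define t where "t = (1 - 2 * s\<^sup>2) + real k' * h"
  have t_gap: "f i < t \<or> t + h \<le> f i" if "i < n" for i
    using k'(2)[OF that] by (auto simp: t_def algebra_simps)
  have t_lo: "1 - 2 * s\<^sup>2 \<le> t" using h by (simp add: t_def)
  have t_hi: "t \<le> 1"
  proof -
    have "real k' \<le> real (2 ^ d)" using k'(1) by (rule of_nat_mono)
    then have "real k' \<le> 2 ^ d" by (simp only: of_nat_power of_nat_numeral)
    then have "real k' \<le> 2 ^ d + 1" by linarith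
    then have "real k' * h \<le> (2 ^ d + 1) * h" using h by (intro mult_right_mono) auto
    also have "\<dots> = s\<^sup>2" using pow1 by (simp add: h_def)
    finally show ?thesis using zero_le_power2[of s] unfolding t_def by linarith
  qed
  have f0: "f i0 = 1" using u by (simp add: f_def u_def)
  \<comment> \<open>The program only uses values of vertices as thresholds; the smallest one not
    below \<open>t\<close> defines the same cluster.\<close>
  obtain k0 where k0: "k0 < n" "t \<le> f k0" "\<And>i. i < n \<Longrightarrow> t \<le> f i \<Longrightarrow> f k0 \<le> f i"
  proof -
    let ?S = "{i. i < n \<and> t \<le> f i}"
    have ne: "finite (f ` ?S)" "f ` ?S \<noteq> {}" using i0(1) f0 t_hi by auto
    obtain k0 where k0: "Min (f ` ?S) = f k0" "k0 \<in> ?S"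
      using Min_in[OF ne] by (rule imageE)
    show ?thesis
    proof (rule that[of k0])
      show "f k0 \<le> f i" if "i < n" "t \<le> f i" for i
        unfolding k0(1)[symmetric] using ne(1) that by (intro Min_le) auto
    qed (use k0(2) in auto)
  qed
  define C where "C = cluster d v i0 k0"
  have C: "i \<in> C \<longleftrightarrow> t \<le> f i" if "i < n" for i
  proof -
    have "i \<in> C \<longleftrightarrow> f k0 \<le> f i"
      unfolding C_def cluster_def f_def u_def by (simp add: abs_le_square_iff)
    then show ?thesis using k0 that order.trans by blast
  qed
  define cross where "cross e \<longleftrightarrow> (fst e \<in> C) \<noteq> (snd e \<in> C)" for e
  define inn where "inn e = (if fst e \<in> C then fst e else snd e)" for e
  define out where "out e = (if fst e \<in> C then snd e else fst e)" for e
  \<comment> \<open>Turns the inner endpoint towards \<open>u\<close> if it is near the antipode.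
    The outer endpoint gets the same factor, so \<open>rho e\<close> is unchanged and, for almost
    all tapes, so is the product of the signs.\<close>
  define \<sigma> :: "nat \<times> nat \<Rightarrow> real" where "\<sigma> e = (if inner_prod d (v (inn e)) u < 0 then -1 else 1)" for e
  define c where "c e = (\<lambda>l. \<sigma> e * v (inn e) l)" for e
  define b where "b e = (\<lambda>l. \<sigma> e * v (out e) l)" for e
  define A where "A = {e\<in>good. cross e}"
  have A: "e \<in> E" "e \<in> good" "cross e" if "e \<in> A" for e using that by (auto simp: A_def good_def)
  have io: "inn e < n" "out e < n" "inn e \<in> C" "out e \<notin> C" if "e \<in> E" "cross e" for e
    using edgeD[OF that(1)] that(2) by (auto simp: inn_def out_def cross_def)
  have \<sigma>2: "\<sigma> e * \<sigma> e = 1" "\<sigma> e \<in> {1, -1}" for e by (auto simp: \<sigma>_def)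
  have c_unit: "inner_prod d (c e) (c e) = 1" if "e \<in> E" "cross e" for e
    unfolding c_def inner_prod_scale_left inner_prod_scale_right using unit[OF io(1)[OF that]] \<sigma>2(1)[of e] by simp
  have b_unit: "inner_prod d (b e) (b e) = 1" if "e \<in> E" "cross e" for e
    unfolding b_def inner_prod_scale_left inner_prod_scale_right using unit[OF io(2)[OF that]] \<sigma>2(1)[of e] by simp
  have cu: "inner_prod d (c e) u = f (inn e)" for e
    unfolding c_def inner_prod_scale_left f_def by (auto simp: \<sigma>_def)
  have cu_ge: "1 - 2 * s\<^sup>2 \<le> inner_prod d (c e) u" if "e \<in> E" "cross e" for e
    using C[OF io(1)[OF that]] io(3)[OF that] t_lo by (simp add: cu)
  have cb: "inner_prod d (c e) (b e) = rho e" if "cross e" for e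
  proof -
    have "inner_prod d (c e) (b e) = inner_prod d (v (inn e)) (v (out e))"
      unfolding c_def b_def inner_prod_scale_left inner_prod_scale_right
      using \<sigma>2(1)[of e] by (simp flip: mult.assoc)
    also have "\<dots> = rho e"
      by (auto simp: inn_def out_def rho_def inner_prod_commute)
    finally show ?thesis .
  qed
  \<comment> \<open>The vectors \<open>u\<close> and \<open>c e\<close> are at distance at most
    \<open>2 * s\<close>, since their inner product is at least \<open>1 - 2 * s\<^sup>2\<close>.
    With \<open>4 * s \<le> \<epsilon>\<close> this moves the window by at most
    \<open>\<epsilon> / 2\<close>.\<close>
  have ub: "\<bar>inner_prod d u (b e) - rho e\<bar> \<le> 2 * s" if "e \<in> E" "cross e" for e
  proof -
    let ?x = "\<lambda>l. u l - c e l"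
    have "inner_prod d ?x (b e) = inner_prod d u (b e) - rho e"
      unfolding inner_prod_diff_left cb[OF that(2)] ..
    moreover have "inner_prod d ?x ?x = 2 - 2 * inner_prod d (c e) u"
      unfolding inner_prod_diff_left inner_prod_diff_right
      using u c_unit[OF that] by (simp add: inner_prod_commute[of d u "c e"])
    ultimately have "(inner_prod d u (b e) - rho e)\<^sup>2 \<le> 2 - 2 * inner_prod d (c e) u"
      using inner_prod_square_le[OF b_unit[OF that], of ?x] by simp
    also have "\<dots> \<le> (2 * s)\<^sup>2" using cu_ge[OF that] by (simp add: power_mult_distrib)
    finally have "\<bar>inner_prod d u (b e) - rho e\<bar> \<le> \<bar>2 * s\<bar>" by (simp only: abs_le_square_iff)
    then show ?thesis using s by simp
  qed
  interpret boundary_edges d u A weight b "\<epsilon> / 2"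
  proof
    show "finite A" using finite_E by (simp add: A_def good_def)
    show "0 \<le> weight e" if "e \<in> A" for e using edgeD A that by blast
    show "inner_prod d u u = 1" by (rule u)
    show "inner_prod d (b e) (b e) = 1" if "e \<in> A" for e using b_unit A that by blast
    show "0 < \<epsilon> / 2" "\<epsilon> / 2 < 1" using eps by auto
    show "-1 + \<epsilon> / 2 \<le> inner_prod d u (b e)" "inner_prod d u (b e) \<le> -(\<epsilon> / 2)" if "e \<in> A" for e
    proof -
      have "rho e \<in> {-1 + \<epsilon>..-\<epsilon>}" using A(2)[OF that] by (simp add: good_def)
      then show "-1 + \<epsilon> / 2 \<le> inner_prod d u (b e)" "inner_prod d u (b e) \<le> -(\<epsilon> / 2)"
        using ub[OF A(1)[OF that] A(3)[OF that]] s by (auto simp: abs_le_iff)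
    qed
    show "0 \<le> 1 + inner_prod d u (b e) + inner_prod d u (b f) + inner_prod d (b e) (b f)"
      if "e \<in> A" "f \<in> A" for e f
    proof -
      have "0 \<le> inner_prod d (\<lambda>l. \<sigma> e * v (out e) l - (-1) * v i0 l) (\<lambda>l. \<sigma> f * v (out f) l - (-1) * v i0 l)"
        using io(2)[OF A(1) A(3)] that i0(1) \<sigma>2(2) by (intro nonobtuse_signed) auto
      then have "0 \<le> inner_prod d (\<lambda>l. b e l + u l) (\<lambda>l. b f l + u l)"
        by (simp add: b_def u_def)
      then show ?thesis
        unfolding inner_prod_add_left inner_prod_add_right using u
        by (simp add: inner_prod_commute[of d "b e" u] algebra_simps)
    qed
  qed
  define cl where "cl e = trunc_vec d (b e)" for e
  have card_cl: "card (cl ` A) \<le> 2 ^ d"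
  proof -
    have "cl ` A \<subseteq> points"
    proof
      fix x assume "x \<in> cl ` A"
      then obtain e where e: "e \<in> A" "x = cl e" by blast
      then show "x \<in> points"
        using io(2)[OF A(1)[OF e(1)] A(3)[OF e(1)]] \<sigma>2(2)[of e]
        unfolding points_def cl_def b_def by (intro image_eqI[of _ _ "(\<sigma> e, out e)"]) auto
    qed
    then show ?thesis using card_mono[OF finite_points] card_points order.trans by blast
  qed
  have lam': "\<kappa> * total\<^sup>2 \<le> 2 / pi * (\<Sum>e\<in>A. \<Sum>f\<in>A. weight e * weight f * arcsin (inner_prod d (proj e) (proj f)))"
  proof -
    have "\<kappa> * total\<^sup>2 \<le> 2 / pi * arcsin_coeff k * (1 / 2 ^ d - slope ^ (2 * k + 1)) * total\<^sup>2"
      using lam(2) by (intro mult_right_mono) (auto simp: slope_def)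
    also have "\<dots> = 2 / pi * (arcsin_coeff k * (total\<^sup>2 * (1 / real (2 ^ d) - slope ^ (2 * k + 1))))"
      by simp
    also have "\<dots> \<le> 2 / pi * (arcsin_coeff k * (\<Sum>e\<in>A. \<Sum>f\<in>A. weight e * weight f * inner_prod d (proj e) (proj f) ^ (2 * k + 1)))"
    proof (intro mult_left_mono arcsin_coeff_nonneg proj_power_kernel_ge[OF _ card_cl])
      fix e f assume ef: "e \<in> A" "f \<in> A" "cl e = cl f"
      have "inner_prod d (b e) (b f) = inner_prod d (b e) (cl f)" by (simp add: cl_def inner_prod_trunc)
      also have "\<dots> = inner_prod d (b e) (cl e)" by (simp only: ef(3))
      also have "\<dots> = inner_prod d (b e) (b e)" by (simp add: cl_def inner_prod_trunc)
      finally have "inner_prod d (b e) (b f) = 1" using b ef by simp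
      moreover have "corr e = corr f"
        using ef(3) by (metis cl_def corr_def inner_prod_trunc(2))
      ultimately show "inner_prod d (b e) (b f) = 1 \<and> corr e = corr f" ..
    qed auto
    also have "\<dots> \<le> 2 / pi * (\<Sum>e\<in>A. \<Sum>f\<in>A. weight e * weight f * arcsin (inner_prod d (proj e) (proj f)))"
    proof (rule mult_left_mono)
      have "\<bar>inner_prod d (proj e) (proj f)\<bar> \<le> 1" if "e \<in> A" "f \<in> A" for e f
        using that by (intro Cauchy_Schwarz_inner_prod proj_unit)
      then show "arcsin_coeff k * (\<Sum>e\<in>A. \<Sum>f\<in>A. weight e * weight f * inner_prod d (proj e) (proj f) ^ (2 * k + 1))
          \<le> (\<Sum>e\<in>A. \<Sum>f\<in>A. weight e * weight f * arcsin (inner_prod d (proj e) (proj f)))"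
        by (rule arcsin_kernel_ge[OF fin])
    qed simp
    finally show ?thesis .
  qed
  have c_mismatch: "sign_mismatch d (c e) u \<le> s" if "e \<in> A" for e
  proof -
    note e = A(1)[OF that] A(3)[OF that]
    have cs: "\<bar>inner_prod d (c e) u\<bar> \<le> 1" using c_unit[OF e] u by (rule Cauchy_Schwarz_inner_prod)
    then have "(arccos (inner_prod d (c e) u) / pi)\<^sup>2 \<le> (1 - inner_prod d (c e) u) / 2"
      by (intro arccos_square_le) (auto simp: abs_le_iff)
    also have "\<dots> \<le> s\<^sup>2" using cu_ge[OF e] by simp
    finally have "arccos (inner_prod d (c e) u) / pi \<le> s" by (rule power2_le_imp_le) (use s in simp)
    then show ?thesis using sign_mismatch_eq[OF c_unit[OF e] u] by simp
  qed
  define R where "R = (\<Sum>e\<in>{e\<in>E - good. cross e}. weight e)"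
  have R0: "0 \<le> R" unfolding R_def using edgeD by (intro sum_nonneg) auto
  have R_le: "R \<le> pi * bad_value / h"
  proof -
    have each: "weight e \<le> pi / h * gw_value e" if e: "e \<in> E" "cross e" for e
    proof -
      let ?x = "\<lambda>l. v (fst e) l - v (snd e) l"
      \<comment> \<open>An edge leaving the cluster has one end below \<open>t\<close> and the other
        at \<open>t + h\<close> or above. Pairing with \<open>u\<close> does not lengthen the chord,
        and the chord is at most the angle.\<close>
      have "h \<le> \<bar>f (fst e) - f (snd e)\<bar>"
        using e(2) C edgeD[OF e(1)] t_gap[of "fst e"] t_gap[of "snd e"] by (auto simp: cross_def)
      also have "\<dots> \<le> \<bar>inner_prod d ?x u\<bar>"
        unfolding f_def inner_prod_diff_left by (rule abs_triangle_ineq3)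
      finally have h_le: "h \<le> \<bar>inner_prod d ?x u\<bar>" .
      have "(inner_prod d ?x u)\<^sup>2 \<le> inner_prod d ?x ?x" by (rule inner_prod_square_le[OF u])
      also have "\<dots> = 2 * (1 - rho e)"
        unfolding inner_prod_diff_left inner_prod_diff_right
        using unit edgeD[OF e(1)] by (simp add: rho_def inner_prod_commute[of d "v (snd e)" "v (fst e)"])
      also have "\<dots> \<le> (arccos (rho e))\<^sup>2" using edgeD[OF e(1)] by (intro arccos_square_ge)
      finally have "\<bar>inner_prod d ?x u\<bar> \<le> \<bar>arccos (rho e)\<bar>" by (simp only: abs_le_square_iff)
      also have "\<dots> = arccos (rho e)" using edgeD[OF e(1)] by (simp add: arccos_lbound)
      finally have "h \<le> arccos (rho e)" using h_le by simp
      then have "weight e * 1 \<le> weight e * (arccos (rho e) / h)"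
        using h edgeD[OF e(1)] by (intro mult_left_mono) auto
      then show ?thesis by (simp add: gw_value_def field_simps)
    qed
    have "R \<le> (\<Sum>e\<in>{e\<in>E - good. cross e}. pi / h * gw_value e)"
      unfolding R_def using each by (intro sum_mono) auto
    also have "\<dots> \<le> (\<Sum>e\<in>E - good. pi / h * gw_value e)"
      using finite_E h gw_value_nonneg by (intro sum_mono2) (auto intro!: mult_nonneg_nonneg)
    also have "\<dots> = pi * bad_value / h" unfolding bad_value_def sum_distrib_left[symmetric] by simp
    finally show ?thesis .
  qed
  define G where "G \<omega> = cluster_gain d n E w v \<omega> i0 k0" for \<omega>
  have G_eq: "G \<omega> = (\<Sum>e\<in>E. if cross e then weight e * (gw_sign d v \<omega> (fst e) * gw_sign d v \<omega> (snd e)) else 0)" for \<omega>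
    unfolding G_def cluster_gain_def flip_gain_eq[OF graph] C_def[symmetric]
    by (intro sum.cong refl) (simp add: case_prod_unfold cross_def weight_def)
  have G_meas: "G \<in> borel_measurable gauss_tape"
    unfolding G_eq gw_sign_def by measurable
  have G_bound: "\<bar>G \<omega>\<bar> \<le> (\<Sum>e\<in>E. weight e)" for \<omega>
    unfolding G_eq using edgeD
    by (intro order.trans[OF sum_abs] sum_mono) (auto simp: abs_mult gw_sign_def)
  have G_ge: "AE \<omega> in gauss_tape. (\<Sum>e\<in>A. weight e * (sgn_pm (inner_prod d (c e) \<omega>) * sgn_pm (inner_prod d (b e) \<omega>))) - R \<le> G \<omega>"
  proof -
    \<comment> \<open>\<open>sgn_pm\<close> fails to be odd only at 0, so the factors
      \<open>\<sigma>\<close> cancel outside this null set.\<close>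
    have "AE \<omega> in gauss_tape. \<forall>i\<in>{..<n}. \<omega> \<notin> {\<omega>. inner_prod d (v i) \<omega> = 0}"
    proof (rule AE_finite_allI)
      fix i assume "i \<in> {..<n}"
      then have "gauss.prob {\<omega>. inner_prod d (v i) \<omega> = 0} = 0" using unit by (intro gauss_null) auto
      then show "AE \<omega> in gauss_tape. \<omega> \<notin> {\<omega>. inner_prod d (v i) \<omega> = 0}"
        using gauss.prob_eq_0[of "{\<omega>. inner_prod d (v i) \<omega> = 0}"] by simp
    qed simp
    then show ?thesis
    proof eventually_elim
      fix \<omega> assume "\<forall>i\<in>{..<n}. \<omega> \<notin> {\<omega>. inner_prod d (v i) \<omega> = 0}"
      then have nz: "\<And>i. i < n \<Longrightarrow> inner_prod d (v i) \<omega> \<noteq> 0" by auto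
      have "sgn_pm (inner_prod d (c e) \<omega>) * sgn_pm (inner_prod d (b e) \<omega>) =
          gw_sign d v \<omega> (fst e) * gw_sign d v \<omega> (snd e)" if "e \<in> A" for e
      proof -
        note e = io[OF A(1)[OF that] A(3)[OF that]]
        have "sgn_pm (inner_prod d (c e) \<omega>) * sgn_pm (inner_prod d (b e) \<omega>) =
            gw_sign d v \<omega> (inn e) * gw_sign d v \<omega> (out e)"
          unfolding c_def b_def inner_prod_scale_left gw_sign_def
          using nz[OF e(1)] nz[OF e(2)] by (auto simp: sgn_pm_def \<sigma>_def)
        then show ?thesis by (simp add: inn_def out_def mult.commute)
      qed
      then have eqA: "(\<Sum>e\<in>A. weight e * (sgn_pm (inner_prod d (c e) \<omega>) * sgn_pm (inner_prod d (b e) \<omega>))) =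
          (\<Sum>e\<in>A. weight e * (gw_sign d v \<omega> (fst e) * gw_sign d v \<omega> (snd e)))"
        by (intro sum.cong) auto
      have "G \<omega> = (\<Sum>e\<in>{e\<in>E. cross e}. weight e * (gw_sign d v \<omega> (fst e) * gw_sign d v \<omega> (snd e)))"
        unfolding G_eq using finite_E by (rule sum.inter_filter[symmetric])
      also have "\<dots> = (\<Sum>e\<in>{e\<in>E - good. cross e}. weight e * (gw_sign d v \<omega> (fst e) * gw_sign d v \<omega> (snd e))) +
          (\<Sum>e\<in>A. weight e * (gw_sign d v \<omega> (fst e) * gw_sign d v \<omega> (snd e)))"
      proof -
        have "{e\<in>E. cross e} = {e\<in>E - good. cross e} \<union> A" "{e\<in>E - good. cross e} \<inter> A = {}"
          by (auto simp: A_def good_def)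
        then show ?thesis using finite_E fin by (simp add: sum.union_disjoint)
      qed
      finally have split: "G \<omega> = (\<Sum>e\<in>{e\<in>E - good. cross e}. weight e * (gw_sign d v \<omega> (fst e) * gw_sign d v \<omega> (snd e))) +
          (\<Sum>e\<in>A. weight e * (gw_sign d v \<omega> (fst e) * gw_sign d v \<omega> (snd e)))" .
      have "- R \<le> (\<Sum>e\<in>{e\<in>E - good. cross e}. weight e * (gw_sign d v \<omega> (fst e) * gw_sign d v \<omega> (snd e)))"
        unfolding R_def sum_negf[symmetric]
      proof (rule sum_mono)
        fix e assume "e \<in> {e\<in>E - good. cross e}"
        then have "0 \<le> weight e" using edgeD by blast
        then show "- weight e \<le> weight e * (gw_sign d v \<omega> (fst e) * gw_sign d v \<omega> (snd e))"
          by (auto simp: gw_sign_def sgn_pm_def)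
      qed
      then show "(\<Sum>e\<in>A. weight e * (sgn_pm (inner_prod d (c e) \<omega>) * sgn_pm (inner_prod d (b e) \<omega>))) - R \<le> G \<omega>"
        unfolding split
        unfolding eqA by linarith
    qed
  qed
  have strip_eq: "gauss.prob (strip \<delta>) = strip_prob \<delta>"
  proof -
    have "strip \<delta> = {\<omega>. inner_prod d u \<omega> \<in> {-\<delta>..\<delta>}}" by (auto simp: strip_def abs_le_iff)
    then show ?thesis using gauss_strip_law[OF u, of "{-\<delta>..\<delta>}"] by (simp add: strip_prob_def)
  qed
  have main: "total * (strip_prob \<delta> * \<kappa> / 2 - 2 * s - 2 * strip_prob \<delta> * (\<delta> / (\<epsilon> / 2))) - strip_prob \<delta> * R
      \<le> (\<integral>\<omega>. max 0 (G \<omega>) \<partial>gauss_tape)"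
    using strip_gain[OF lam' c_mismatch \<delta> R0 G_meas G_bound G_ge] unfolding strip_eq .
  have total_ge: "good_weight / 2 ^ d \<le> total"
  proof -
    \<comment> \<open>Every good edge that starts at the heavy vector leaves the cluster: its second
      end has value \<open>\<bar>rho e\<bar>\<close>, at most \<open>1 - \<epsilon>\<close>, which
      is below the threshold because \<open>2 * s\<^sup>2 < \<epsilon>\<close>.\<close>
    have "{e\<in>good. trunc_vec d (v (fst e)) = trunc_vec d (v i0)} \<subseteq> A"
    proof
      fix e assume "e \<in> {e\<in>good. trunc_vec d (v (fst e)) = trunc_vec d (v i0)}"
      then have e: "e \<in> good" "e \<in> E" "trunc_vec d (v (fst e)) = trunc_vec d (v i0)" "rho e \<in> {-1 + \<epsilon>..-\<epsilon>}"
        by (auto simp: good_def)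
      have same: "inner_prod d x (v (fst e)) = inner_prod d x u" for x
        using e(3) by (metis inner_prod_trunc(2) u_def)
      have "f (fst e) = 1"
        using same[of "v (fst e)"] unit[OF edgeD(1)[OF e(2)]] by (simp add: f_def)
      then have "fst e \<in> C" using C[OF edgeD(1)[OF e(2)]] t_hi by simp
      moreover have "f (snd e) = \<bar>rho e\<bar>"
        unfolding f_def rho_def same[symmetric] by (simp add: inner_prod_commute)
      then have "snd e \<notin> C" using C[OF edgeD(2)[OF e(2)]] t_lo s2 e(4) eps by auto
      ultimately show "e \<in> A" using e by (simp add: A_def cross_def)
    qed
    then have "(\<Sum>e\<in>{e\<in>good. trunc_vec d (v (fst e)) = trunc_vec d (v i0)}. weight e) \<le> total"
      unfolding total_def using fin W by (intro sum_mono2) auto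
    with i0(2) show ?thesis by linarith
  qed
  have "good_weight / 2 ^ d * (strip_prob \<delta> * \<kappa> / 2 - 2 * s - 2 * strip_prob \<delta> * (\<delta> / (\<epsilon> / 2)))
      \<le> total * (strip_prob \<delta> * \<kappa> / 2 - 2 * s - 2 * strip_prob \<delta> * (\<delta> / (\<epsilon> / 2)))"
    using total_ge rate by (intro mult_right_mono)
  moreover have "strip_prob \<delta> * R \<le> strip_prob \<delta> * (pi * bad_value / h)"
    using R_le by (intro mult_left_mono) (auto simp: strip_prob_def)
  ultimately have "good_weight / 2 ^ d * (strip_prob \<delta> * \<kappa> / 2 - 2 * s - 2 * strip_prob \<delta> * (\<delta> / (\<epsilon> / 2)))
      - strip_prob \<delta> * (pi * bad_value / h) \<le> (\<integral>\<omega>. max 0 (G \<omega>) \<partial>gauss_tape)"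
    using main by linarith
  moreover have "integrable gauss_tape (\<lambda>\<omega>. max 0 (G \<omega>))"
  proof (rule gauss_integrable_bounded)
    show "\<bar>max 0 (G \<omega>)\<bar> \<le> (\<Sum>e\<in>E. weight e)" for \<omega> using G_bound[of \<omega>] by (auto simp: max_def)
  qed (use G_meas in measurable)
  ultimately show ?thesis
    unfolding G_def h_def using i0(1) k0(1) by blast
qed

end

section \<open>The approximation guarantee\<close>

lemma borel_measurable_Max_insert_0:
  assumes "finite S" "\<And>p. p \<in> S \<Longrightarrow> f p \<in> borel_measurable M"
  shows "(\<lambda>\<omega>. Max (insert (0::real) ((\<lambda>p. f p \<omega>) ` S))) \<in> borel_measurable M"
  using assms
proof (induction S rule: finite_induct)
  case empty
  then show ?case by simp
next
  case (insert a S)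
  have "Max (insert 0 ((\<lambda>p. f p \<omega>) ` insert a S)) = max (f a \<omega>) (Max (insert 0 ((\<lambda>p. f p \<omega>) ` S)))" for \<omega>
    using insert.hyps(1) by (simp add: insert_commute[of 0] del: insert_commute)
  then show ?case using insert by auto
qed

context sdp_solution
begin

lemma cluster_gain_measurable: "(\<lambda>\<omega>. cluster_gain d n E w v \<omega> i k) \<in> borel_measurable gauss_tape"
  unfolding cluster_gain_def flip_gain_def gw_sign_def by measurable

text \<open>The pair may be fixed before the tape is drawn, since the maximum formed by the program
  dominates its positive part on every tape.\<close>

lemma expected_cut_ge:
  assumes int: "integrable gauss_tape (\<lambda>\<omega>. max 0 (cluster_gain d n E w v \<omega> i0 k0))" and i0: "i0 < n" "k0 < n"
  shows "(\<Sum>e\<in>E. gw_value e) + (\<integral>\<omega>. max 0 (cluster_gain d n E w v \<omega> i0 k0) \<partial>gauss_tape)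
    \<le> (\<integral>\<omega>. cut_weight E w (alg_cut rounding_algorithm d n E w v \<omega>) \<partial>gauss_tape)"
    and "(\<Sum>e\<in>E. gw_value e) \<le> (\<integral>\<omega>. cut_weight E w (alg_cut rounding_algorithm d n E w v \<omega>) \<partial>gauss_tape)"
proof -
  let ?X = "\<lambda>\<omega>. cut_weight E w (gw_sign d v \<omega>)"
  let ?Y = "\<lambda>\<omega>. cut_weight E w (alg_cut rounding_algorithm d n E w v \<omega>)"
  have Y: "?Y \<omega> = ?X \<omega> + Max (insert 0 ((\<lambda>p. cluster_gain d n E w v \<omega> (fst p) (snd p)) ` ({..<n} \<times> {..<n})))" for \<omega>
    using rounding_algorithm_output(2)[OF graph] by (simp add: case_prod_unfold)
  have meas: "?Y \<in> borel_measurable gauss_tape"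
    unfolding Y using expected_gw_cut(1)
    by (intro borel_measurable_add borel_measurable_Max_insert_0 cluster_gain_measurable) auto
  have "\<bar>?Y \<omega>\<bar> \<le> (\<Sum>e\<in>E. weight e)" for \<omega>
  proof -
    let ?D = "{(i, j)\<in>E. alg_cut rounding_algorithm d n E w v \<omega> i \<noteq> alg_cut rounding_algorithm d n E w v \<omega> j}"
    have eq: "?Y \<omega> = (\<Sum>e\<in>?D. weight e)" by (simp add: cut_weight_def weight_def case_prod_unfold)
    have "0 \<le> ?Y \<omega>" unfolding eq using edgeD(3) by (intro sum_nonneg) auto
    moreover have "?Y \<omega> \<le> (\<Sum>e\<in>E. weight e)"
      unfolding eq using edgeD(3) finite_E by (intro sum_mono2) auto
    ultimately show ?thesis by simp
  qed
  then have intY: "integrable gauss_tape ?Y" using meas by (rule gauss_integrable_bounded[rotated])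
  have Y_ge: "?X \<omega> + max 0 (cluster_gain d n E w v \<omega> i0 k0) \<le> ?Y \<omega>" for \<omega>
    unfolding Y using i0 by (intro add_left_mono max.boundedI Max_ge) (auto simp: image_iff intro!: bexI[of _ "(i0, k0)"])
  have "(\<integral>\<omega>. ?X \<omega> + max 0 (cluster_gain d n E w v \<omega> i0 k0) \<partial>gauss_tape) \<le> (\<integral>\<omega>. ?Y \<omega> \<partial>gauss_tape)"
    using expected_gw_cut(1) int intY Y_ge by (intro integral_mono) auto
  then show 1: "(\<Sum>e\<in>E. gw_value e) + (\<integral>\<omega>. max 0 (cluster_gain d n E w v \<omega> i0 k0) \<partial>gauss_tape) \<le> (\<integral>\<omega>. ?Y \<omega> \<partial>gauss_tape)"
    using expected_gw_cut int by simp
  have "0 \<le> (\<integral>\<omega>. max 0 (cluster_gain d n E w v \<omega> i0 k0) \<partial>gauss_tape)"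
    by (rule Bochner_Integration.integral_nonneg) simp
  with 1 show "(\<Sum>e\<in>E. gw_value e) \<le> (\<integral>\<omega>. ?Y \<omega> \<partial>gauss_tape)" by linarith
qed

lemma sdp_value_nonneg: "0 \<le> sdp_value d E w v"
  unfolding sdp_value_eq edge_value_def using edgeD by (intro sum_nonneg mult_nonneg_nonneg) auto

lemma bad_value_nonneg: "0 \<le> bad_value"
  unfolding bad_value_def using gw_value_nonneg by (intro sum_nonneg) auto

lemma strip_prob_ge: "0 \<le> \<delta> \<Longrightarrow> \<delta> \<le> 1 \<Longrightarrow> \<delta> / 3 \<le> strip_prob \<delta>"
proof -
  assume \<delta>: "0 \<le> \<delta>" "\<delta> \<le> 1"
  have u: "inner_prod (Suc 0) (\<lambda>_. 1) (\<lambda>_. 1) = 1" by (simp add: inner_prod_def)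
  have "{\<omega>. \<bar>inner_prod (Suc 0) (\<lambda>_. 1) \<omega>\<bar> \<le> \<delta>} = {\<omega>. inner_prod (Suc 0) (\<lambda>_. 1) \<omega> \<in> {-\<delta>..\<delta>}}"
    by (auto simp: abs_le_iff)
  then show ?thesis
    using gauss_strip(2)[OF u \<delta>] gauss_strip_law[OF u, of "{-\<delta>..\<delta>}"] by (simp add: strip_prob_def)
qed

text \<open>If the bad edges carry at least a share \<open>q\<close> of the SDP value, the excess of
  plain rounding suffices; otherwise they are too light to spoil the gain of the cluster.\<close>

lemma approximation:
  assumes lam: "0 < \<kappa>" "\<kappa> \<le> 1" "\<kappa> \<le> 2 / pi * arcsin_coeff k * (1 / 2 ^ d - ((1 - \<epsilon> / 2) / (1 + \<epsilon> / 2)) ^ (2 * k + 1))"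
    and s: "s = \<epsilon> / 2 * \<kappa>\<^sup>2 / 384"
  shows "(alpha_GW + \<kappa> * s\<^sup>2 / (2048 * 2 ^ d * (2 ^ d + 1))) * sdp_value d E w v
    \<le> (\<integral>\<omega>. cut_weight E w (alg_cut rounding_algorithm d n E w v \<omega>) \<partial>gauss_tape)"
proof -
  define S M where "S = sdp_value d E w v" and "M = (2 :: real) ^ d"
  \<comment> \<open>The main term is half of \<open>P * \<kappa>\<close>. This choice makes the
    projection error a quarter of \<open>P * \<kappa>\<close>; with
    \<open>s = \<delta> * \<kappa> / 48\<close> and \<open>\<delta> / 3 \<le> P\<close> the cluster
    error is at most an eighth, and an eighth remains.\<close>
  define \<delta> where "\<delta> = \<epsilon> / 2 * \<kappa> / 8"
  define P where "P = strip_prob \<delta>"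
  \<comment> \<open>Chosen so that, with \<open>pi\<close> rounded up to 4, the loss from bad edges
    is at most half of the main gain \<open>S / 2 / M * (P * \<kappa> / 8)\<close>.\<close>
  define q where "q = \<kappa> * s\<^sup>2 / (128 * M * (M + 1))"
  let ?cut = "\<integral>\<omega>. cut_weight E w (alg_cut rounding_algorithm d n E w v \<omega>) \<partial>gauss_tape"
  have M: "1 \<le> M" by (simp add: M_def)
  have \<delta>: "0 < \<delta>" "\<delta> \<le> 1 / 16"
  proof -
    show "0 < \<delta>" using lam eps by (simp add: \<delta>_def)
    have "\<epsilon> / 2 * \<kappa> \<le> (1 / 2) * 1" using lam eps by (intro mult_mono) auto
    then show "\<delta> \<le> 1 / 16" by (simp add: \<delta>_def)
  qed
  have s_eq: "s = \<delta> * \<kappa> / 48" by (simp add: s \<delta>_def power2_eq_square)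
  have "\<delta> * \<kappa> \<le> \<delta> * 1" using lam \<delta> by (intro mult_left_mono) auto
  then have s_le: "0 < s" "s \<le> \<delta>" using lam \<delta> by (auto simp: s_eq)
  have s_eps: "4 * s \<le> \<epsilon>"
  proof -
    have "\<epsilon> * \<kappa>\<^sup>2 \<le> \<epsilon> * 1" using lam eps by (intro mult_left_mono power_le_one) auto
    then show ?thesis using eps by (simp add: s)
  qed
  have P: "\<delta> / 3 \<le> P" unfolding P_def using \<delta> by (intro strip_prob_ge) auto
  have s2: "s\<^sup>2 \<le> s"
    using s_le \<delta> by (simp add: power2_eq_square mult_left_le)
  have q: "0 < q" "q \<le> 1 / 128"
  proof -
    show "0 < q" using lam s_le M by (simp add: q_def)
    have "\<kappa> * s\<^sup>2 \<le> 1 * 1" using lam s2 s_le \<delta> by (intro mult_mono) auto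
    moreover have "1 * 1 \<le> M * (M + 1)" using M by (intro mult_mono) auto
    ultimately show "q \<le> 1 / 128" unfolding q_def using M by (simp add: field_simps)
  qed
  have target: "(alpha_GW + \<kappa> * s\<^sup>2 / (2048 * 2 ^ d * (2 ^ d + 1))) * S = alpha_GW * S + q * S / 16"
    by (simp add: q_def M_def algebra_simps)
  have S0: "0 \<le> S" unfolding S_def by (rule sdp_value_nonneg)
  show ?thesis
  proof (cases "q * S \<le> bad_value")
    case True
    show ?thesis
    \<comment> \<open>Without vertices there is no pair to instantiate
      \<open>expected_cut_ge\<close> with.\<close>
    proof (cases "n = 0")
      case True
      then have "E = {}" using edge by fastforce
      then show ?thesis by (simp add: sdp_value_def cut_weight_def)
    next
      case False
      have "\<bar>max 0 (cluster_gain d n E w v \<omega> 0 0)\<bar> \<le> (\<Sum>e\<in>E. weight e)" for \<omega>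
      proof -
        have "\<bar>cluster_gain d n E w v \<omega> 0 0\<bar> \<le> (\<Sum>e\<in>E. weight e)"
          unfolding cluster_gain_def flip_gain_eq[OF graph] case_prod_unfold
          using edgeD(3) by (intro order.trans[OF sum_abs] sum_mono) (auto simp: abs_mult gw_sign_def weight_def)
        then show ?thesis by (auto simp: max_def)
      qed
      then have "integrable gauss_tape (\<lambda>\<omega>. max 0 (cluster_gain d n E w v \<omega> 0 0))"
        by (rule gauss_integrable_bounded[rotated])
           (intro borel_measurable_max borel_measurable_const cluster_gain_measurable)
      then have "(\<Sum>e\<in>E. gw_value e) \<le> ?cut" using False by (intro expected_cut_ge(2)) auto
      then show ?thesis using gw_excess \<open>q * S \<le> bad_value\<close> unfolding target[unfolded S_def] S_def by linarith
    qed
  next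
    case False
    then have bad: "bad_value < q * S" by simp
    have S: "0 < S" using bad bad_value_nonneg q S0 by (cases "S = 0") auto
    have "q * S \<le> 1 / 128 * S" using q S0 by (intro mult_right_mono) auto
    then have good: "S / 2 \<le> good_weight" using good_weight_ge bad S0 unfolding S_def by linarith
    have rate: "P * \<kappa> / 8 \<le> P * \<kappa> / 2 - 2 * s - 2 * P * (\<delta> / (\<epsilon> / 2))"
    proof -
      have "2 * P * (\<delta> / (\<epsilon> / 2)) = P * \<kappa> / 4" using eps by (simp add: \<delta>_def)
      moreover have "\<delta> / 3 * \<kappa> \<le> P * \<kappa>" using P lam by (intro mult_right_mono) auto
      then have "2 * s \<le> P * \<kappa> / 8" by (simp add: s_eq)
      ultimately show ?thesis by linarith
    qed
    have P0: "0 \<le> P * \<kappa> / 8" using P \<delta> lam by (intro divide_nonneg_nonneg mult_nonneg_nonneg) auto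
    obtain i0 k0 where ik: "i0 < n" "k0 < n" and int: "integrable gauss_tape (\<lambda>\<omega>. max 0 (cluster_gain d n E w v \<omega> i0 k0))"
      and gain: "good_weight / 2 ^ d * (P * \<kappa> / 2 - 2 * s - 2 * P * (\<delta> / (\<epsilon> / 2)))
        - P * (pi * bad_value / (s\<^sup>2 / (2 ^ d + 1)))
        \<le> (\<integral>\<omega>. max 0 (cluster_gain d n E w v \<omega> i0 k0) \<partial>gauss_tape)"
    proof -
      have "0 \<le> \<delta>" "0 \<le> \<kappa>" "0 < good_weight" using \<delta> lam good S by linarith+
      moreover have "0 \<le> strip_prob \<delta> * \<kappa> / 2 - 2 * s - 2 * strip_prob \<delta> * (\<delta> / (\<epsilon> / 2))"
        using rate P0 unfolding P_def by linarith
      ultimately show ?thesis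
        using expected_gain[OF s_le(1) s_eps _ _ lam(3)] that unfolding P_def by blast
    qed
    have main: "P * (S * \<kappa> / (32 * M)) \<le> (\<integral>\<omega>. max 0 (cluster_gain d n E w v \<omega> i0 k0) \<partial>gauss_tape)"
    proof -
      have "S / 2 / M * (P * \<kappa> / 8) \<le> good_weight / M * (P * \<kappa> / 2 - 2 * s - 2 * P * (\<delta> / (\<epsilon> / 2)))"
        using good rate P0 M S by (intro mult_mono divide_right_mono) auto
      moreover have "P * (pi * bad_value / (s\<^sup>2 / (M + 1))) \<le> P * (S * \<kappa> / (32 * M))"
      proof (rule mult_left_mono)
        have "pi * bad_value \<le> 4 * (q * S)"
          using pi_less_4 bad bad_value_nonneg by (intro mult_mono) auto
        then have "pi * bad_value / (s\<^sup>2 / (M + 1)) \<le> 4 * (q * S) / (s\<^sup>2 / (M + 1))"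
          using M by (intro divide_right_mono) auto
        also have "\<dots> = S * \<kappa> / (32 * M)"
        proof -
          have "4 * (\<kappa> * a / (128 * M * N) * S) / (a / N) = S * \<kappa> / (32 * M)" if "a \<noteq> 0" "N \<noteq> 0" for a N
            using that M by (simp add: field_simps)
          then show ?thesis unfolding q_def using s_le M by simp
        qed
        finally show "pi * bad_value / (s\<^sup>2 / (M + 1)) \<le> S * \<kappa> / (32 * M)" .
        show "0 \<le> P" using P \<delta> by simp
      qed
      moreover have "S / 2 / M * (P * \<kappa> / 8) = 2 * (P * (S * \<kappa> / (32 * M)))" by simp
      ultimately show ?thesis using gain unfolding M_def by linarith
    qed
    have "q * S / 16 \<le> P * (S * \<kappa> / (32 * M))"
    proof -
      \<comment> \<open>The demanded improvement is below the gain just found, because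
        \<open>s\<^sup>2 / 3\<close> is at most \<open>\<delta> / 3\<close> and hence at most
        \<open>P\<close>.\<close>
      have "q * S / 16 = s\<^sup>2 / (64 * (M + 1)) * (S * \<kappa> / (32 * M))"
        by (simp add: q_def algebra_simps)
      also have "\<dots> \<le> P * (S * \<kappa> / (32 * M))"
      proof (rule mult_right_mono)
        have "s\<^sup>2 / (64 * (M + 1)) \<le> s\<^sup>2 / 3" using M by (intro divide_left_mono) auto
        also have "\<dots> \<le> P" using s2 s_le P by linarith
        finally show "s\<^sup>2 / (64 * (M + 1)) \<le> P" .
      qed (use S lam M in auto)
      finally show ?thesis .
    qed
    then have "alpha_GW * S + q * S / 16 \<le> ?cut"
      using main expected_cut_ge(1)[OF int ik] gw_excess bad_value_nonneg unfolding S_def by linarith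
    then show ?thesis using target by (simp add: S_def)
  qed
qed

end

text \<open>The right side has degree 5 in \<open>\<mu> ^ (d + 1)\<close>, once from the kernel
  constant and four times from the square of \<open>s\<close>, over at most 4^(d+1). For
  \<open>d \<ge> 1\<close> the remaining constants are absorbed into the base, because
  \<open>C\<close> and \<open>B\<close> are at most 1.\<close>

lemma exponential_lower_bound:
  fixes \<epsilon> \<mu> :: real
  assumes \<epsilon>: "0 < \<epsilon>" "\<epsilon> < 1 / 2" and \<mu>: "0 < \<mu>" "\<mu> \<le> 1"
  shows "\<exists>c>0. \<forall>d::nat. d \<ge> 1 \<longrightarrow> 2 powr (- (c * real d)) \<le>
    \<mu> ^ (d + 1) * (\<epsilon> / 2 * (\<mu> ^ (d + 1))\<^sup>2 / 384)\<^sup>2 / (2048 * 2 ^ d * (2 ^ d + 1))"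
proof -
  define C where "C = (\<epsilon> / 768)\<^sup>2 / 2048"
  define B where "B = \<mu> ^ 5 / 4"
  define x where "x = C * B\<^sup>2"
  have C: "0 < C" "C \<le> 1"
  proof -
    have "(\<epsilon> / 768)\<^sup>2 \<le> 1" using \<epsilon> by (intro power_le_one) auto
    then show "0 < C" "C \<le> 1" using \<epsilon> by (auto simp: C_def)
  qed
  have B: "0 < B" "B < 1"
    using \<mu> power_le_one[of \<mu> 5] by (auto simp: B_def)
  have x: "0 < x" "x < 1"
  proof -
    show "0 < x" using C B by (simp add: x_def)
    have "B\<^sup>2 < 1" using B by (simp add: power_less_one_iff)
    then have "C * B\<^sup>2 < 1 * 1" using C B by (intro mult_le_less_imp_less) auto
    then show "x < 1" by (simp add: x_def)
  qed
  define c where "c = - log 2 x"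
  have "0 < c" using x by (simp add: c_def)
  moreover have "2 powr (- (c * real d)) \<le>
      \<mu> ^ (d + 1) * (\<epsilon> / 2 * (\<mu> ^ (d + 1))\<^sup>2 / 384)\<^sup>2 / (2048 * 2 ^ d * (2 ^ d + 1))" if d: "d \<ge> 1" for d
  proof -
    define y where "y = \<mu> ^ (d + 1)"
    have y: "0 < y" using \<mu> by (simp add: y_def)
    have "2 powr (- (c * real d)) = (2 powr log 2 x) powr real d"
      by (simp add: c_def powr_powr)
    also have "\<dots> = x ^ d" using x by (simp add: powr_realpow)
    also have "\<dots> = C ^ d * B ^ (2 * d)" by (simp add: x_def power_mult_distrib power_mult)
    also have "\<dots> \<le> C ^ 1 * B ^ (d + 1)"
      using C B d by (intro mult_mono power_decreasing) auto
    also have "\<dots> = C * y ^ 5 / 4 ^ (d + 1)"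
      by (simp only: B_def y_def power_divide power_one_right power_mult[symmetric] mult.commute[of 5] times_divide_eq_right)
    also have "\<dots> \<le> C * y ^ 5 / (2 ^ d * (2 ^ d + 1))"
    proof (rule divide_left_mono)
      have "(2::real) ^ d * (2 ^ d + 1) \<le> 2 ^ d * (4 * 2 ^ d)"
      proof (rule mult_left_mono)
        have "(1::real) \<le> 2 ^ d" by simp
        then show "(2::real) ^ d + 1 \<le> 4 * 2 ^ d" by linarith
      qed simp
      also have "\<dots> = 4 ^ (d + 1)"
        by (simp flip: power_mult_distrib)
      finally show "(2::real) ^ d * (2 ^ d + 1) \<le> 4 ^ (d + 1)" .
      show "0 < 4 ^ (d + 1) * ((2::real) ^ d * (2 ^ d + 1))" by (simp add: add_pos_pos)
    qed (use C y in simp)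
    also have "\<dots> = y * (\<epsilon> / 2 * y\<^sup>2 / 384)\<^sup>2 / (2048 * 2 ^ d * (2 ^ d + 1))"
      by (simp add: C_def power_divide power_mult_distrib eval_nat_numeral)
    finally show ?thesis by (simp only: y_def)
  qed
  ultimately show ?thesis by blast
qed

theorem theorem1:
  shows "\<exists>c::real. c > 0 \<and> (\<exists>A::cmd. poly_time A \<and>
    (\<forall>(d::nat) (n::nat) (E::(nat \<times> nat) set) (w::nat \<Rightarrow> nat \<Rightarrow> real) (v::nat \<Rightarrow> nat \<Rightarrow> real).
       d \<ge> 1 \<longrightarrow> weighted_graph n E w \<longrightarrow> sdp_feasible d n v \<longrightarrow>
         (\<forall>\<omega>. \<forall>i<n. alg_cut A d n E w v \<omega> i \<in> {1, -1}) \<and>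
         (\<integral>\<omega>. cut_weight E w (alg_cut A d n E w v \<omega>) \<partial>gauss_tape)
           \<ge> (alpha_GW + 2 powr (- (c * real d))) * sdp_value d E w v))"
proof -
  obtain \<epsilon> :: real where \<epsilon>: "0 < \<epsilon>" "\<epsilon> < 1 / 2" "\<And>\<rho>. -1 \<le> \<rho> \<Longrightarrow> \<rho> \<le> 1 \<Longrightarrow> \<rho> \<notin> {-1 + \<epsilon>..-\<epsilon>} \<Longrightarrow>
      19 / 20 * ((1 - \<rho>) / 2) \<le> arccos \<rho> / pi"
    using ratio_away_from_critical by blast
  define \<tau> where "\<tau> = (1 - \<epsilon> / 2) / (1 + \<epsilon> / 2)"
  have \<tau>: "0 \<le> \<tau>" "\<tau> < 1" using \<epsilon> by (auto simp: \<tau>_def)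
  \<comment> \<open>At degree parameter \<open>L * (d + 1)\<close> the power of
    \<open>\<tau>\<close> is at most \<open>(1 / 2) ^ (d + 1)\<close>, which is half of the term
    \<open>1 / 2 ^ d\<close> from coinciding neighbours.\<close>
  obtain L where L: "\<tau> ^ L < 1 / 2" using real_arch_pow_inv[of "1/2" \<tau>] \<tau> by auto
  \<comment> \<open>One factor 1/2 accounts for \<open>2 / pi\<close>, one for the surviving half of
    \<open>1 / 2 ^ d\<close>, and \<open>12 ^ L\<close> comes from \<open>arcsin_coeff_ge\<close>;
    each is raised to the power \<open>d + 1\<close>.\<close>
  define \<mu> :: real where "\<mu> = 1 / (12 ^ L * 4)"
  have \<mu>: "0 < \<mu>" "\<mu> \<le> 1"
  proof -
    have "(1::real) \<le> 12 ^ L" by simp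
    then have "(1::real) \<le> 12 ^ L * 4" by linarith
    then show "0 < \<mu>" "\<mu> \<le> 1" by (auto simp: \<mu>_def)
  qed
  obtain c where c: "c > 0" "\<And>d::nat. d \<ge> 1 \<Longrightarrow> 2 powr (- (c * real d)) \<le>
      \<mu> ^ (d + 1) * (\<epsilon> / 2 * (\<mu> ^ (d + 1))\<^sup>2 / 384)\<^sup>2 / (2048 * 2 ^ d * (2 ^ d + 1))"
    using exponential_lower_bound[OF \<epsilon>(1,2) \<mu>] by blast
  have kernel: "\<mu> ^ (d + 1) \<le> 2 / pi * arcsin_coeff (L * (d + 1)) * (1 / 2 ^ d - \<tau> ^ (2 * (L * (d + 1)) + 1))" for d
  proof -
    have "\<tau> ^ (2 * (L * (d + 1)) + 1) \<le> \<tau> ^ (L * (d + 1))"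
      using \<tau> by (intro power_decreasing) auto
    also have "\<dots> = (\<tau> ^ L) ^ (d + 1)" by (rule power_mult)
    also have "\<dots> \<le> (1 / 2) ^ (d + 1)" using L \<tau> by (intro power_mono) auto
    finally have 1: "(1 / 2) ^ (d + 1) \<le> 1 / 2 ^ d - \<tau> ^ (2 * (L * (d + 1)) + 1)"
      by (simp add: power_one_over field_simps)
    have 2: "(1 / 12 ^ L) ^ (d + 1) \<le> arcsin_coeff (L * (d + 1))"
      using arcsin_coeff_ge[of "L * (d + 1)"] by (simp only: power_mult power_one_over)
    have 3: "(1 / 2) ^ (d + 1) \<le> 2 / pi"
    proof -
      have "(1 / 2 :: real) ^ (d + 1) \<le> (1 / 2) ^ 1" by (intro power_decreasing) auto
      also have "\<dots> \<le> 2 / pi" using pi_less_4 by (simp add: field_simps)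
      finally show ?thesis .
    qed
    have "\<mu> = 1 / 2 * (1 / 12 ^ L) * (1 / 2)" by (simp add: \<mu>_def)
    then have "\<mu> ^ (d + 1) = (1 / 2) ^ (d + 1) * (1 / 12 ^ L) ^ (d + 1) * (1 / 2) ^ (d + 1)"
      by (simp only: power_mult_distrib)
    also have "\<dots> \<le> 2 / pi * arcsin_coeff (L * (d + 1)) * (1 / 2 ^ d - \<tau> ^ (2 * (L * (d + 1)) + 1))"
      using 1 2 3 arcsin_coeff_nonneg by (intro mult_mono) auto
    finally show ?thesis .
  qed
  have "(alpha_GW + 2 powr (- (c * real d))) * sdp_value d E w v \<le>
      (\<integral>\<omega>. cut_weight E w (alg_cut rounding_algorithm d n E w v \<omega>) \<partial>gauss_tape)"
    if d: "d \<ge> 1" and G: "weighted_graph n E w" and v: "sdp_feasible d n v" for d n E w v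
  proof -
    interpret sdp_solution d n E w v \<epsilon>
      using G v \<epsilon> by unfold_locales
    have "(alpha_GW + 2 powr (- (c * real d))) * sdp_value d E w v \<le>
        (alpha_GW + \<mu> ^ (d + 1) * (\<epsilon> / 2 * (\<mu> ^ (d + 1))\<^sup>2 / 384)\<^sup>2 / (2048 * 2 ^ d * (2 ^ d + 1))) * sdp_value d E w v"
      using c(2)[OF d] sdp_value_nonneg by (intro mult_right_mono add_left_mono)
    also have "\<dots> \<le> (\<integral>\<omega>. cut_weight E w (alg_cut rounding_algorithm d n E w v \<omega>) \<partial>gauss_tape)"
    proof (rule approximation[OF _ _ kernel[of d, unfolded \<tau>_def] refl])
      show "0 < \<mu> ^ (d + 1)" using \<mu>(1) by (rule zero_less_power)
      show "\<mu> ^ (d + 1) \<le> 1" using \<mu> by (intro power_le_one) auto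
    qed
    finally show ?thesis .
  qed
  then show ?thesis
    using c(1) poly_time_rounding_algorithm rounding_algorithm_output(1)
    by (intro exI[of _ c] conjI exI[of _ rounding_algorithm]) auto
qed

end
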